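(* Let $\mathscr{A}$ be a von Neumann algebra. Then $\mathscr{A}$ is duplicable if and only if there is a set $X$ such that $\mathscr{A}$ is MIU-isomorphic to $\ell^\infty(X)$. In that case, the duplicator $(\delta,u)$ on $\mathscr{A}$ is unique, and it is given by $\delta(a\otimes b)=a\cdot b$ (for all $a,b\in\mathscr{A}$) and $u=1$.
   Context: $\otimes$ denotes the spatial tensor product of von Neumann algebras. A positive linear map between von Neumann algebras is normal if it preserves suprema of bounded directed sets of self-adjoint elements, and subunital if $f(1)\le 1$. A duplicator on a von Neumann algebra $\mathscr{A}$ is a normal positive subunital linear map $\delta\colon\mathscr{A}\otimes\mathscr{A}\to\mathscr{A}$ together with an element $u\in\mathscr{A}$, called its unit, with $0\le u\le 1$, such that $\delta(a\otimes u)=a=\delta(u\otimes a)$ for all $a\in\mathscr{A}$. $\mathscr{A}$ is duplicable if there is a duplicator on $\mathscr{A}$. For a set $X$, $\ell^\infty(X)$ is the von Neumann algebra of bounded functions $X\to\mathbb{C}$ with pointwise operations. A MIU-map is a linear map that is multiplicative, involution-preserving and unital (a unital $*$-homomorphism); a MIU-isomorphism is a bijective MIU-map (automatically normal). *)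

theory Defs
  imports "HOL-Analysis.Analysis"
begin

section \<open>Complex Hilbert spaces\<close>

class scaleC =
  fixes scaleC :: "complex \<Rightarrow> 'a \<Rightarrow> 'a" (infixr "*\<^sub>C" 75)

(* cinner is conjugate-linear in its first argument; norm and topology come from its real part *)
class complex_hilbert = scaleC + real_inner + complete_space +
  fixes cinner :: "'a \<Rightarrow> 'a \<Rightarrow> complex"
  assumes scaleC_add_right: "c *\<^sub>C (x + y) = c *\<^sub>C x + c *\<^sub>C y"
    and scaleC_add_left: "(c + d) *\<^sub>C x = c *\<^sub>C x + d *\<^sub>C x"
    and scaleC_scaleC: "c *\<^sub>C d *\<^sub>C x = (c * d) *\<^sub>C x"
    and scaleR_scaleC: "r *\<^sub>R x = complex_of_real r *\<^sub>C x"
    and cinner_commute: "cinner x y = cnj (cinner y x)"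
    and cinner_add_right: "cinner x (y + z) = cinner x y + cinner x z"
    and cinner_scaleC_right: "cinner x (c *\<^sub>C y) = c * cinner x y"
    and inner_cinner: "inner x y = Re (cinner x y)"

instance complex_hilbert \<subseteq> banach ..

instantiation complex :: complex_hilbert
begin

definition scaleC_complex_def: "c *\<^sub>C (x::complex) = c * x"
definition cinner_complex_def: "cinner (x::complex) y = cnj x * y"

instance
  by standard
    (auto simp: scaleC_complex_def cinner_complex_def algebra_simps scaleR_conv_of_real
      inner_complex_def)

end

lemma scaleC_one [simp]: "1 *\<^sub>C (x::'a::complex_hilbert) = x"
  using scaleR_scaleC[of 1 x] by simp

lemma scaleC_zero_right [simp]: "c *\<^sub>C (0::'a::complex_hilbert) = 0"
  using scaleC_add_right[of c 0 "0::'a"] by simp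

lemma cinner_zero_right [simp]: "cinner x (0::'a::complex_hilbert) = 0"
  using cinner_add_right[of x 0 0] by simp

lemma cinner_zero_left [simp]: "cinner (0::'a::complex_hilbert) x = 0"
  by (subst cinner_commute) simp

lemma cinner_add_left: "cinner (x + y) (z::'a::complex_hilbert) = cinner x z + cinner y z"
  using cinner_commute[of "x + y" z] cinner_commute[of x z] cinner_commute[of y z]
  by (simp add: cinner_add_right)

lemma cinner_scaleC_left: "cinner (c *\<^sub>C x) (y::'a::complex_hilbert) = cnj c * cinner x y"
  using cinner_commute[of "c *\<^sub>C x" y] cinner_commute[of x y] by (simp add: cinner_scaleC_right)

lemma cinner_minus_right: "cinner x (- y::'a::complex_hilbert) = - cinner x y"
  by (metis add.right_inverse cinner_add_right cinner_zero_right minus_unique)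

lemma cinner_diff_right: "cinner x (y - z::'a::complex_hilbert) = cinner x y - cinner x z"
  using cinner_add_right[of x y "-z"] by (simp add: cinner_minus_right)

lemma cinner_diff_left: "cinner (x - y) (z::'a::complex_hilbert) = cinner x z - cinner y z"
  using cinner_diff_right[of z x y] by (metis cinner_commute complex_cnj_diff)

lemma cinner_sum_right: "cinner x (\<Sum>i\<in>A. f i) = (\<Sum>i\<in>A. cinner x (f i::'a::complex_hilbert))"
  by (induction A rule: infinite_finite_induct) (auto simp: cinner_add_right)

lemma cinner_sum_left: "cinner (\<Sum>i\<in>A. f i) x = (\<Sum>i\<in>A. cinner (f i::'a::complex_hilbert) x)"
  by (induction A rule: infinite_finite_induct) (auto simp: cinner_add_left)

lemma cinner_self: "cinner x (x::'a::complex_hilbert) = complex_of_real ((norm x)\<^sup>2)"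
proof -
  have "Im (cinner x x) = 0"
    using arg_cong[OF cinner_commute[of x x], of Im] by simp
  then show ?thesis
    by (simp add: complex_eq_iff power2_norm_eq_inner inner_cinner)
qed

lemma cinner_self_eq_0 [simp]: "cinner x (x::'a::complex_hilbert) = 0 \<longleftrightarrow> x = 0"
  by (simp add: cinner_self)

lemma norm_scaleC [simp]: "norm (c *\<^sub>C (x::'a::complex_hilbert)) = cmod c * norm x"
proof -
  have "complex_of_real ((norm (c *\<^sub>C x))\<^sup>2) = c * cnj c * complex_of_real ((norm x)\<^sup>2)"
    unfolding cinner_self[symmetric] by (simp add: cinner_scaleC_left cinner_scaleC_right)
  also have "c * cnj c = complex_of_real ((cmod c)\<^sup>2)"
    by (simp only: complex_norm_square)
  finally have "(norm (c *\<^sub>C x))\<^sup>2 = (cmod c * norm x)\<^sup>2"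
    unfolding power_mult_distrib by (simp only: of_real_mult[symmetric] of_real_eq_iff)
  then show ?thesis
    by (simp add: power2_eq_iff_nonneg)
qed

lemma cinner_bound: "cmod (cinner x (y::'a::complex_hilbert)) \<le> norm x * norm y"
proof (cases "cinner x y = 0")
  case False
  define c where "c = cnj (cinner x y) / cmod (cinner x y)"
  have "cmod c = 1"
    using False by (simp add: c_def norm_divide)
  have "c * cinner x y = cmod (cinner x y)"
    using False unfolding c_def
    by (simp add: divide_simps mult.commute complex_norm_square[symmetric] power2_eq_square)
  then have "cmod (cinner x y) = inner x (c *\<^sub>C y)"
    by (simp add: inner_cinner cinner_scaleC_right)
  also have "\<dots> \<le> norm x * norm (c *\<^sub>C y)"
    by (rule norm_cauchy_schwarz)
  finally show ?thesis
    using \<open>cmod c = 1\<close> by simp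
qed simp

lemma bounded_linear_cinner: "bounded_linear (cinner (x::'a::complex_hilbert))"
  by (rule bounded_linear_intro[of _ "norm x"])
    (auto simp: cinner_add_right scaleR_scaleC cinner_scaleC_right scaleR_conv_of_real
      scaleC_complex_def mult.commute intro: cinner_bound[THEN order_trans])


section \<open>Orthonormal bases\<close>

definition orthonormal :: "'a::complex_hilbert set \<Rightarrow> bool" where
  "orthonormal B \<longleftrightarrow> (\<forall>b\<in>B. \<forall>c\<in>B. cinner b c = (if b = c then 1 else 0))"

definition is_onb :: "'a::complex_hilbert set \<Rightarrow> bool" where
  "is_onb B \<longleftrightarrow> orthonormal B \<and> (\<forall>x. (\<forall>b\<in>B. cinner b x = 0) \<longrightarrow> x = 0)"

definition onb :: "'a::complex_hilbert set" where
  "onb = (SOME B. is_onb B)"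

lemma ex_onb: "\<exists>B::'a::complex_hilbert set. is_onb B"
proof -
  have "\<exists>M\<in>Collect orthonormal. \<forall>X\<in>Collect orthonormal. M \<subseteq> X \<longrightarrow> X = (M::'a set)"
  proof (rule subset_Zorn')
    fix C :: "'a set set"
    assume C: "subset.chain (Collect orthonormal) C"
    have "cinner b c = (if b = c then 1 else 0)" if bc: "b \<in> X" "X \<in> C" "c \<in> Y" "Y \<in> C" for b c X Y
    proof -
      have "X \<subseteq> Y \<or> Y \<subseteq> X"
        using C bc unfolding subset.chain_def by blast
      then obtain Z where "Z \<in> C" "b \<in> Z" "c \<in> Z"
        using bc by blast
      then show ?thesis
        using C unfolding subset.chain_def orthonormal_def by blast
    qed
    then show "\<Union>C \<in> Collect orthonormal"
      unfolding orthonormal_def by blast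
  qed
  then obtain M :: "'a set" where M: "orthonormal M" "\<And>X. orthonormal X \<Longrightarrow> M \<subseteq> X \<Longrightarrow> X = M"
    by auto
  have "x = 0" if x: "\<forall>b\<in>M. cinner b x = 0" for x
  proof (rule ccontr)
    assume "x \<noteq> 0"
    define e where "e = complex_of_real (inverse (norm x)) *\<^sub>C x"
    have "norm e = 1"
      using \<open>x \<noteq> 0\<close> by (simp add: e_def norm_inverse)
    then have e: "cinner e e = 1"
      by (simp add: cinner_self)
    have 1: "cinner b e = 0" if "b \<in> M" for b
      using x that by (simp add: e_def cinner_scaleC_right)
    have 2: "cinner e b = 0" if "b \<in> M" for b
      using 1[OF that] by (subst cinner_commute) simp
    have "orthonormal (insert e M)"
      using M(1) e 1 2 unfolding orthonormal_def by auto
    then have "e \<in> M"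
      using M(2)[of "insert e M"] by auto
    then show False
      using 1[of e] e by simp
  qed
  then show ?thesis
    using M(1) unfolding is_onb_def by blast
qed

lemma is_onb_onb: "is_onb onb"
  unfolding onb_def by (rule someI_ex[OF ex_onb])

lemma cinner_onb: "b \<in> onb \<Longrightarrow> c \<in> onb \<Longrightarrow> cinner b c = (if b = c then 1 else 0)"
  using is_onb_onb unfolding is_onb_def orthonormal_def by blast

lemma onb_total: "(\<And>b. b \<in> onb \<Longrightarrow> cinner b x = 0) \<Longrightarrow> x = 0"
  using is_onb_onb unfolding is_onb_def by blast

lemma norm_sum_onb:
  assumes "finite F" "F \<subseteq> onb"
  shows "(norm (\<Sum>b\<in>F. k b *\<^sub>C b))\<^sup>2 = (\<Sum>b\<in>F. (cmod (k b))\<^sup>2)"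
proof -
  have "complex_of_real ((norm (\<Sum>b\<in>F. k b *\<^sub>C b))\<^sup>2) =
      (\<Sum>b\<in>F. \<Sum>c\<in>F. cnj (k b) * (k c * cinner b c))"
    by (simp only: cinner_self[symmetric] cinner_sum_left)
      (simp only: cinner_sum_right cinner_scaleC_left cinner_scaleC_right sum_distrib_left
        mult.left_commute)
  also have "\<dots> = (\<Sum>b\<in>F. \<Sum>c\<in>F. if c = b then complex_of_real ((cmod (k b))\<^sup>2) else 0)"
  proof (intro sum.cong refl)
    fix b c assume "b \<in> F" "c \<in> F"
    then have "cinner b c = (if b = c then 1 else 0)"
      using assms by (intro cinner_onb) auto
    then show "cnj (k b) * (k c * cinner b c)
        = (if c = b then complex_of_real ((cmod (k b))\<^sup>2) else 0)"
      by (auto simp: complex_norm_square mult.commute simp del: of_real_power)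
  qed
  also have "\<dots> = complex_of_real (\<Sum>b\<in>F. (cmod (k b))\<^sup>2)"
    using assms by simp
  finally show ?thesis
    by (simp only: of_real_eq_iff)
qed

lemma cinner_onb_sum:
  assumes "finite F" "F \<subseteq> onb" "b \<in> onb"
  shows "cinner b (\<Sum>c\<in>F. k c *\<^sub>C c) = (if b \<in> F then k b else 0)"
proof -
  have "cinner b (\<Sum>c\<in>F. k c *\<^sub>C c) = (\<Sum>c\<in>F. if b = c then k c else 0)"
    unfolding cinner_sum_right cinner_scaleC_right
    using assms by (intro sum.cong refl) (auto simp: subset_iff cinner_onb)
  then show ?thesis
    using assms by simp
qed

lemma bessel:
  assumes "finite F" "F \<subseteq> onb"
  shows "(\<Sum>b\<in>F. (cmod (cinner b x))\<^sup>2) \<le> (norm x)\<^sup>2"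
proof -
  define p where "p = (\<Sum>b\<in>F. cinner b x *\<^sub>C b)"
  have "cinner p (x - p) = 0"
    apply (subst p_def)
    unfolding cinner_sum_left cinner_scaleC_left cinner_diff_right
    using assms
    by (auto simp: cinner_onb_sum subset_iff p_def sum_subtractf[symmetric] intro!: sum.neutral)
  then have "inner p (x - p) = 0"
    by (simp add: inner_cinner)
  then have "(norm x)\<^sup>2 = (norm p)\<^sup>2 + (norm (x - p))\<^sup>2"
    using norm_add_Pythagorean[of p "x - p"] by (simp add: orthogonal_def)
  then show ?thesis
    using norm_sum_onb[OF assms, of "\<lambda>b. cinner b x"] unfolding p_def[symmetric] by simp
qed

lemma has_sum_onb: "((\<lambda>b. cinner b x *\<^sub>C b) has_sum x) (onb::'a::complex_hilbert set)"
proof -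
  let ?f = "\<lambda>b. cinner b x *\<^sub>C b" and ?q = "\<lambda>b. (cmod (cinner b x))\<^sup>2"
  have q: "?q summable_on onb"
    by (rule nonneg_bdd_above_summable_on) (auto intro!: bdd_aboveI2 bessel)
  then have "(sum ?q \<longlongrightarrow> infsum ?q onb) (finite_subsets_at_top onb)"
    by (rule infsum_tendsto)
  then have *: "\<forall>\<^sub>F F in finite_subsets_at_top onb. dist (sum ?q F) (infsum ?q onb) < e" if "e > 0" for e
    using that by (rule tendstoD)
  have "\<exists>P. eventually P (finite_subsets_at_top onb) \<and>
      (\<forall>F F'. P F \<and> P F' \<longrightarrow> dist (sum ?f F) (sum ?f F') < e)" if "e > 0" for e :: real
  proof -
    have "(e/2)\<^sup>2 / 2 > 0"
      using that by simp
    from *[OF this] have "\<exists>G. finite G \<and> G \<subseteq> onb \<and> (\<forall>F. finite F \<and> G \<subseteq> F \<and> F \<subseteq> onb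
        \<longrightarrow> dist (sum ?q F) (infsum ?q onb) < (e/2)\<^sup>2 / 2)"
      unfolding eventually_finite_subsets_at_top .
    then obtain G where G: "finite G" "G \<subseteq> onb"
        "\<And>F. finite F \<and> G \<subseteq> F \<and> F \<subseteq> onb \<Longrightarrow> dist (sum ?q F) (infsum ?q onb) < (e/2)\<^sup>2 / 2"
      by blast
    define P where "P F \<longleftrightarrow> finite F \<and> G \<subseteq> F \<and> F \<subseteq> onb" for F
    have 1: "dist (sum ?f F) (sum ?f G) < e / 2" if F: "P F" for F
    proof -
      have "sum ?f F - sum ?f G = sum ?f (F - G)"
        using F unfolding P_def by (simp add: sum_diff)
      moreover have "(norm (sum ?f (F - G)))\<^sup>2 = sum ?q (F - G)"
        using F unfolding P_def by (intro norm_sum_onb) auto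
      moreover have "sum ?q (F - G) = sum ?q F - sum ?q G"
        using F unfolding P_def by (simp add: sum_diff)
      moreover have "sum ?q F - sum ?q G < (e/2)\<^sup>2"
      proof -
        have "\<bar>sum ?q F - infsum ?q onb\<bar> < (e/2)\<^sup>2 / 2" "\<bar>sum ?q G - infsum ?q onb\<bar> < (e/2)\<^sup>2 / 2"
          using G(3)[of F] G(3)[of G] G(1,2) F unfolding P_def dist_real_def by blast+
        then show ?thesis
          by linarith
      qed
      ultimately have "(dist (sum ?f F) (sum ?f G))\<^sup>2 < (e/2)\<^sup>2"
        by (simp add: dist_norm)
      then show ?thesis
        by (rule power_less_imp_less_base) (use \<open>e > 0\<close> in simp)
    qed
    have "dist (sum ?f F) (sum ?f F') < e" if "P F" "P F'" for F F'
      using 1[OF that(1)] 1[OF that(2)] dist_triangle_half_l by blast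
    moreover have "eventually P (finite_subsets_at_top onb)"
      unfolding eventually_finite_subsets_at_top P_def using G by blast
    ultimately show ?thesis
      by blast
  qed
  then have "cauchy_filter (filtermap (sum ?f) (finite_subsets_at_top onb))"
    by (simp add: cauchy_filter_metric_filtermap)
  moreover have "complete (UNIV::'a set)"
    by (metis Cauchy_convergent UNIV_I complete_def convergent_def)
  ultimately have "\<exists>y. (sum ?f \<longlongrightarrow> y) (finite_subsets_at_top onb)"
    using complete_uniform[where S = "UNIV::'a set"]
    by (force simp add: filterlim_def)
  then obtain y where "(sum ?f \<longlongrightarrow> y) (finite_subsets_at_top onb)"
    by blast
  then have y: "(?f has_sum y) onb"
    by (simp add: has_sum_def)
  have "cinner b (x - y) = 0" if b: "b \<in> onb" for b
  proof -
    have "((\<lambda>c. cinner b (?f c)) has_sum cinner b y) onb"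
      by (rule has_sum_bounded_linear[OF bounded_linear_cinner y])
    moreover have "((\<lambda>c. cinner b (?f c)) has_sum cinner b x) onb"
      by (rule has_sum_finite_neutralI[of "{b}"]) (use b in \<open>auto simp: cinner_scaleC_right cinner_onb\<close>)
    ultimately have "cinner b x = cinner b y"
      using has_sum_unique by blast
    then show ?thesis
      by (simp add: cinner_diff_right)
  qed
  then have "x - y = 0"
    by (rule onb_total)
  then show ?thesis
    using y by simp
qed

lemma parseval: "((\<lambda>b. cnj (cinner b x) * cinner b y) has_sum cinner x y) (onb::'a::complex_hilbert set)"
proof -
  have "((\<lambda>b. cinner x (cinner b y *\<^sub>C b)) has_sum cinner x y) onb"
    by (rule has_sum_bounded_linear[OF bounded_linear_cinner has_sum_onb])
  then show ?thesis
    by (simp add: cinner_scaleC_right mult.commute cinner_commute[of x])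
qed


section \<open>The Hilbert space tensor product\<close>

(* Realised as square-summable coefficient families over the product of two orthonormal bases;
   the choice of bases is immaterial by htensor_bilinear, cinner_tensor and dense_tensor below,
   which determine the tensor product up to a unique unitary. *)
typedef (overloaded) ('a::complex_hilbert, 'b::complex_hilbert) htensor =
  "{f :: 'a \<times> 'b \<Rightarrow> complex. (\<forall>p. p \<notin> onb \<times> onb \<longrightarrow> f p = 0) \<and>
      (\<lambda>p. (cmod (f p))\<^sup>2) summable_on UNIV}"
  by (rule exI[of _ "\<lambda>_. 0"]) simp

setup_lifting type_definition_htensor

lemma sq_summable_mult:
  assumes "(\<lambda>p. (cmod (f p))\<^sup>2) summable_on UNIV" "(\<lambda>p. (cmod (g p))\<^sup>2) summable_on UNIV"
  shows "(\<lambda>p. cnj (f p) * g p) summable_on UNIV"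
proof (rule abs_summable_summable, rule abs_summable_product)
  show "(\<lambda>p. norm (cnj (f p) * cnj (f p))) summable_on UNIV"
    "(\<lambda>p. norm (g p * g p)) summable_on UNIV"
    using assms by (simp_all add: norm_mult power2_eq_square)
qed

lemma sq_summable_add:
  assumes "(\<lambda>p. (cmod (f p))\<^sup>2) summable_on UNIV" "(\<lambda>p. (cmod (g p))\<^sup>2) summable_on UNIV"
  shows "(\<lambda>p. (cmod (f p + g p))\<^sup>2) summable_on UNIV"
proof (rule summable_on_comparison_test)
  show "(\<lambda>p. 2 * (cmod (f p))\<^sup>2 + 2 * (cmod (g p))\<^sup>2) summable_on UNIV"
    by (intro summable_on_add summable_on_cmult_right assms)
  fix p
  have "(cmod (f p + g p))\<^sup>2 \<le> (cmod (f p) + cmod (g p))\<^sup>2"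
    by (intro power_mono norm_triangle_ineq) simp
  also have "\<dots> \<le> 2 * (cmod (f p))\<^sup>2 + 2 * (cmod (g p))\<^sup>2"
    using sum_squares_bound[of "cmod (f p)" "cmod (g p)"] by (simp add: power2_sum)
  finally show "(cmod (f p + g p))\<^sup>2 \<le> 2 * (cmod (f p))\<^sup>2 + 2 * (cmod (g p))\<^sup>2" .
qed simp

lemma sq_summable_cmult:
  assumes "(\<lambda>p. (cmod (f p))\<^sup>2) summable_on UNIV"
  shows "(\<lambda>p. (cmod (c * f p))\<^sup>2) summable_on UNIV"
  using summable_on_cmult_right[OF assms, of "(cmod c)\<^sup>2"] by (simp add: norm_mult power_mult_distrib)

lemma sq_summable_diff:
  assumes "(\<lambda>p. (cmod (f p))\<^sup>2) summable_on UNIV" "(\<lambda>p. (cmod (g p))\<^sup>2) summable_on UNIV"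
  shows "(\<lambda>p. (cmod (f p - g p))\<^sup>2) summable_on UNIV"
  using sq_summable_add[OF assms(1) sq_summable_cmult[OF assms(2), of "-1"]] by simp

instantiation htensor :: (complex_hilbert, complex_hilbert) scaleC
begin
lift_definition scaleC_htensor :: "complex \<Rightarrow> ('a, 'b) htensor \<Rightarrow> ('a, 'b) htensor"
  is "\<lambda>c f p. c * f p" by (auto intro: sq_summable_cmult)
instance ..
end

instantiation htensor :: (complex_hilbert, complex_hilbert) ab_group_add
begin

lift_definition zero_htensor :: "('a, 'b) htensor" is "\<lambda>_. 0" by simp
lift_definition plus_htensor :: "('a, 'b) htensor \<Rightarrow> ('a, 'b) htensor \<Rightarrow> ('a, 'b) htensor"
  is "\<lambda>f g p. f p + g p" by (auto intro: sq_summable_add)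
lift_definition minus_htensor :: "('a, 'b) htensor \<Rightarrow> ('a, 'b) htensor \<Rightarrow> ('a, 'b) htensor"
  is "\<lambda>f g p. f p - g p" by (auto intro: sq_summable_diff)
lift_definition uminus_htensor :: "('a, 'b) htensor \<Rightarrow> ('a, 'b) htensor"
  is "\<lambda>f p. - f p" by auto

instance
  by standard (transfer; simp add: algebra_simps; fail)+

end

instantiation htensor :: (complex_hilbert, complex_hilbert) real_vector
begin

definition scaleR_htensor_def: "r *\<^sub>R (x :: ('a, 'b) htensor) = complex_of_real r *\<^sub>C x"

instance
  by standard (unfold scaleR_htensor_def, (transfer; simp add: algebra_simps; fail)+)

end

lift_definition htensor_cinner ::
    "('a::complex_hilbert, 'b::complex_hilbert) htensor \<Rightarrow> ('a, 'b) htensor \<Rightarrow> complex"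
  is "\<lambda>f g. \<Sum>\<^sub>\<infinity>p. cnj (f p) * g p" .

lift_definition htensor_norm :: "('a::complex_hilbert, 'b::complex_hilbert) htensor \<Rightarrow> real"
  is "\<lambda>f. sqrt (\<Sum>\<^sub>\<infinity>p. (cmod (f p))\<^sup>2)" .

lemma htensor_cinner_self: "htensor_cinner x x = complex_of_real ((htensor_norm x)\<^sup>2)"
proof transfer
  fix f :: "'a \<times> 'b \<Rightarrow> complex"
  assume f: "(\<forall>p. p \<notin> onb \<times> onb \<longrightarrow> f p = 0) \<and> (\<lambda>p. (cmod (f p))\<^sup>2) summable_on UNIV"
  have "(\<Sum>\<^sub>\<infinity>p. cnj (f p) * f p) = (\<Sum>\<^sub>\<infinity>p. complex_of_real ((cmod (f p))\<^sup>2))"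
    by (simp only: complex_norm_square mult.commute)
  also have "\<dots> = complex_of_real (\<Sum>\<^sub>\<infinity>p. (cmod (f p))\<^sup>2)"
    using f by (intro infsumI) (simp only: has_sum_of_real_iff has_sum_infsum)
  finally show "(\<Sum>\<^sub>\<infinity>p. cnj (f p) * f p) =
      complex_of_real ((sqrt (\<Sum>\<^sub>\<infinity>p. (cmod (f p))\<^sup>2))\<^sup>2)"
    by (simp add: infsum_nonneg)
qed

lemma htensor_norm_nonneg: "htensor_norm (x::('a::complex_hilbert, 'b::complex_hilbert) htensor) \<ge> 0"
  by transfer (simp add: infsum_nonneg)

lemma sum_htensor_le_norm:
  assumes "finite F"
  shows "(\<Sum>p\<in>F. (cmod (Rep_htensor x p))\<^sup>2) \<le> (htensor_norm x)\<^sup>2"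
  using assms by transfer (simp add: infsum_nonneg finite_sum_le_infsum)

lemma htensor_norm_eq_0:
  assumes "htensor_norm (x::('a::complex_hilbert, 'b::complex_hilbert) htensor) = 0"
  shows "x = 0"
proof -
  have "(cmod (Rep_htensor x p))\<^sup>2 \<le> 0" for p
    using sum_htensor_le_norm[of "{p}" x] assms by simp
  then show ?thesis
    by (simp add: Rep_htensor_inject[symmetric] zero_htensor.rep_eq fun_eq_iff)
qed

lemma htensor_cinner_commute: "htensor_cinner x y = cnj (htensor_cinner y x)"
  by transfer (simp add: infsum_cnj[symmetric] mult.commute del: infsum_cnj)

lemma htensor_cinner_add_right:
  "htensor_cinner x (y + z) = htensor_cinner x y + htensor_cinner x z"
  by transfer (simp add: distrib_left sq_summable_mult infsum_add)

lemma htensor_cinner_scaleC_right: "htensor_cinner x (c *\<^sub>C y) = c * htensor_cinner x y"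
proof transfer
  fix f g :: "'a \<times> 'b \<Rightarrow> complex" and c :: complex
  have "(\<Sum>\<^sub>\<infinity>p. cnj (f p) * (c * g p)) = (\<Sum>\<^sub>\<infinity>p. c * (cnj (f p) * g p))"
    by (simp add: mult.left_commute)
  then show "(\<Sum>\<^sub>\<infinity>p. cnj (f p) * (c * g p)) = c * (\<Sum>\<^sub>\<infinity>p. cnj (f p) * g p)"
    by (simp add: infsum_cmult_right')
qed

instantiation htensor :: (complex_hilbert, complex_hilbert) real_inner
begin

definition norm_htensor_def: "norm (x :: ('a, 'b) htensor) = htensor_norm x"
definition sgn_htensor_def: "sgn (x :: ('a, 'b) htensor) = x /\<^sub>R norm x"
definition dist_htensor_def: "dist x (y :: ('a, 'b) htensor) = norm (x - y)"
definition uniformity_htensor_def: "(uniformity :: (('a, 'b) htensor \<times> ('a, 'b) htensor) filter) =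
  (INF e\<in>{0 <..}. principal {(x, y). dist x y < e})"
definition open_htensor_def: "open (U :: ('a, 'b) htensor set) \<longleftrightarrow>
  (\<forall>x\<in>U. \<forall>\<^sub>F (x', y) in uniformity. x' = x \<longrightarrow> y \<in> U)"
definition inner_htensor_def: "inner x (y :: ('a, 'b) htensor) = Re (htensor_cinner x y)"

instance
proof
  fix x y z :: "('a, 'b) htensor" and r :: real
  have self: "inner x x = (htensor_norm x)\<^sup>2" for x :: "('a, 'b) htensor"
    by (simp add: inner_htensor_def htensor_cinner_self del: of_real_power)
  show comm: "inner x y = inner y x" for x y :: "('a, 'b) htensor"
    unfolding inner_htensor_def by (subst htensor_cinner_commute) simp
  show "inner (x + y) z = inner x z + inner y z"
    unfolding comm[of _ z] by (simp add: inner_htensor_def htensor_cinner_add_right)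
  show "inner (r *\<^sub>R x) y = r * inner x y"
    unfolding comm[of _ y]
    by (simp add: inner_htensor_def scaleR_htensor_def htensor_cinner_scaleC_right)
  show "sgn x = x /\<^sub>R norm x" "dist x y = norm (x - y)"
    "uniformity = (INF e\<in>{0 <..}. principal {(x, y :: ('a, 'b) htensor). dist x y < e})"
    "open U \<longleftrightarrow> (\<forall>x\<in>U. \<forall>\<^sub>F (x', y) in uniformity. x' = x \<longrightarrow> y \<in> U)"
    for U :: "('a, 'b) htensor set"
    by (simp_all add: sgn_htensor_def dist_htensor_def uniformity_htensor_def open_htensor_def)
  show "0 \<le> inner x x" "norm x = sqrt (inner x x)"
    by (simp_all add: self htensor_norm_nonneg norm_htensor_def)
  have "htensor_norm (0::('a, 'b) htensor) = 0"
    by transfer simp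
  then show "inner x x = 0 \<longleftrightarrow> x = 0"
    using htensor_norm_eq_0 by (auto simp: self)
qed

end

lemma htensor_complete:
  fixes X :: "nat \<Rightarrow> ('a::complex_hilbert, 'b::complex_hilbert) htensor"
  assumes X: "Cauchy X"
  shows "convergent X"
proof -
  have coord: "cmod (Rep_htensor x p) \<le> norm x" for x :: "('a, 'b) htensor" and p
    using sum_htensor_le_norm[of "{p}" x]
    by (simp add: norm_htensor_def[symmetric])
  have "Cauchy (\<lambda>n. Rep_htensor (X n) p)" for p
  proof (rule metric_CauchyI)
    fix e :: real assume "e > 0"
    from metric_CauchyD[OF X this] obtain M where
      "\<And>m n. m \<ge> M \<Longrightarrow> n \<ge> M \<Longrightarrow> dist (X m) (X n) < e" by blast
    then show "\<exists>M. \<forall>m\<ge>M. \<forall>n\<ge>M. dist (Rep_htensor (X m) p) (Rep_htensor (X n) p) < e"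
      using coord[of "X _ - X _" p] unfolding dist_norm minus_htensor.rep_eq
      by (meson le_less_trans)
  qed
  then have "\<forall>p. \<exists>l. (\<lambda>n. Rep_htensor (X n) p) \<longlonglongrightarrow> l"
    by (simp add: Cauchy_convergent_iff convergent_def)
  then obtain g where g: "\<And>p. (\<lambda>n. Rep_htensor (X n) p) \<longlonglongrightarrow> g p"
    by metis
  have *: "\<exists>M. \<forall>n\<ge>M. \<forall>F. finite F \<longrightarrow> (\<Sum>p\<in>F. (cmod (Rep_htensor (X n) p - g p))\<^sup>2) \<le> e\<^sup>2"
    if "e > 0" for e :: real
  proof -
    from metric_CauchyD[OF X that] obtain M where M:
      "\<And>m n. m \<ge> M \<Longrightarrow> n \<ge> M \<Longrightarrow> dist (X m) (X n) < e" by blast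
    have "(\<Sum>p\<in>F. (cmod (Rep_htensor (X n) p - g p))\<^sup>2) \<le> e\<^sup>2" if "n \<ge> M" "finite F" for n F
    proof (rule LIMSEQ_le_const2)
      show "(\<lambda>m. \<Sum>p\<in>F. (cmod (Rep_htensor (X n) p - Rep_htensor (X m) p))\<^sup>2)
          \<longlonglongrightarrow> (\<Sum>p\<in>F. (cmod (Rep_htensor (X n) p - g p))\<^sup>2)"
        by (intro tendsto_intros g)
      have "(\<Sum>p\<in>F. (cmod (Rep_htensor (X n) p - Rep_htensor (X m) p))\<^sup>2) \<le> e\<^sup>2" if "m \<ge> M" for m
      proof -
        have "(\<Sum>p\<in>F. (cmod (Rep_htensor (X n) p - Rep_htensor (X m) p))\<^sup>2) \<le> (norm (X n - X m))\<^sup>2"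
          using sum_htensor_le_norm[OF \<open>finite F\<close>, of "X n - X m"]
          by (simp add: minus_htensor.rep_eq norm_htensor_def)
        also have "\<dots> \<le> e\<^sup>2"
          using M[OF \<open>n \<ge> M\<close> that] by (intro power_mono) (auto simp: dist_norm)
        finally show ?thesis .
      qed
      then show "\<exists>N. \<forall>m\<ge>N. (\<Sum>p\<in>F. (cmod (Rep_htensor (X n) p - Rep_htensor (X m) p))\<^sup>2) \<le> e\<^sup>2"
        by blast
    qed
    then show ?thesis
      by blast
  qed
  have diff: "(\<lambda>p. (cmod (Rep_htensor (X n) p - g p))\<^sup>2) summable_on UNIV"
    if "\<forall>F. finite F \<longrightarrow> (\<Sum>p\<in>F. (cmod (Rep_htensor (X n) p - g p))\<^sup>2) \<le> e\<^sup>2" for n e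
    using that by (intro nonneg_bdd_above_summable_on) (auto intro!: bdd_aboveI2)
  obtain N where N: "\<forall>F. finite F \<longrightarrow> (\<Sum>p\<in>F. (cmod (Rep_htensor (X N) p - g p))\<^sup>2) \<le> 1\<^sup>2"
    using *[of 1] by auto
  have "(\<lambda>p. (cmod (Rep_htensor (X N) p - (Rep_htensor (X N) p - g p)))\<^sup>2) summable_on UNIV"
    using Rep_htensor[of "X N"] by (intro sq_summable_diff diff[OF N]) simp
  then have g1: "(\<lambda>p. (cmod (g p))\<^sup>2) summable_on UNIV"
    by simp
  have g2: "g p = 0" if "p \<notin> onb \<times> onb" for p
  proof -
    have "(\<lambda>n. Rep_htensor (X n) p) = (\<lambda>n. 0)"
      using Rep_htensor that by (intro ext) blast
    then show ?thesis
      using g[of p] by (simp add: LIMSEQ_const_iff)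
  qed
  define y where "y = Abs_htensor g"
  have y: "Rep_htensor y = g"
    unfolding y_def using g1 g2 by (intro Abs_htensor_inverse) blast
  have "X \<longlonglongrightarrow> y"
  proof (rule metric_LIMSEQ_I)
    fix e :: real assume "e > 0"
    with *[of "e/2"] obtain M where
      M: "\<And>n. n \<ge> M \<Longrightarrow> \<forall>F. finite F \<longrightarrow> (\<Sum>p\<in>F. (cmod (Rep_htensor (X n) p - g p))\<^sup>2) \<le> (e/2)\<^sup>2"
      by auto
    have "dist (X n) y < e" if "n \<ge> M" for n
    proof -
      have "(\<Sum>\<^sub>\<infinity>p. (cmod (Rep_htensor (X n) p - g p))\<^sup>2) \<le> (e/2)\<^sup>2"
        using M[OF that] by (intro infsum_le_finite_sums diff[OF M[OF that]]) blast
      then have "dist (X n) y \<le> sqrt ((e/2)\<^sup>2)"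
        unfolding dist_norm norm_htensor_def htensor_norm.rep_eq minus_htensor.rep_eq y by (rule real_sqrt_le_mono)
      then show ?thesis
        using \<open>e > 0\<close> by simp
    qed
    then show "\<exists>M. \<forall>n\<ge>M. dist (X n) y < e"
      by blast
  qed
  then show ?thesis
    by (auto simp: convergent_def)
qed

instantiation htensor :: (complex_hilbert, complex_hilbert) complex_hilbert
begin

definition cinner_htensor_def: "cinner = (htensor_cinner :: ('a, 'b) htensor \<Rightarrow> _)"

instance
proof
  fix x y z :: "('a, 'b) htensor" and c d :: complex and r :: real
  show "c *\<^sub>C (x + y) = c *\<^sub>C x + c *\<^sub>C y" "(c + d) *\<^sub>C x = c *\<^sub>C x + d *\<^sub>C x"
    "c *\<^sub>C d *\<^sub>C x = (c * d) *\<^sub>C x"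
    by (transfer; simp add: algebra_simps; fail)+
  show "convergent X" if "Cauchy X" for X :: "nat \<Rightarrow> ('a, 'b) htensor"
    using that by (rule htensor_complete)
qed (simp_all add: cinner_htensor_def scaleR_htensor_def inner_htensor_def
      htensor_cinner_add_right htensor_cinner_scaleC_right htensor_cinner_commute[symmetric])

end

lemma has_sum_tensor_coeff:
  fixes x x' :: "'a::complex_hilbert" and y y' :: "'b::complex_hilbert"
  shows "((\<lambda>(b, c). cnj (cinner b x * cinner c y) * (cinner b x' * cinner c y'))
     has_sum (cinner x x' * cinner y y')) (onb \<times> onb)"
proof -
  have norms: "(\<lambda>b. norm (cnj (cinner b x) * cinner b x')) summable_on onb" for x x' :: "'c::complex_hilbert"
    using has_sum_imp_summable[OF parseval[of x x']]
    by (simp only: summable_on_iff_abs_summable_on_complex)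
  let ?h = "\<lambda>(b, c). (cnj (cinner b x) * cinner b x') * (cnj (cinner c y) * cinner c y')"
  have "(?h has_sum (cinner x x' * cinner y y')) (onb \<times> onb)"
  proof (rule has_sum_SigmaI)
    fix b :: 'a
    show "((\<lambda>c. ?h (b, c)) has_sum (cnj (cinner b x) * cinner b x') * cinner y y') onb"
      using has_sum_cmult_right[OF parseval[of y y']] by simp
  next
    show "((\<lambda>b. (cnj (cinner b x) * cinner b x') * cinner y y') has_sum (cinner x x' * cinner y y')) onb"
      using has_sum_cmult_left[OF parseval[of x x']] by simp
  next
    have "(\<lambda>p. norm (?h p)) summable_on onb \<times> onb"
    proof (subst Infinite_Sum.abs_summable_on_Sigma_iff, intro conjI ballI)
      fix b :: 'a
      show "(\<lambda>c. norm (?h (b, c))) summable_on onb"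
        using summable_on_cmult_right[OF norms[of y y'], of "norm (cnj (cinner b x) * cinner b x')"]
        by (simp add: norm_mult)
    next
      have "(\<lambda>b. norm (\<Sum>\<^sub>\<infinity>c\<in>onb. norm (?h (b, c)))) =
          (\<lambda>b. norm (cnj (cinner b x) * cinner b x') *
            norm (\<Sum>\<^sub>\<infinity>c\<in>onb. norm (cnj (cinner c y) * cinner c y')))"
        by (simp add: norm_mult infsum_cmult_right' abs_mult)
      then show "(\<lambda>b. norm (\<Sum>\<^sub>\<infinity>c\<in>onb. norm (?h (b, c)))) summable_on onb"
        using summable_on_cmult_left[OF norms[of x x']] by simp
    qed
    then show "?h summable_on onb \<times> onb"
      by (rule abs_summable_summable)
  qed
  then show ?thesis
    by (simp add: case_prod_unfold mult_ac)
qed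

lift_definition tensor ::
    "'a::complex_hilbert \<Rightarrow> 'b::complex_hilbert \<Rightarrow> ('a, 'b) htensor" (infixl "\<otimes>\<^sub>h" 70)
  is "\<lambda>x y (b, c). if b \<in> onb \<and> c \<in> onb then cinner b x * cinner c y else 0"
proof (intro CollectI conjI)
  fix x :: 'a and y :: 'b
  let ?f = "\<lambda>(b, c). if b \<in> onb \<and> c \<in> onb then cinner b x * cinner c y else 0"
  show "\<forall>p. p \<notin> onb \<times> onb \<longrightarrow> ?f p = 0"
    by auto
  have "(\<lambda>(b, c). norm (cnj (cinner b x * cinner c y) * (cinner b x * cinner c y)))
      summable_on onb \<times> onb"
    using has_sum_imp_summable[OF has_sum_tensor_coeff[of x y x y]]
    by (simp add: summable_on_iff_abs_summable_on_complex case_prod_unfold)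
  then show "(\<lambda>p. (cmod (?f p))\<^sup>2) summable_on UNIV"
    by (rule summable_on_cong_neutral[THEN iffD1, rotated -1])
      (auto simp: norm_mult power2_eq_square split: if_splits)
qed

lemma htensor_bilinear:
  "(x + x') \<otimes>\<^sub>h y = x \<otimes>\<^sub>h y + x' \<otimes>\<^sub>h y"
  "x \<otimes>\<^sub>h (y + y') = x \<otimes>\<^sub>h y + x \<otimes>\<^sub>h y'"
  "(c *\<^sub>C x) \<otimes>\<^sub>h y = c *\<^sub>C (x \<otimes>\<^sub>h y)"
  "x \<otimes>\<^sub>h (c *\<^sub>C y) = c *\<^sub>C (x \<otimes>\<^sub>h y)"
  by (transfer; auto simp: fun_eq_iff cinner_add_right cinner_scaleC_right algebra_simps; fail)+

lemma cinner_tensor: "cinner (x \<otimes>\<^sub>h y) (x' \<otimes>\<^sub>h y') = cinner x x' * cinner y y'"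
  unfolding cinner_htensor_def
proof transfer
  fix x x' :: 'a and y y' :: 'b
  show "(\<Sum>\<^sub>\<infinity>p. cnj ((case p of (b, c) \<Rightarrow> if b \<in> onb \<and> c \<in> onb then cinner b x * cinner c y else 0)) *
      (case p of (b, c) \<Rightarrow> if b \<in> onb \<and> c \<in> onb then cinner b x' * cinner c y' else 0)) =
      cinner x x' * cinner y y'"
    by (rule infsumI, rule has_sum_cong_neutral[THEN iffD1, OF _ _ _ has_sum_tensor_coeff[of x y x' y']])
      (auto split: if_splits)
qed

(* The real span suffices, since the set of elementary tensors is closed under complex scaling. *)
lemma dense_tensor: "closure (span {x \<otimes>\<^sub>h y | x y. True}) = UNIV"
proof -
  have "z \<in> closure (span {x \<otimes>\<^sub>h y | x y. True})" for z :: "('a, 'b) htensor"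
  proof (unfold closure_approachable, intro allI impI)
    fix e :: real assume "e > 0"
    let ?z = "Rep_htensor z"
    have z1: "(\<lambda>p. (cmod (?z p))\<^sup>2) summable_on UNIV" and z2: "\<And>p. p \<notin> onb \<times> onb \<Longrightarrow> ?z p = 0"
      using Rep_htensor[of z] by auto
    have "(e/2)\<^sup>2 > 0"
      using \<open>e > 0\<close> by simp
    from infsum_finite_approximation[OF z1 this] obtain F where
      F: "finite F" "dist (\<Sum>p\<in>F. (cmod (?z p))\<^sup>2) (\<Sum>\<^sub>\<infinity>p. (cmod (?z p))\<^sup>2) \<le> (e/2)\<^sup>2"
      by blast
    define w where "w = (\<Sum>p\<in>F \<inter> onb \<times> onb. (?z p *\<^sub>C fst p) \<otimes>\<^sub>h snd p)"
    have rep_sum: "Rep_htensor (sum h G) q = (\<Sum>p\<in>G. Rep_htensor (h p) q)"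
      for h :: "_ \<Rightarrow> ('a, 'b) htensor" and G :: "('a \<times> 'b) set" and q
      by (induction G rule: infinite_finite_induct) (auto simp: zero_htensor.rep_eq plus_htensor.rep_eq)
    have w: "Rep_htensor w q = (if q \<in> F then ?z q else 0)" for q
    proof -
      have "Rep_htensor w q = (\<Sum>p\<in>F \<inter> onb \<times> onb. if p = q then ?z q else 0)"
        unfolding w_def rep_sum
        by (intro sum.cong refl)
          (cases q, auto simp: tensor.rep_eq cinner_scaleC_right cinner_onb split: if_splits)
      then show ?thesis
        using F(1) z2[of q] by auto
    qed
    have "(\<Sum>\<^sub>\<infinity>p. (cmod (?z p - Rep_htensor w p))\<^sup>2) =
        (\<Sum>\<^sub>\<infinity>p. (cmod (?z p))\<^sup>2) - (\<Sum>p\<in>F. (cmod (?z p))\<^sup>2)"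
    proof -
      have "((\<lambda>p. (cmod (?z p))\<^sup>2) has_sum
          ((\<Sum>\<^sub>\<infinity>p. (cmod (?z p))\<^sup>2) - (\<Sum>p\<in>F. (cmod (?z p))\<^sup>2))) (UNIV - F)"
        using F(1) z1 by (intro has_sum_Diff has_sum_infsum) auto
      then have "((\<lambda>p. (cmod (?z p - Rep_htensor w p))\<^sup>2) has_sum
          ((\<Sum>\<^sub>\<infinity>p. (cmod (?z p))\<^sup>2) - (\<Sum>p\<in>F. (cmod (?z p))\<^sup>2))) UNIV"
        by (rule has_sum_cong_neutral[THEN iffD1, rotated -1]) (auto simp: w)
      then show ?thesis
        by (rule infsumI)
    qed
    also have "\<dots> \<le> (e/2)\<^sup>2"
      using F(2) by (simp add: dist_real_def)
    finally have "norm (z - w) \<le> sqrt ((e/2)\<^sup>2)"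
      unfolding norm_htensor_def htensor_norm.rep_eq minus_htensor.rep_eq by (rule real_sqrt_le_mono)
    then have "dist w z < e"
      using \<open>e > 0\<close> by (simp add: dist_norm norm_minus_commute)
    moreover have "w \<in> span {x \<otimes>\<^sub>h y | x y. True}"
      unfolding w_def by (intro span_sum span_base) blast
    ultimately show "\<exists>w\<in>span {x \<otimes>\<^sub>h y | x y. True}. dist w z < e"
      by blast
  qed
  then show ?thesis
    by blast
qed

section \<open>Bounded operators\<close>

lemma bounded_linear_scaleC: "bounded_linear ((*\<^sub>C) c :: 'a::complex_hilbert \<Rightarrow> 'a)"
  by (rule bounded_linear_intro[of _ "cmod c"])
    (auto simp: scaleC_add_right scaleR_scaleC scaleC_scaleC mult.commute)

instantiation blinfun :: (real_normed_vector, complex_hilbert) scaleC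
begin
lift_definition scaleC_blinfun :: "complex \<Rightarrow> 'a \<Rightarrow>\<^sub>L 'b \<Rightarrow> 'a \<Rightarrow>\<^sub>L 'b" is "\<lambda>c f x. c *\<^sub>C f x"
  by (rule bounded_linear_compose[OF bounded_linear_scaleC])
instance ..
end

(* blinfun only provides real-linear bounded maps *)
definition complex_ops :: "('h::complex_hilbert \<Rightarrow>\<^sub>L 'h) set" where
  "complex_ops = {a. \<forall>c x. blinfun_apply a (c *\<^sub>C x) = c *\<^sub>C blinfun_apply a x}"

(* The operators specified by the two THE's exist for all complex-linear a and b; they are unique
   by definiteness of the inner product and by dense_tensor, respectively. *)
definition adj :: "'h::complex_hilbert \<Rightarrow>\<^sub>L 'h \<Rightarrow> 'h \<Rightarrow>\<^sub>L 'h" where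
  "adj a = (THE b. \<forall>x y. cinner (blinfun_apply a x) y = cinner x (blinfun_apply b y))"

definition op_tensor ::
    "'h::complex_hilbert \<Rightarrow>\<^sub>L 'h \<Rightarrow> 'k::complex_hilbert \<Rightarrow>\<^sub>L 'k \<Rightarrow> ('h, 'k) htensor \<Rightarrow>\<^sub>L ('h, 'k) htensor"
    (infixl "\<otimes>\<^sub>o" 70) where
  "a \<otimes>\<^sub>o b = (THE t. \<forall>x y. blinfun_apply t (x \<otimes>\<^sub>h y) = blinfun_apply a x \<otimes>\<^sub>h blinfun_apply b y)"

definition op_pos :: "'h::complex_hilbert \<Rightarrow>\<^sub>L 'h \<Rightarrow> bool" where
  "op_pos a \<longleftrightarrow> a \<in> complex_ops \<and> (\<forall>x. cinner x (a x) \<in> \<real>\<^sub>\<ge>\<^sub>0)"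

definition op_le :: "'h::complex_hilbert \<Rightarrow>\<^sub>L 'h \<Rightarrow> 'h \<Rightarrow>\<^sub>L 'h \<Rightarrow> bool" (infix "\<le>\<^sub>o" 50) where
  "a \<le>\<^sub>o b \<longleftrightarrow> op_pos (b - a)"


section \<open>Von Neumann algebras\<close>

definition commutant :: "('h::complex_hilbert \<Rightarrow>\<^sub>L 'h) set \<Rightarrow> ('h \<Rightarrow>\<^sub>L 'h) set" where
  "commutant S = {b \<in> complex_ops. \<forall>a\<in>S. a o\<^sub>L b = b o\<^sub>L a}"

definition von_neumann_algebra :: "('h::complex_hilbert \<Rightarrow>\<^sub>L 'h) set \<Rightarrow> bool" where
  "von_neumann_algebra A \<longleftrightarrow>
     A \<subseteq> complex_ops \<and> (\<forall>a\<in>A. adj a \<in> A) \<and> commutant (commutant A) = A"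

definition spatial_tensor ::
    "('h::complex_hilbert \<Rightarrow>\<^sub>L 'h) set \<Rightarrow> ('k::complex_hilbert \<Rightarrow>\<^sub>L 'k) set \<Rightarrow>
     (('h, 'k) htensor \<Rightarrow>\<^sub>L ('h, 'k) htensor) set" where
  "spatial_tensor A B = commutant (commutant {a \<otimes>\<^sub>o b | a b. a \<in> A \<and> b \<in> B})"

definition self_adjoints :: "('h::complex_hilbert \<Rightarrow>\<^sub>L 'h) set \<Rightarrow> ('h \<Rightarrow>\<^sub>L 'h) set" where
  "self_adjoints A = {a \<in> A. adj a = a}"

definition directed :: "('h::complex_hilbert \<Rightarrow>\<^sub>L 'h) set \<Rightarrow> bool" where
  "directed D \<longleftrightarrow> D \<noteq> {} \<and> (\<forall>a\<in>D. \<forall>b\<in>D. \<exists>c\<in>D. a \<le>\<^sub>o c \<and> b \<le>\<^sub>o c)"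

definition is_supremum ::
    "('h::complex_hilbert \<Rightarrow>\<^sub>L 'h) set \<Rightarrow> ('h \<Rightarrow>\<^sub>L 'h) set \<Rightarrow> 'h \<Rightarrow>\<^sub>L 'h \<Rightarrow> bool" where
  "is_supremum A D s \<longleftrightarrow> s \<in> self_adjoints A \<and> (\<forall>d\<in>D. d \<le>\<^sub>o s) \<and>
     (\<forall>t\<in>self_adjoints A. (\<forall>d\<in>D. d \<le>\<^sub>o t) \<longrightarrow> s \<le>\<^sub>o t)"

definition linear_map ::
    "('h::complex_hilbert \<Rightarrow>\<^sub>L 'h) set \<Rightarrow> ('h \<Rightarrow>\<^sub>L 'h \<Rightarrow> 'k::complex_hilbert \<Rightarrow>\<^sub>L 'k) \<Rightarrow> bool" where
  "linear_map A f \<longleftrightarrow> (\<forall>a\<in>A. \<forall>b\<in>A. f (a + b) = f a + f b) \<and> (\<forall>c. \<forall>a\<in>A. f (c *\<^sub>C a) = c *\<^sub>C f a)"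

definition positive_map ::
    "('h::complex_hilbert \<Rightarrow>\<^sub>L 'h) set \<Rightarrow> ('h \<Rightarrow>\<^sub>L 'h \<Rightarrow> 'k::complex_hilbert \<Rightarrow>\<^sub>L 'k) \<Rightarrow> bool" where
  "positive_map A f \<longleftrightarrow> (\<forall>a\<in>A. op_pos a \<longrightarrow> op_pos (f a))"

(* Having a supremum s in A already entails that D is bounded. *)
definition normal_map ::
    "('h::complex_hilbert \<Rightarrow>\<^sub>L 'h) set \<Rightarrow> ('k::complex_hilbert \<Rightarrow>\<^sub>L 'k) set \<Rightarrow>
     ('h \<Rightarrow>\<^sub>L 'h \<Rightarrow> 'k \<Rightarrow>\<^sub>L 'k) \<Rightarrow> bool" where
  "normal_map A B f \<longleftrightarrow>
     (\<forall>D s. D \<subseteq> self_adjoints A \<and> directed D \<and> is_supremum A D s \<longrightarrow> is_supremum B (f ` D) (f s))"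


section \<open>Duplicators\<close>

(* \<delta> is extensional (undefined outside its domain), so that equality of duplicators as HOL
   functions is equality of maps on the spatial tensor product. *)
definition duplicator ::
    "('h::complex_hilbert \<Rightarrow>\<^sub>L 'h) set \<Rightarrow>
     (('h, 'h) htensor \<Rightarrow>\<^sub>L ('h, 'h) htensor \<Rightarrow> 'h \<Rightarrow>\<^sub>L 'h) \<Rightarrow> 'h \<Rightarrow>\<^sub>L 'h \<Rightarrow> bool" where
  "duplicator A \<delta> u \<longleftrightarrow>
     \<delta> \<in> spatial_tensor A A \<rightarrow>\<^sub>E A \<and>
     linear_map (spatial_tensor A A) \<delta> \<and>
     positive_map (spatial_tensor A A) \<delta> \<and>
     normal_map (spatial_tensor A A) A \<delta> \<and>
     \<delta> id_blinfun \<le>\<^sub>o id_blinfun \<and>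
     u \<in> A \<and> 0 \<le>\<^sub>o u \<and> u \<le>\<^sub>o id_blinfun \<and>
     (\<forall>a\<in>A. \<delta> (a \<otimes>\<^sub>o u) = a \<and> \<delta> (u \<otimes>\<^sub>o a) = a)"

definition duplicable :: "('h::complex_hilbert \<Rightarrow>\<^sub>L 'h) set \<Rightarrow> bool" where
  "duplicable A \<longleftrightarrow> (\<exists>\<delta> u. duplicator A \<delta> u)"


section \<open>Bounded functions\<close>

definition linfty :: "'x set \<Rightarrow> ('x \<Rightarrow> complex) set" where
  "linfty X = {f \<in> extensional X. bounded (f ` X)}"

definition miu_isomorphism ::
    "('h::complex_hilbert \<Rightarrow>\<^sub>L 'h) set \<Rightarrow> 'x set \<Rightarrow> ('h \<Rightarrow>\<^sub>L 'h \<Rightarrow> 'x \<Rightarrow> complex) \<Rightarrow> bool" where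
  "miu_isomorphism A X \<phi> \<longleftrightarrow> bij_betw \<phi> A (linfty X) \<and>
     (\<forall>x\<in>X.
        (\<forall>a\<in>A. \<forall>b\<in>A. \<phi> (a + b) x = \<phi> a x + \<phi> b x) \<and>
        (\<forall>c. \<forall>a\<in>A. \<phi> (c *\<^sub>C a) x = c * \<phi> a x) \<and>
        (\<forall>a\<in>A. \<forall>b\<in>A. \<phi> (a o\<^sub>L b) x = \<phi> a x * \<phi> b x) \<and>
        (\<forall>a\<in>A. \<phi> (adj a) x = cnj (\<phi> a x)) \<and>
        \<phi> id_blinfun x = 1)"

definition miu_isomorphic_linfty :: "('h::complex_hilbert \<Rightarrow>\<^sub>L 'h) set \<Rightarrow> 'x set \<Rightarrow> bool" where
  "miu_isomorphic_linfty A X \<longleftrightarrow> (\<exists>\<phi>. miu_isomorphism A X \<phi>)"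

end

theory Submission
  imports Defs
begin

text \<open>
  Let \<open>(\<delta>, u)\<close> be a duplicator. Positivity of \<open>\<delta>((1 - u) \<otimes> (1 - u)) = u - 1\<close> gives \<open>u = 1\<close>. For a
  projection p and a positive contraction b, \<open>0 \<le> \<delta>(p \<otimes> b) \<le> p\<close> and \<open>0 \<le> \<delta>(p\<^sup>\<bottom> \<otimes> b) \<le> p\<^sup>\<bottom>\<close>, so that
  \<open>b = \<delta>(p \<otimes> b) + \<delta>(p\<^sup>\<bottom> \<otimes> b)\<close> commutes with p and \<open>\<delta>(p \<otimes> b) = pb\<close>. As the projections span a norm
  dense subspace, the algebra is commutative and \<open>\<delta>(a \<otimes> b) = ab\<close>. Since \<open>\<delta>\<close> is normal and kills all
  \<open>p \<otimes> p\<^sup>\<bottom>\<close>, there is a nonzero vector \<open>\<xi>\<close> with \<open>(p \<otimes> 1) \<xi> = (p \<otimes> p) \<xi>\<close> for all projections p; it exists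
  below every nonzero projection, and it yields an atom there. So the algebra is \<open>\<ell>\<^sup>\<infinity>\<close> of its atoms. As
  \<open>p \<otimes> p\<close>, for p an atom, compresses the tensor square to scalars, \<open>\<delta>\<close> is determined by its values on
  these elements. Conversely, on \<open>\<ell>\<^sup>\<infinity>(X)\<close> each point is a vector state v, and
  \<open>\<delta>(T)(x) = \<langle>v \<otimes> v, T (v \<otimes> v)\<rangle>\<close> is a duplicator.
\<close>

section \<open>Adjoints\<close>

text \<open>On elementary tensors of a commutative algebra the product a b always makes sense; the
  obstacle is a normal extension to the spatial tensor product. In a diffuse algebra the projections
  p \<otimes> (1 - p) exhaust the identity, since the diagonal is a null set, and normality would
  force \<delta>(1) = 0. Normality therefore enters exactly where atoms are produced. On a diagonal
  vector p acts as p \<otimes> p, so one additive function of p is controlled by a product of three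
  norms, a superlinear decay that arbitrarily fine partitions of a projection contradict. Spectral
  theory is kept to monotone limits: square roots, kernel projections and sign projections are
  strong limits or built from them, commute with everything the given operator commutes with, and so
  lie in the algebra by the bicommutant condition. Uniqueness avoids density of elementary tensors:
  the tensor square of an atom splits each positive contraction into a scalar part and a remainder,
  and the order locates the image of the remainder.\<close>

lemma cauchy_tendsto:
  fixes f :: "'a \<Rightarrow> 'b::{complete_space}"
  assumes "F \<noteq> bot"
    and "\<And>e. e > 0 \<Longrightarrow> \<exists>P. eventually P F \<and> (\<forall>x y. P x \<and> P y \<longrightarrow> dist (f x) (f y) < e)"
  shows "\<exists>l. (f \<longlongrightarrow> l) F"
proof -
  have "cauchy_filter (filtermap f F)"
    using assms(2) by (simp add: cauchy_filter_metric_filtermap)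
  moreover have "complete (UNIV::'b set)"
    by (metis Cauchy_convergent UNIV_I complete_def convergent_def)
  ultimately have "\<exists>y. filtermap f F \<le> nhds y"
    using complete_uniform[where S = "UNIV::'b set"] assms(1)
    by (force simp: filtermap_bot_iff)
  then show ?thesis
    by (simp add: filterlim_def)
qed

text \<open>By \<open>norm_sum_onb\<close> the squared norm of a finite partial sum is the sum of
  its squared coefficients, so the Cauchy property of the sums of squares passes to the
  vectors.\<close>

lemma summable_onb:
  fixes k :: "'a::complex_hilbert \<Rightarrow> complex"
  assumes "(\<lambda>b. (cmod (k b))\<^sup>2) summable_on onb"
  shows "(\<lambda>b. k b *\<^sub>C b) summable_on onb"
proof -
  let ?f = "\<lambda>b. k b *\<^sub>C b" and ?q = "\<lambda>b. (cmod (k b))\<^sup>2"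
  have lim: "(sum ?q \<longlongrightarrow> infsum ?q onb) (finite_subsets_at_top onb)"
    using assms by (rule infsum_tendsto)
  have "\<exists>P. eventually P (finite_subsets_at_top onb) \<and>
      (\<forall>F F'. P F \<and> P F' \<longrightarrow> dist (sum ?f F) (sum ?f F') < e)" if "e > 0" for e :: real
  proof -
    have "(e/2)\<^sup>2 / 2 > 0"
      using that by simp
    with lim have "\<exists>G. finite G \<and> G \<subseteq> onb \<and> (\<forall>F. finite F \<and> G \<subseteq> F \<and> F \<subseteq> onb
        \<longrightarrow> dist (sum ?q F) (infsum ?q onb) < (e/2)\<^sup>2 / 2)"
      unfolding eventually_finite_subsets_at_top[symmetric] by (rule tendstoD)
    then obtain G where G: "finite G" "G \<subseteq> onb"
        "\<And>F. finite F \<and> G \<subseteq> F \<and> F \<subseteq> onb \<Longrightarrow> dist (sum ?q F) (infsum ?q onb) < (e/2)\<^sup>2 / 2"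
      by blast
    define P where "P F \<longleftrightarrow> finite F \<and> G \<subseteq> F \<and> F \<subseteq> onb" for F
    have 1: "dist (sum ?f F) (sum ?f G) < e / 2" if F: "P F" for F
    proof -
      have "sum ?f F - sum ?f G = sum ?f (F - G)"
        using F unfolding P_def by (simp add: sum_diff)
      moreover have "(norm (sum ?f (F - G)))\<^sup>2 = sum ?q (F - G)"
        using F unfolding P_def by (intro norm_sum_onb) auto
      moreover have "sum ?q (F - G) = sum ?q F - sum ?q G"
        using F unfolding P_def by (simp add: sum_diff)
      moreover have "sum ?q F - sum ?q G < (e/2)\<^sup>2"
      proof -
        have "\<bar>sum ?q F - infsum ?q onb\<bar> < (e/2)\<^sup>2 / 2" "\<bar>sum ?q G - infsum ?q onb\<bar> < (e/2)\<^sup>2 / 2"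
          using G(3)[of F] G(3)[of G] G(1,2) F unfolding P_def dist_real_def by blast+
        then show ?thesis
          by linarith
      qed
      ultimately have "(dist (sum ?f F) (sum ?f G))\<^sup>2 < (e/2)\<^sup>2"
        by (simp add: dist_norm)
      then show ?thesis
        by (rule power_less_imp_less_base) (use \<open>e > 0\<close> in simp)
    qed
    have "dist (sum ?f F) (sum ?f F') < e" if "P F" "P F'" for F F'
      using 1[OF that(1)] 1[OF that(2)] dist_triangle_half_l by blast
    moreover have "eventually P (finite_subsets_at_top onb)"
      unfolding eventually_finite_subsets_at_top P_def using G by blast
    ultimately show ?thesis
      by blast
  qed
  then have "\<exists>l. (sum ?f \<longlongrightarrow> l) (finite_subsets_at_top onb)"
    by (intro cauchy_tendsto) auto
  then show ?thesis
    by (auto simp: summable_on_def has_sum_def)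
qed

text \<open>The representing vector has coefficients \<open>cnj (g b)\<close>. Their square
  summability comes from testing g on its own partial sum v: if S is the finite sum of squares, then
  g v = S and the squared norm of v is also S, so S \<le> K * norm v forces S \<le> K^2.\<close>

lemma riesz:
  fixes g :: "'a::complex_hilbert \<Rightarrow> complex"
  assumes g: "bounded_linear g" and gC: "\<And>c x. g (c *\<^sub>C x) = c * g x"
  shows "\<exists>y. \<forall>x. g x = cinner y x"
proof -
  interpret g: bounded_linear g by fact
  obtain K where K: "\<And>x. cmod (g x) \<le> norm x * K" "K \<ge> 0"
    using g.nonneg_bounded by blast
  have "(\<Sum>b\<in>F. (cmod (g b))\<^sup>2) \<le> K\<^sup>2" if F: "finite F" "F \<subseteq> onb" for F
  proof -
    let ?S = "\<Sum>b\<in>F. (cmod (g b))\<^sup>2"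
    define v where "v = (\<Sum>b\<in>F. cnj (g b) *\<^sub>C b)"
    have "g v = complex_of_real ?S"
      by (simp add: v_def g.sum gC complex_norm_square mult.commute del: of_real_power)
    then have "\<bar>?S\<bar> \<le> norm v * K"
      using K(1)[of v] by (metis norm_of_real)
    then have "?S \<le> norm v * K"
      by linarith
    moreover have nv: "(norm v)\<^sup>2 = ?S"
      unfolding v_def using norm_sum_onb[OF F, of "\<lambda>b. cnj (g b)"] by simp
    ultimately have "norm v * norm v \<le> norm v * K"
      by (simp add: power2_eq_square)
    then have "norm v \<le> K"
      using K(2) by (cases "norm v = 0") (auto simp: mult_le_cancel_left)
    then show ?thesis
      using nv by (metis norm_ge_zero power_mono)
  qed
  then have "(\<lambda>b. (cmod (g b))\<^sup>2) summable_on onb"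
    by (intro nonneg_bdd_above_summable_on) (auto intro!: bdd_aboveI2)
  then have "(\<lambda>b. (cmod (cnj (g b)))\<^sup>2) summable_on onb"
    by simp
  then obtain y where y: "((\<lambda>b. cnj (g b) *\<^sub>C b) has_sum y) onb"
    using summable_onb[of "\<lambda>b. cnj (g b)"] unfolding summable_on_def by blast
  have "g x = cinner y x" for x
  proof -
    have "((\<lambda>b. g (cinner b x *\<^sub>C b)) has_sum g x) onb"
      by (rule has_sum_bounded_linear[OF g has_sum_onb])
    moreover have "((\<lambda>b. cnj (cinner x (cnj (g b) *\<^sub>C b))) has_sum cnj (cinner x y)) onb"
      by (subst has_sum_cnj_iff) (rule has_sum_bounded_linear[OF bounded_linear_cinner y])
    moreover have "cnj (cinner x (cnj (g b) *\<^sub>C b)) = g (cinner b x *\<^sub>C b)" for b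
      by (simp add: gC cinner_scaleC_right cinner_commute[of b x])
    ultimately have "g x = cnj (cinner x y)"
      using has_sum_unique by (simp add: infsumI)
    then show ?thesis
      using cinner_commute[of y x] by simp
  qed
  then show ?thesis
    by blast
qed

lemma cinner_ext_left: "(\<And>x. cinner y x = cinner z x) \<Longrightarrow> y = (z::'a::complex_hilbert)"
  by (metis cinner_diff_left cinner_self_eq_0 diff_eq_eq diff_self eq_iff_diff_eq_0)

lemma cinner_ext_right:
  assumes "\<And>x. cinner x y = cinner x z"
  shows "y = (z::'a::complex_hilbert)"
  by (rule cinner_ext_left) (use assms cinner_commute in metis)

lemma complex_ops_scaleC: "a \<in> complex_ops \<Longrightarrow> blinfun_apply a (c *\<^sub>C x) = c *\<^sub>C blinfun_apply a x"
  by (simp add: complex_ops_def)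

lemma scaleC_minus_right: "c *\<^sub>C (- x) = - (c *\<^sub>C (x::'a::complex_hilbert))"
  by (metis add.right_inverse minus_unique scaleC_add_right scaleC_zero_right)

lemma scaleC_diff_right: "c *\<^sub>C (x - y) = c *\<^sub>C x - c *\<^sub>C (y::'a::complex_hilbert)"
  using scaleC_add_right[of c x "-y"] by (simp add: scaleC_minus_right)

lemma scaleC_zero_left [simp]: "0 *\<^sub>C x = (0::'a::complex_hilbert)"
  by (metis add_cancel_left_left scaleC_add_left)

lemma scaleC_minus_left: "(- c) *\<^sub>C x = - (c *\<^sub>C (x::'a::complex_hilbert))"
  by (metis add.right_inverse minus_unique scaleC_add_left scaleC_zero_left)

lemma scaleC_diff_left: "(c - d) *\<^sub>C x = c *\<^sub>C x - d *\<^sub>C (x::'a::complex_hilbert)"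
  using scaleC_add_left[of c "-d" x] by (simp add: scaleC_minus_left)

lemma complex_ops_zero [simp, intro]: "0 \<in> complex_ops"
  and complex_ops_id [simp, intro]: "id_blinfun \<in> complex_ops"
  and complex_ops_add [simp, intro]: "a \<in> complex_ops \<Longrightarrow> b \<in> complex_ops \<Longrightarrow> a + b \<in> complex_ops"
  and complex_ops_diff [simp, intro]: "a \<in> complex_ops \<Longrightarrow> b \<in> complex_ops \<Longrightarrow> a - b \<in> complex_ops"
  and complex_ops_minus [simp, intro]: "a \<in> complex_ops \<Longrightarrow> - a \<in> complex_ops"
  and complex_ops_comp [simp, intro]: "a \<in> complex_ops \<Longrightarrow> b \<in> complex_ops \<Longrightarrow> a o\<^sub>L b \<in> complex_ops"
  and complex_ops_scaleR [simp, intro]: "a \<in> complex_ops \<Longrightarrow> r *\<^sub>R a \<in> complex_ops"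
  and complex_ops_scaleC_op [simp, intro]: "a \<in> complex_ops \<Longrightarrow> c *\<^sub>C a \<in> complex_ops"
  by (auto simp: complex_ops_def blinfun.bilinear_simps scaleC_add_right scaleC_diff_right
      scaleC_minus_right scaleR_scaleC scaleC_scaleC mult.commute scaleC_blinfun.rep_eq)

text \<open>\<open>riesz\<close> applied to x \<mapsto> <y, a x> gives the image of each y;
  linearity follows from uniqueness of representing vectors, and boundedness from pairing
  \<open>B x\<close> with itself.\<close>

lemma ex_adj:
  fixes a :: "'h::complex_hilbert \<Rightarrow>\<^sub>L 'h"
  assumes "a \<in> complex_ops"
  shows "\<exists>b. \<forall>x y. cinner (blinfun_apply a x) y = cinner x (blinfun_apply b y)"
proof -
  have "\<exists>z. \<forall>x. cinner y (blinfun_apply a x) = cinner z x" for y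
    by (rule riesz)
      (auto simp: complex_ops_scaleC[OF assms] cinner_scaleC_right
        intro!: bounded_linear_compose[OF bounded_linear_cinner] blinfun.bounded_linear_right)
  then obtain B where B: "\<And>x y. cinner y (blinfun_apply a x) = cinner (B y) x"
    by metis
  then have B': "cinner (blinfun_apply a x) y = cinner x (B y)" for x y
    using cinner_commute[of "blinfun_apply a x" y] cinner_commute[of x "B y"] by simp
  have "bounded_linear B"
  proof (rule bounded_linear_intro[of _ "norm a"])
    show "B (x + y) = B x + B y" for x y
      by (rule cinner_ext_right) (simp add: B'[symmetric] cinner_add_right)
    show "B (r *\<^sub>R x) = r *\<^sub>R B x" for r x
      by (rule cinner_ext_right) (simp add: B'[symmetric] cinner_scaleC_right scaleR_scaleC)
    show "norm (B x) \<le> norm x * norm a" for x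
    proof (cases "B x = 0")
      case False
      have "(norm (B x))\<^sup>2 = cmod (cinner (B x) (B x))"
        by (simp add: cinner_self norm_power)
      also have "\<dots> = cmod (cinner (blinfun_apply a (B x)) x)"
        by (simp add: B')
      also have "\<dots> \<le> norm (blinfun_apply a (B x)) * norm x"
        by (rule cinner_bound)
      also have "\<dots> \<le> (norm a * norm (B x)) * norm x"
        by (intro mult_right_mono norm_blinfun) auto
      finally have "norm (B x) * norm (B x) \<le> norm (B x) * (norm x * norm a)"
        by (simp add: power2_eq_square mult_ac)
      then show ?thesis
        using False by (simp add: mult_le_cancel_left)
    qed simp
  qed
  then show ?thesis
    using B' by (intro exI[of _ "Blinfun B"]) (simp add: bounded_linear_Blinfun_apply)
qed

lemma cinner_adj_right:
  fixes a :: "'h::complex_hilbert \<Rightarrow>\<^sub>L 'h"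
  assumes "a \<in> complex_ops"
  shows "cinner x (blinfun_apply (adj a) y) = cinner (blinfun_apply a x) y"
proof -
  obtain b where b: "\<And>x y. cinner (blinfun_apply a x) y = cinner x (blinfun_apply b y)"
    using ex_adj[OF assms] by blast
  have "adj a = b"
    unfolding adj_def
  proof (rule the_equality)
    show "\<forall>x y. cinner (blinfun_apply a x) y = cinner x (blinfun_apply b y)"
      using b by blast
    fix b' assume "\<forall>x y. cinner (blinfun_apply a x) y = cinner x (blinfun_apply b' y)"
    then have "cinner x (blinfun_apply b' y) = cinner x (blinfun_apply b y)" for x y
      using b by metis
    then show "b' = b"
      by (rule blinfun_eqI[OF cinner_ext_right])
  qed
  then show ?thesis
    using b by simp
qed

lemma cinner_adj_left:
  fixes a :: "'h::complex_hilbert \<Rightarrow>\<^sub>L 'h"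
  assumes "a \<in> complex_ops"
  shows "cinner (blinfun_apply (adj a) x) y = cinner x (blinfun_apply a y)"
  using cinner_adj_right[OF assms, of y x] cinner_commute[of "adj a x" y] cinner_commute[of x "a y"]
  by simp

lemma adj_eqI:
  fixes a :: "'h::complex_hilbert \<Rightarrow>\<^sub>L 'h"
  assumes "a \<in> complex_ops" "\<And>x y. cinner (blinfun_apply a x) y = cinner x (blinfun_apply b y)"
  shows "adj a = b"
  by (rule blinfun_eqI, rule cinner_ext_right) (simp add: cinner_adj_right assms)

lemma adj_complex_ops [simp, intro]:
  fixes a :: "'h::complex_hilbert \<Rightarrow>\<^sub>L 'h"
  assumes "a \<in> complex_ops"
  shows "adj a \<in> complex_ops"
proof -
  have "adj a (c *\<^sub>C x) = c *\<^sub>C adj a x" for c x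
    by (rule cinner_ext_right) (simp add: cinner_adj_right assms cinner_scaleC_right)
  then show ?thesis
    by (simp add: complex_ops_def)
qed

lemma adj_adj: "a \<in> complex_ops \<Longrightarrow> adj (adj a) = a"
  by (rule adj_eqI) (auto simp: cinner_adj_left)

lemma adj_comp: "a \<in> complex_ops \<Longrightarrow> b \<in> complex_ops \<Longrightarrow> adj (a o\<^sub>L b) = adj b o\<^sub>L adj a"
  and adj_scaleC: "a \<in> complex_ops \<Longrightarrow> adj (c *\<^sub>C a) = cnj c *\<^sub>C adj a"
  by (rule adj_eqI; auto simp: cinner_adj_right scaleC_blinfun.rep_eq cinner_scaleC_left
      cinner_scaleC_right; fail)+

text \<open>The symmetric form of self-adjointness does not mention the description inside
  \<open>adj\<close>, so closure properties reduce to sesquilinear algebra;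
  \<open>herm_iff_adj\<close> links the two.\<close>

definition herm :: "('h::complex_hilbert \<Rightarrow>\<^sub>L 'h) \<Rightarrow> bool" where
  "herm a \<longleftrightarrow> a \<in> complex_ops \<and> (\<forall>x y. cinner (blinfun_apply a x) y = cinner x (blinfun_apply a y))"

lemma herm_ops: "herm a \<Longrightarrow> a \<in> complex_ops"
  by (simp add: herm_def)

lemma herm_cinner: "herm a \<Longrightarrow> cinner (blinfun_apply a x) y = cinner x (blinfun_apply a y)"
  by (simp add: herm_def)

lemma herm_iff_adj: "herm a \<longleftrightarrow> a \<in> complex_ops \<and> adj a = a"
  by (metis adj_eqI cinner_adj_right herm_def)

lemma herm_adj: "herm a \<Longrightarrow> adj a = a"
  by (simp add: herm_iff_adj)

lemma herm_zero [simp, intro]: "herm 0"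
  and herm_id [simp, intro]: "herm id_blinfun"
  and herm_add [intro]: "herm a \<Longrightarrow> herm b \<Longrightarrow> herm (a + b)"
  and herm_diff [intro]: "herm a \<Longrightarrow> herm b \<Longrightarrow> herm (a - b)"
  and herm_minus [intro]: "herm a \<Longrightarrow> herm (- a)"
  and herm_scaleR [intro]: "herm a \<Longrightarrow> herm (r *\<^sub>R a)"
  by (auto simp: herm_def cinner_add_left cinner_add_right cinner_diff_left cinner_diff_right
      blinfun.bilinear_simps cinner_scaleC_left cinner_scaleC_right scaleR_scaleC
      cinner_minus_right cinner_diff_left[of 0, simplified])

lemma herm_comp: "herm a \<Longrightarrow> herm b \<Longrightarrow> a o\<^sub>L b = b o\<^sub>L a \<Longrightarrow> herm (a o\<^sub>L b)"
  unfolding herm_iff_adj by (auto simp: adj_comp)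

lemma blinfun_compose_assoc: "(a o\<^sub>L b) o\<^sub>L c = a o\<^sub>L (b o\<^sub>L c)"
  by (rule blinfun_eqI) simp

lemma herm_sandwich: "herm a \<Longrightarrow> b \<in> complex_ops \<Longrightarrow> herm (adj b o\<^sub>L a o\<^sub>L b)"
  unfolding herm_iff_adj by (auto simp: adj_comp adj_adj blinfun_compose_assoc)

lemma Im_herm: "herm a \<Longrightarrow> Im (cinner x (blinfun_apply a x)) = 0"
  using arg_cong[OF cinner_commute[of x "blinfun_apply a x"], of Im] herm_cinner[of a x x] by simp

section \<open>Positive operators\<close>

lemma blinfun_compose_id [simp]: "id_blinfun o\<^sub>L a = a" "a o\<^sub>L id_blinfun = a"
  by (rule blinfun_eqI, simp)+

lemma herm_inner: "herm a \<Longrightarrow> inner (blinfun_apply a x) y = inner x (blinfun_apply a y)"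
  by (simp add: inner_cinner herm_cinner)

text \<open>Polarization: the quadratic form is real at x + y and at x + \<i> y, and these two facts
  give the imaginary and the real part of the symmetry.\<close>

lemma op_pos_herm:
  fixes a :: "'h::complex_hilbert \<Rightarrow>\<^sub>L 'h"
  assumes "op_pos a"
  shows "herm a"
proof -
  have a: "a \<in> complex_ops" and p: "Im (cinner x (blinfun_apply a x)) = 0" for x
    using assms by (auto simp: op_pos_def complex_nonneg_Reals_iff)
  have "cinner (blinfun_apply a x) y = cinner x (blinfun_apply a y)" for x y
  proof -
    have "Im (cinner x (blinfun_apply a y)) + Im (cinner y (blinfun_apply a x)) = 0"
      using p[of "x + y"] p[of x] p[of y]
      by (simp add: cinner_add_left cinner_add_right blinfun.bilinear_simps)
    moreover have "Re (cinner x (blinfun_apply a y)) = Re (cinner y (blinfun_apply a x))"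
      using p[of "x + \<i> *\<^sub>C y"] p[of x] p[of y]
      by (simp add: cinner_add_left cinner_add_right blinfun.bilinear_simps complex_ops_scaleC[OF a]
          cinner_scaleC_left cinner_scaleC_right)
    ultimately have "cinner x (blinfun_apply a y) = cnj (cinner y (blinfun_apply a x))"
      by (simp add: complex_eq_iff)
    then show ?thesis
      using cinner_commute[of "blinfun_apply a x" y] by simp
  qed
  then show ?thesis
    using a by (simp add: herm_def)
qed

lemma op_pos_iff: "op_pos a \<longleftrightarrow> herm a \<and> (\<forall>x. 0 \<le> inner x (blinfun_apply a x))"
proof -
  have "op_pos a \<longleftrightarrow> (\<forall>x. 0 \<le> inner x (blinfun_apply a x))" if "herm a"
    unfolding op_pos_def complex_nonneg_Reals_iff inner_cinner
    using Im_herm[OF that] herm_ops[OF that] by auto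
  then show ?thesis
    using op_pos_herm by blast
qed

lemma op_le_iff: "herm a \<Longrightarrow> herm b \<Longrightarrow>
    a \<le>\<^sub>o b \<longleftrightarrow> (\<forall>x. inner x (blinfun_apply a x) \<le> inner x (blinfun_apply b x))"
  by (auto simp: op_le_def op_pos_iff herm_diff blinfun.bilinear_simps inner_diff_right)

lemma op_le_herm: "a \<le>\<^sub>o b \<Longrightarrow> herm a \<longleftrightarrow> herm b"
  using herm_diff[of b "b - a"] herm_add[of "b - a" a] op_pos_herm[of "b - a"]
  by (auto simp: op_le_def)

lemma op_le_inner: "a \<le>\<^sub>o b \<Longrightarrow> inner x (blinfun_apply a x) \<le> inner x (blinfun_apply b x)"
  by (auto simp: op_le_def op_pos_iff blinfun.bilinear_simps inner_diff_right)

lemma op_pos_inner: "op_pos a \<Longrightarrow> 0 \<le> inner x (blinfun_apply a x)"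
  by (simp add: op_pos_iff)

lemma op_pos_zero [simp, intro]: "op_pos 0"
  and op_pos_id [simp, intro]: "op_pos id_blinfun"
  and op_pos_add [intro]: "op_pos a \<Longrightarrow> op_pos b \<Longrightarrow> op_pos (a + b)"
  and op_pos_scaleR [intro]: "op_pos a \<Longrightarrow> 0 \<le> r \<Longrightarrow> op_pos (r *\<^sub>R a)"
  by (auto simp: op_pos_iff herm_add herm_scaleR blinfun.bilinear_simps inner_add_right)

lemma op_le_refl [simp, intro]: "a \<le>\<^sub>o a"
  and op_le_trans [trans]: "a \<le>\<^sub>o b \<Longrightarrow> b \<le>\<^sub>o c \<Longrightarrow> a \<le>\<^sub>o c"
  and op_le_zero_iff: "0 \<le>\<^sub>o a \<longleftrightarrow> op_pos a"
  using op_pos_add[of "b - a" "c - b"] by (auto simp: op_le_def)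

lemma op_pos_sandwich:
  fixes a b :: "'h::complex_hilbert \<Rightarrow>\<^sub>L 'h"
  assumes "op_pos a" "b \<in> complex_ops"
  shows "op_pos (adj b o\<^sub>L a o\<^sub>L b)"
  using assms by (auto simp: op_pos_iff herm_sandwich inner_cinner cinner_adj_right)

lemma op_pos_sandwich_herm: "op_pos a \<Longrightarrow> herm b \<Longrightarrow> op_pos (b o\<^sub>L a o\<^sub>L b)"
  using op_pos_sandwich[of a b] by (simp add: herm_adj herm_ops)

lemma op_pos_adj_comp: "b \<in> complex_ops \<Longrightarrow> op_pos (adj b o\<^sub>L b)"
  using op_pos_sandwich[OF op_pos_id, of b] by (simp add: blinfun_compose_assoc)

lemma op_pos_cauchy_schwarz:
  assumes "op_pos a"
  shows "(inner x (blinfun_apply a y))\<^sup>2 \<le> inner x (blinfun_apply a x) * inner y (blinfun_apply a y)"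
proof -
  define A B C where "A = inner x (blinfun_apply a x)" and "B = inner x (blinfun_apply a y)"
    and "C = inner y (blinfun_apply a y)"
  have a: "herm a" and pos: "0 \<le> inner x (blinfun_apply a x)" for x
    using assms by (auto simp: op_pos_iff)
  have B: "inner y (blinfun_apply a x) = B"
    unfolding B_def by (metis herm_inner[OF a] inner_commute)
  have q: "0 \<le> A + 2 * t * B + t\<^sup>2 * C" for t
    using pos[of "x + t *\<^sub>R y"] B unfolding A_def B_def C_def
    by (simp add: blinfun.bilinear_simps inner_add_left inner_add_right power2_eq_square algebra_simps)
  have "C \<ge> 0"
    using pos by (simp add: C_def)
  have "B\<^sup>2 \<le> A * C"
  proof (cases "C = 0")
    case True
    have "B = 0"
    proof (rule ccontr)
      assume "B \<noteq> 0"
      \<comment> \<open>With C = 0 the quadratic is affine in t; the chosen t gives it the value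
        -1.\<close>
      then show False
        using q[of "- (A + 1) / (2 * B)"] True by (simp add: field_simps)
    qed
    then show ?thesis
      using True by simp
  next
    case False
    then have "C > 0"
      using \<open>C \<ge> 0\<close> by simp
    then show ?thesis
      using q[of "- B / C"] by (simp add: field_simps power2_eq_square)
  qed
  then show ?thesis
    by (simp add: A_def B_def C_def)
qed

text \<open>Cauchy-Schwarz for the form of a, at the vectors a h and h, bounds the fourth power of
  the norm of a h by <a h, a (a h)> <h, a h>, and the form bound absorbs one square. This turns
  convergence or vanishing of quadratic forms into statements about vectors.\<close>

lemma op_pos_norm_sq_le:
  assumes "op_pos a" "\<And>x. inner x (blinfun_apply a x) \<le> K * (norm x)\<^sup>2"
  shows "(norm (blinfun_apply a h))\<^sup>2 \<le> K * inner h (blinfun_apply a h)"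
proof -
  let ?n = "(norm (blinfun_apply a h))\<^sup>2" and ?C = "inner h (blinfun_apply a h)"
  have C: "0 \<le> ?C"
    by (rule op_pos_inner[OF assms(1)])
  have "?n\<^sup>2 \<le> inner (blinfun_apply a h) (blinfun_apply a (blinfun_apply a h)) * ?C"
    using op_pos_cauchy_schwarz[OF assms(1), of "blinfun_apply a h" h] by (simp add: power2_norm_eq_inner)
  also have "\<dots> \<le> (K * ?n) * ?C"
    by (intro mult_right_mono assms(2) C)
  finally have *: "?n * ?n \<le> ?n * (K * ?C)"
    by (simp add: power2_eq_square mult_ac)
  show ?thesis
  proof (cases "h = 0")
    case False
    have "0 \<le> K * (norm h)\<^sup>2"
      using assms(2)[of h] C by linarith
    then have "0 \<le> K"
      using False by (simp add: zero_le_mult_iff)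
    then have "0 \<le> K * ?C"
      using C by simp
    then show ?thesis
      using * mult_left_le_imp_le[of ?n ?n "K * ?C"] by (cases "?n = 0") auto
  qed simp
qed

lemma inner_op_le: "inner x (blinfun_apply a x) \<le> norm a * (norm x)\<^sup>2"
proof -
  have "inner x (blinfun_apply a x) \<le> norm x * norm (blinfun_apply a x)"
    by (rule norm_cauchy_schwarz)
  also have "\<dots> \<le> norm x * (norm a * norm x)"
    by (intro mult_left_mono norm_blinfun) auto
  finally show ?thesis
    by (simp add: power2_eq_square mult_ac)
qed

lemma herm_eq_zero:
  assumes "herm a" "\<And>x. inner x (blinfun_apply a x) = 0"
  shows "a = 0"
proof -
  have "op_pos a"
    using assms by (simp add: op_pos_iff)
  then have "(norm (blinfun_apply a h))\<^sup>2 \<le> 0" for h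
    using op_pos_norm_sq_le[of a 0 h] assms(2) by simp
  then show ?thesis
    by (intro blinfun_eqI) simp
qed

lemma herm_eqI:
  assumes "herm a" "herm b" "\<And>x. inner x (blinfun_apply a x) = inner x (blinfun_apply b x)"
  shows "a = b"
  using herm_eq_zero[of "a - b"] assms by (simp add: herm_diff blinfun.bilinear_simps inner_diff_right)

lemma op_le_antisym: "a \<le>\<^sub>o b \<Longrightarrow> b \<le>\<^sub>o a \<Longrightarrow> a = b"
  using herm_eq_zero[of "a - b"] op_pos_herm[of "a - b"] op_le_inner[of a b] op_le_inner[of b a]
  by (force simp: op_le_def blinfun.bilinear_simps inner_diff_right intro: order_antisym)

lemma op_le_norm_bound:
  assumes "op_pos a" "\<And>x. inner x (blinfun_apply a x) \<le> K * (norm x)\<^sup>2"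
  shows "norm (blinfun_apply a h) \<le> K * norm h"
proof (cases "h = 0")
  case False
  have "0 \<le> K * (norm h)\<^sup>2"
    using assms(2)[of h] op_pos_inner[OF assms(1), of h] by linarith
  then have "0 \<le> K"
    using False by (simp add: zero_le_mult_iff)
  have "(norm (blinfun_apply a h))\<^sup>2 \<le> K * inner h (blinfun_apply a h)"
    by (rule op_pos_norm_sq_le[OF assms])
  also have "\<dots> \<le> K * (K * (norm h)\<^sup>2)"
    by (intro mult_left_mono assms(2) \<open>0 \<le> K\<close>)
  finally have "(norm (blinfun_apply a h))\<^sup>2 \<le> (K * norm h)\<^sup>2"
    by (simp add: power2_eq_square mult_ac)
  then show ?thesis
    by (rule power2_le_imp_le) (simp add: \<open>0 \<le> K\<close>)
qed simp

section \<open>Monotone convergence of operators\<close>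

text \<open>With D regarded as a net indexed by itself, strong convergence along D becomes an
  ordinary filter limit.\<close>

definition tails :: "('h::complex_hilbert \<Rightarrow>\<^sub>L 'h) set \<Rightarrow> ('h \<Rightarrow>\<^sub>L 'h) filter" where
  "tails D = (INF d\<in>D. principal {e\<in>D. d \<le>\<^sub>o e})"

lemma eventually_tails:
  assumes "directed D"
  shows "eventually P (tails D) \<longleftrightarrow> (\<exists>d\<in>D. \<forall>e\<in>D. d \<le>\<^sub>o e \<longrightarrow> P e)"
  unfolding tails_def
proof (subst eventually_INF_base)
  show "D \<noteq> {}"
    using assms by (simp add: directed_def)
  fix a b assume "a \<in> D" "b \<in> D"
  then obtain c where "c \<in> D" "a \<le>\<^sub>o c" "b \<le>\<^sub>o c"
    using assms by (auto simp: directed_def)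
  then show "\<exists>x\<in>D. principal {e \<in> D. x \<le>\<^sub>o e}
      \<le> inf (principal {e \<in> D. a \<le>\<^sub>o e}) (principal {e \<in> D. b \<le>\<^sub>o e})"
    by (intro bexI[of _ c]) (auto intro: op_le_trans)
qed (auto simp: eventually_principal)

lemma tails_not_bot: "directed D \<Longrightarrow> tails D \<noteq> bot"
  unfolding trivial_limit_def by (auto simp: eventually_tails)

text \<open>For each h the numbers <h, d h> increase and are bounded, hence nearly constant from
  some d2 on; \<open>op_pos_norm_sq_le\<close> for e - d2 turns this into the Cauchy property of d
  h. The clause about c is what later places limits in von Neumann algebras: strong limits preserve
  commutation.\<close>

lemma directed_limit:
  fixes D :: "('h::complex_hilbert \<Rightarrow>\<^sub>L 'h) set"
  assumes D: "directed D" "\<And>d. d \<in> D \<Longrightarrow> herm d" and t: "\<And>d. d \<in> D \<Longrightarrow> d \<le>\<^sub>o t"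
  obtains T where "herm T" "\<And>h. ((\<lambda>d. blinfun_apply d h) \<longlongrightarrow> blinfun_apply T h) (tails D)"
    "\<And>d. d \<in> D \<Longrightarrow> d \<le>\<^sub>o T" "\<And>t. (\<And>d. d \<in> D \<Longrightarrow> d \<le>\<^sub>o t) \<Longrightarrow> T \<le>\<^sub>o t"
    "\<And>c. (\<And>d. d \<in> D \<Longrightarrow> d o\<^sub>L c = c o\<^sub>L d) \<Longrightarrow> T o\<^sub>L c = c o\<^sub>L T"
proof -
  note nb = tails_not_bot[OF D(1)]
  obtain d0 where d0: "d0 \<in> D"
    using D(1) by (auto simp: directed_def)
  \<comment> \<open>All differences e - d with d0 \<le> d \<le> e lie below t - d0, so this K serves
    uniformly although D may be unbounded below.\<close>
  define K where "K = norm (t - d0)"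
  have gap: "op_pos (e - d)" "inner x (blinfun_apply (e - d) x) \<le> K * (norm x)\<^sup>2"
    if "d \<in> D" "e \<in> D" "d0 \<le>\<^sub>o d" "d \<le>\<^sub>o e" for d e x
  proof -
    show "op_pos (e - d)"
      using that by (simp add: op_le_def)
    have "inner x (blinfun_apply (e - d) x) \<le> inner x (blinfun_apply (t - d0) x)"
      using op_le_inner[OF that(3), of x] op_le_inner[OF t[OF that(2)], of x]
      by (simp add: blinfun.bilinear_simps inner_diff_right)
    also have "\<dots> \<le> K * (norm x)\<^sup>2"
      unfolding K_def by (rule inner_op_le)
    finally show "inner x (blinfun_apply (e - d) x) \<le> K * (norm x)\<^sup>2" .
  qed
  have ex: "\<exists>l. ((\<lambda>d. blinfun_apply d h) \<longlongrightarrow> l) (tails D)" for h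
  proof (rule cauchy_tendsto[OF nb])
    fix \<epsilon> :: real assume "\<epsilon> > 0"
    \<comment> \<open>Chosen so that K * \<eta> is below (\<epsilon>/2)^2; the added 1 covers K =
      0.\<close>
    define \<eta> where "\<eta> = (\<epsilon>/2)\<^sup>2 / (K + 1)"
    have K: "K \<ge> 0"
      by (simp add: K_def)
    then have "\<eta> > 0"
      using \<open>\<epsilon> > 0\<close> by (simp add: \<eta>_def)
    let ?q = "\<lambda>d. inner h (blinfun_apply d h)"
    have bdd: "bdd_above (?q ` D)"
      using op_le_inner[OF t] by (intro bdd_aboveI2)
    obtain d1 where d1: "d1 \<in> D" "?q d1 > (SUP d\<in>D. ?q d) - \<eta>"
      using less_cSUP_iff[OF _ bdd, of "(SUP d\<in>D. ?q d) - \<eta>"] d0 \<open>\<eta> > 0\<close> by auto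
    obtain d2 where d2: "d2 \<in> D" "d0 \<le>\<^sub>o d2" "d1 \<le>\<^sub>o d2"
      using D(1) d0 d1 unfolding directed_def by blast
    have near: "dist (blinfun_apply e h) (blinfun_apply d2 h) < \<epsilon> / 2" if e: "e \<in> D" "d2 \<le>\<^sub>o e" for e
    proof -
      have "(norm (blinfun_apply (e - d2) h))\<^sup>2 \<le> K * inner h (blinfun_apply (e - d2) h)"
        by (intro op_pos_norm_sq_le gap) (use e d2 in auto)
      also have "\<dots> \<le> K * \<eta>"
      proof (intro mult_left_mono K)
        have "?q e \<le> (SUP d\<in>D. ?q d)"
          using bdd e by (intro cSUP_upper)
        then show "inner h (blinfun_apply (e - d2) h) \<le> \<eta>"
          using d1(2) op_le_inner[OF d2(3), of h] by (simp add: blinfun.bilinear_simps inner_diff_right)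
      qed
      also have "\<dots> < (K + 1) * \<eta>"
        using \<open>\<eta> > 0\<close> by (simp add: algebra_simps)
      also have "\<dots> = (\<epsilon>/2)\<^sup>2"
        using K by (simp add: \<eta>_def)
      finally have "norm (blinfun_apply (e - d2) h) < \<epsilon> / 2"
        by (rule power_less_imp_less_base) (use \<open>\<epsilon> > 0\<close> in simp)
      then show ?thesis
        by (simp add: dist_norm blinfun.bilinear_simps)
    qed
    show "\<exists>P. eventually P (tails D) \<and>
        (\<forall>x y. P x \<and> P y \<longrightarrow> dist (blinfun_apply x h) (blinfun_apply y h) < \<epsilon>)"
    proof (intro exI conjI allI impI)
      show "eventually (\<lambda>e. e \<in> D \<and> d2 \<le>\<^sub>o e) (tails D)"
        using d2(1) by (auto simp: eventually_tails[OF D(1)])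
      show "dist (blinfun_apply x h) (blinfun_apply y h) < \<epsilon>"
        if "(x \<in> D \<and> d2 \<le>\<^sub>o x) \<and> (y \<in> D \<and> d2 \<le>\<^sub>o y)" for x y
        using near[of x] near[of y] that dist_triangle_half_l by blast
    qed
  qed
  then obtain L where L: "\<And>h. ((\<lambda>d. blinfun_apply d h) \<longlongrightarrow> L h) (tails D)"
    by metis
  have inD: "eventually (\<lambda>d. d \<in> D \<and> d1 \<le>\<^sub>o d) (tails D)" if "d1 \<in> D" for d1
    using that by (auto simp: eventually_tails[OF D(1)])
  have "bounded_linear L"
  proof (rule bounded_linear_intro)
    show "L (x + y) = L x + L y" for x y
      by (rule tendsto_unique[OF nb L]) (simp add: blinfun.bilinear_simps tendsto_add L)
    show "L (r *\<^sub>R x) = r *\<^sub>R L x" for r x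
      by (rule tendsto_unique[OF nb L]) (simp add: blinfun.bilinear_simps tendsto_scaleR L)
    show "norm (L x) \<le> norm x * (K + norm d0)" for x
    proof (rule tendsto_upperbound[OF tendsto_norm[OF L] _ nb])
      show "\<forall>\<^sub>F d in tails D. norm (blinfun_apply d x) \<le> norm x * (K + norm d0)"
        using inD[OF d0]
      proof eventually_elim
        case (elim d)
        have "norm (blinfun_apply d x) \<le> norm (blinfun_apply (d - d0) x) + norm (blinfun_apply d0 x)"
          using norm_triangle_ineq[of "blinfun_apply (d - d0) x" "blinfun_apply d0 x"]
          by (simp add: blinfun.bilinear_simps)
        also have "\<dots> \<le> K * norm x + norm d0 * norm x"
          by (intro add_mono op_le_norm_bound gap norm_blinfun) (use d0 elim in auto)
        finally show ?case
          by (simp add: algebra_simps)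
      qed
    qed
  qed
  define T where "T = Blinfun L"
  have T: "blinfun_apply T = L"
    by (simp add: T_def bounded_linear_Blinfun_apply \<open>bounded_linear L\<close>)
  have lim: "((\<lambda>d. blinfun_apply d h) \<longlongrightarrow> blinfun_apply T h) (tails D)" for h
    by (simp add: T L)
  note ev = inD[OF d0]
  have lim_inner: "((\<lambda>d. inner h (blinfun_apply d h)) \<longlongrightarrow> inner h (blinfun_apply T h)) (tails D)" for h
    by (intro tendsto_intros lim)
  have "T \<in> complex_ops"
    unfolding complex_ops_def
  proof (intro CollectI allI)
    fix c x
    have "((\<lambda>d. c *\<^sub>C blinfun_apply d x) \<longlongrightarrow> c *\<^sub>C blinfun_apply T x) (tails D)"
      using bounded_linear.tendsto[OF bounded_linear_scaleC lim] .
    then have "((\<lambda>d. blinfun_apply d (c *\<^sub>C x)) \<longlongrightarrow> c *\<^sub>C blinfun_apply T x) (tails D)"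
      by (rule Lim_transform_eventually)
        (use ev in eventually_elim, auto simp: complex_ops_scaleC herm_ops D(2))
    then show "blinfun_apply T (c *\<^sub>C x) = c *\<^sub>C blinfun_apply T x"
      using tendsto_unique[OF nb lim] by blast
  qed
  moreover have "cinner (blinfun_apply T x) y = cinner x (blinfun_apply T y)" for x y
  proof -
    have 1: "((\<lambda>d. cinner x (blinfun_apply d y)) \<longlongrightarrow> cinner x (blinfun_apply T y)) (tails D)" for x y
      by (rule bounded_linear.tendsto[OF bounded_linear_cinner lim])
    have "((\<lambda>d. cnj (cinner y (blinfun_apply d x))) \<longlongrightarrow> cnj (cinner y (blinfun_apply T x))) (tails D)"
      by (intro tendsto_cnj 1)
    then have "((\<lambda>d. cinner x (blinfun_apply d y)) \<longlongrightarrow> cnj (cinner y (blinfun_apply T x))) (tails D)"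
    proof (rule Lim_transform_eventually)
      show "\<forall>\<^sub>F d in tails D. cnj (cinner y (blinfun_apply d x)) = cinner x (blinfun_apply d y)"
        using ev
        by eventually_elim (metis D(2) cinner_commute herm_cinner)
    qed
    then have "cinner x (blinfun_apply T y) = cnj (cinner y (blinfun_apply T x))"
      using tendsto_unique[OF nb 1] by blast
    then show ?thesis
      using cinner_commute[of "blinfun_apply T x" y] by simp
  qed
  ultimately have herm: "herm T"
    by (simp add: herm_def)
  show thesis
  proof (rule that[OF herm lim])
    fix d assume d: "d \<in> D"
    have "inner h (blinfun_apply d h) \<le> inner h (blinfun_apply T h)" for h
      by (rule tendsto_lowerbound[OF lim_inner _ nb])
        (use inD[OF d] in eventually_elim, simp add: op_le_inner)
    then show "d \<le>\<^sub>o T"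
      using op_le_iff herm D(2)[OF d] by blast
  next
    fix t assume t: "\<And>d. d \<in> D \<Longrightarrow> d \<le>\<^sub>o t"
    have "inner h (blinfun_apply T h) \<le> inner h (blinfun_apply t h)" for h
      by (rule tendsto_upperbound[OF lim_inner _ nb])
        (use ev in eventually_elim, simp add: op_le_inner t)
    moreover have "herm t"
      using t[OF d0] D(2)[OF d0] op_le_herm by blast
    ultimately show "T \<le>\<^sub>o t"
      using op_le_iff herm by blast
  next
    fix c assume c: "\<And>d. d \<in> D \<Longrightarrow> d o\<^sub>L c = c o\<^sub>L d"
    show "T o\<^sub>L c = c o\<^sub>L T"
    proof (rule blinfun_eqI)
      fix h
      have "((\<lambda>d. blinfun_apply c (blinfun_apply d h)) \<longlongrightarrow> blinfun_apply c (blinfun_apply T h)) (tails D)"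
        by (intro tendsto_intros lim)
      then have "((\<lambda>d. blinfun_apply d (blinfun_apply c h)) \<longlongrightarrow> blinfun_apply c (blinfun_apply T h)) (tails D)"
        by (rule Lim_transform_eventually)
          (use ev in eventually_elim, metis c blinfun_apply_blinfun_compose)
      then show "blinfun_apply (T o\<^sub>L c) h = blinfun_apply (c o\<^sub>L T) h"
        using tendsto_unique[OF nb lim] by simp
    qed
  qed
qed

lemma increasing_limit:
  fixes a :: "nat \<Rightarrow> 'h::complex_hilbert \<Rightarrow>\<^sub>L 'h"
  assumes a: "\<And>n. herm (a n)" "\<And>n. a n \<le>\<^sub>o a (Suc n)" "\<And>n. a n \<le>\<^sub>o t"
  obtains T where "herm T" "\<And>h. (\<lambda>n. blinfun_apply (a n) h) \<longlonglongrightarrow> blinfun_apply T h"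
    "\<And>c. (\<And>n. a n o\<^sub>L c = c o\<^sub>L a n) \<Longrightarrow> T o\<^sub>L c = c o\<^sub>L T"
proof -
  have mono: "a m \<le>\<^sub>o a n" if "m \<le> n" for m n
    using that by (induction n rule: dec_induct) (auto intro: op_le_trans a)
  have dir: "directed (range a)"
    unfolding directed_def
  proof (intro conjI ballI)
    fix x y assume "x \<in> range a" "y \<in> range a"
    then obtain m n where "x = a m" "y = a n"
      by blast
    then show "\<exists>c\<in>range a. x \<le>\<^sub>o c \<and> y \<le>\<^sub>o c"
      using mono[of m "max m n"] mono[of n "max m n"] by auto
  qed auto
  have lim: "filterlim a (tails (range a)) sequentially"
    unfolding filterlim_iff eventually_tails[OF dir] eventually_sequentially
    using mono by blast
  obtain T where T: "herm T"
    "\<And>h. ((\<lambda>d. blinfun_apply d h) \<longlongrightarrow> blinfun_apply T h) (tails (range a))"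
    "\<And>c. (\<And>d. d \<in> range a \<Longrightarrow> d o\<^sub>L c = c o\<^sub>L d) \<Longrightarrow> T o\<^sub>L c = c o\<^sub>L T"
    by (rule directed_limit[OF dir, of t]) (use a in auto)
  show thesis
  proof (rule that[OF T(1)])
    show "(\<lambda>n. blinfun_apply (a n) h) \<longlonglongrightarrow> blinfun_apply T h" for h
      using filterlim_compose[OF T(2) lim] .
    show "T o\<^sub>L c = c o\<^sub>L T" if "\<And>n. a n o\<^sub>L c = c o\<^sub>L a n" for c
      using that by (intro T(3)) auto
  qed
qed

interpretation blinfun_compose: bounded_bilinear "(o\<^sub>L)"
  by (rule bounded_bilinear_blinfun_compose)

section \<open>Square roots and spectral projections\<close>

text \<open>The polynomials in b with nonnegative coefficients. Working in this cone gives the monotonicity of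
  the iteration for the square root, at a stage where the positivity of products of commuting positive
  operators is not yet available.\<close>

inductive_set pcone :: "('h::complex_hilbert \<Rightarrow>\<^sub>L 'h) \<Rightarrow> ('h \<Rightarrow>\<^sub>L 'h) set" for b where
  id: "id_blinfun \<in> pcone b"
| shift: "x \<in> pcone b \<Longrightarrow> b o\<^sub>L x \<in> pcone b"
| add: "x \<in> pcone b \<Longrightarrow> y \<in> pcone b \<Longrightarrow> x + y \<in> pcone b"
| scale: "x \<in> pcone b \<Longrightarrow> 0 \<le> r \<Longrightarrow> r *\<^sub>R x \<in> pcone b"

lemma pcone_comp: "x \<in> pcone b \<Longrightarrow> y \<in> pcone b \<Longrightarrow> x o\<^sub>L y \<in> pcone b"
proof (induction rule: pcone.induct)
  case (shift x)
  then show ?case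
    by (simp add: blinfun_compose_assoc pcone.shift)
next
  case (add x x')
  then show ?case
    by (simp add: blinfun_compose.add_left pcone.add)
next
  case (scale x r)
  then show ?case
    by (simp add: blinfun_compose.scaleR_left pcone.scale)
qed simp

lemma pcone_commute: "x \<in> pcone b \<Longrightarrow> b o\<^sub>L c = c o\<^sub>L b \<Longrightarrow> x o\<^sub>L c = c o\<^sub>L x"
proof (induction rule: pcone.induct)
  case (shift x)
  then show ?case
    by (metis blinfun_compose_assoc)
next
  case (add x x')
  then show ?case
    by (simp add: blinfun_compose.add_left blinfun_compose.add_right)
next
  case (scale x r)
  then show ?case
    by (simp add: blinfun_compose.scaleR_left blinfun_compose.scaleR_right)
qed simp

lemma pcone_commutes:
  assumes "x \<in> pcone b" "y \<in> pcone b"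
  shows "x o\<^sub>L y = y o\<^sub>L x"
  using pcone_commute[OF assms(1)] pcone_commute[OF assms(2), of b] by metis

lemma pcone_pos:
  assumes "op_pos b" "x \<in> pcone b"
  shows "op_pos x" "op_pos (b o\<^sub>L x)"
proof -
  have "op_pos x \<and> op_pos (b o\<^sub>L x)"
    using assms(2)
  proof (induction rule: pcone.induct)
    case (shift x)
    have "b o\<^sub>L (b o\<^sub>L x) = b o\<^sub>L x o\<^sub>L b"
      using pcone_commute[OF shift(1), of b] by (simp add: blinfun_compose_assoc)
    then show ?case
      using shift op_pos_sandwich_herm[of x b] assms(1) by (auto simp: op_pos_herm)
  next
    case (add x y)
    then show ?case
      by (simp add: op_pos_add blinfun_compose.add_right)
  next
    case (scale x r)
    then show ?case
      by (simp add: op_pos_scaleR blinfun_compose.scaleR_right)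
  qed (use assms in auto)
  then show "op_pos x" "op_pos (b o\<^sub>L x)"
    by auto
qed

text \<open>Iterates for \<open>1 - sqrt (1 - b)\<close>, the least solution of \<open>y = (b + y\<^sup>2) / 2\<close>.\<close>

primrec sqrt_seq :: "('h::complex_hilbert \<Rightarrow>\<^sub>L 'h) \<Rightarrow> nat \<Rightarrow> 'h \<Rightarrow>\<^sub>L 'h" where
  "sqrt_seq b 0 = 0"
| "sqrt_seq b (Suc n) = (1/2) *\<^sub>R (b + (sqrt_seq b n o\<^sub>L sqrt_seq b n))"

lemma sqrt_seq_pcone: "sqrt_seq b n \<in> pcone b"
proof (induction n)
  case 0
  then show ?case
    using pcone.scale[OF pcone.id, of 0 b] by simp
next
  case (Suc n)
  have "b \<in> pcone b"
    using pcone.shift[OF pcone.id, of b] by simp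
  then show ?case
    using Suc by (auto intro!: pcone.scale pcone.add pcone_comp)
qed

lemma sqrt_seq_mono: "sqrt_seq b (Suc n) - sqrt_seq b n \<in> pcone b"
proof (induction n)
  case 0
  have "b \<in> pcone b"
    using pcone.shift[OF pcone.id, of b] by simp
  then show ?case
    using pcone.scale[of b b "1/2"] by (simp add: blinfun_compose.zero_left)
next
  case (Suc n)
  let ?x = "sqrt_seq b (Suc n)" and ?y = "sqrt_seq b n"
  have "sqrt_seq b (Suc (Suc n)) - ?x = (1/2) *\<^sub>R ((?x o\<^sub>L ?x) - (?y o\<^sub>L ?y))"
    by (simp add: algebra_simps)
  \<comment> \<open>Factoring the difference of squares, valid because elements of the cone commute,
    keeps the increment in the cone.\<close>
  also have "(?x o\<^sub>L ?x) - (?y o\<^sub>L ?y) = (?x + ?y) o\<^sub>L (?x - ?y)"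
    using pcone_commutes[OF sqrt_seq_pcone[of b "Suc n"] sqrt_seq_pcone[of b n]]
    by (simp only: blinfun_compose.add_left blinfun_compose.diff_right) simp
  finally show ?case
    using Suc by (auto intro!: pcone.scale pcone_comp pcone.add sqrt_seq_pcone simp del: sqrt_seq.simps)
qed

lemma op_le_id_iff: "herm a \<Longrightarrow> a \<le>\<^sub>o id_blinfun \<longleftrightarrow> (\<forall>x. inner x (blinfun_apply a x) \<le> (norm x)\<^sup>2)"
  by (simp add: op_le_iff power2_norm_eq_inner)

lemma norm_sq_le_inner:
  assumes "op_pos a" "a \<le>\<^sub>o id_blinfun"
  shows "(norm (blinfun_apply a h))\<^sup>2 \<le> inner h (blinfun_apply a h)"
  using op_pos_norm_sq_le[of a 1 h] assms by (simp add: op_le_id_iff op_pos_herm)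

text \<open>The limit Y of the iterates for b = 1 - a satisfies Y = (b + Y^2) / 2, that is (1 - Y)^2
  = 1 - b = a, so 1 - Y is the root. The bound by 1 is inductive: a positive contraction y satisfies
  y^2 \<le> y by \<open>norm_sq_le_inner\<close>.\<close>

lemma ex_sqrt_contraction:
  fixes a :: "'h::complex_hilbert \<Rightarrow>\<^sub>L 'h"
  assumes "op_pos a" "a \<le>\<^sub>o id_blinfun"
  shows "\<exists>s. op_pos s \<and> s o\<^sub>L s = a \<and> (\<forall>c. a o\<^sub>L c = c o\<^sub>L a \<longrightarrow> s o\<^sub>L c = c o\<^sub>L s)"
proof -
  define b where "b = id_blinfun - a"
  have b: "op_pos b" "b \<le>\<^sub>o id_blinfun"
    using assms by (auto simp: b_def op_le_def)
  let ?y = "sqrt_seq b"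
  have pos: "op_pos (?y n)" for n
    using pcone_pos(1)[OF b(1) sqrt_seq_pcone] .
  have le: "?y n \<le>\<^sub>o id_blinfun" for n
  proof (induction n)
    case 0
    then show ?case
      by (simp add: op_le_def)
  next
    case (Suc n)
    have "inner x (blinfun_apply (?y (Suc n)) x) \<le> (norm x)\<^sup>2" for x
    proof -
      have "inner x (blinfun_apply (?y n) (blinfun_apply (?y n) x)) = (norm (blinfun_apply (?y n) x))\<^sup>2"
        by (simp add: herm_inner[OF op_pos_herm[OF pos], symmetric] power2_norm_eq_inner)
      also have "\<dots> \<le> inner x (blinfun_apply (?y n) x)"
        by (rule norm_sq_le_inner[OF pos Suc])
      also have "\<dots> \<le> (norm x)\<^sup>2"
        using Suc pos by (simp add: op_le_id_iff op_pos_herm)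
      finally show ?thesis
        using op_le_inner[OF b(2), of x]
        by (simp add: blinfun.bilinear_simps inner_add_right power2_norm_eq_inner)
    qed
    then show ?case
      using op_le_id_iff[OF op_pos_herm[OF pos[of "Suc n"]]] by blast
  qed
  obtain Y where Y: "herm Y" "\<And>h. (\<lambda>n. blinfun_apply (?y n) h) \<longlonglongrightarrow> blinfun_apply Y h"
    "\<And>c. (\<And>n. ?y n o\<^sub>L c = c o\<^sub>L ?y n) \<Longrightarrow> Y o\<^sub>L c = c o\<^sub>L Y"
  proof (rule increasing_limit[of ?y id_blinfun])
    show "?y n \<le>\<^sub>o ?y (Suc n)" for n
      unfolding op_le_def by (rule pcone_pos(1)[OF b(1) sqrt_seq_mono])
  qed (use pos le op_pos_herm in auto)
  \<comment> \<open>The equation is compared through quadratic forms: <x, y (y x)> is the squared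
    norm of y x, so strong convergence of the iterates passes to their squares.\<close>
  have YY: "Y = (1/2) *\<^sub>R (b + (Y o\<^sub>L Y))"
  proof (rule herm_eqI)
    show "herm ((1/2) *\<^sub>R (b + (Y o\<^sub>L Y)))"
      using Y(1) op_pos_herm[OF b(1)] by (intro herm_scaleR herm_add herm_comp) auto
    fix x
    have 1: "(\<lambda>n. inner x (blinfun_apply (?y (Suc n)) x)) \<longlonglongrightarrow> inner x (blinfun_apply Y x)"
      by (intro tendsto_intros LIMSEQ_Suc[OF Y(2)])
    have 2: "inner x (blinfun_apply (?y (Suc n)) x)
        = (inner x (blinfun_apply b x) + (norm (blinfun_apply (?y n) x))\<^sup>2) / 2" for n
      by (simp add: blinfun.bilinear_simps inner_add_right power2_norm_eq_inner
          herm_inner[OF op_pos_herm[OF pos], symmetric])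
    have "(\<lambda>n. (inner x (blinfun_apply b x) + (norm (blinfun_apply (?y n) x))\<^sup>2) / 2)
        \<longlonglongrightarrow> (inner x (blinfun_apply b x) + (norm (blinfun_apply Y x))\<^sup>2) / 2"
      by (intro tendsto_intros Y(2)) auto
    then have "inner x (blinfun_apply Y x) = (inner x (blinfun_apply b x) + (norm (blinfun_apply Y x))\<^sup>2) / 2"
      by (rule LIMSEQ_unique[OF 1[unfolded 2]])
    then show "inner x (blinfun_apply Y x) = inner x (blinfun_apply ((1/2) *\<^sub>R (b + (Y o\<^sub>L Y))) x)"
      by (simp add: blinfun.bilinear_simps inner_add_right power2_norm_eq_inner
          herm_inner[OF Y(1), symmetric])
  qed (use Y in simp)
  define s where "s = id_blinfun - Y"
  have "inner x (blinfun_apply Y x) \<le> (norm x)\<^sup>2" for x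
  proof (rule LIMSEQ_le_const2)
    show "(\<lambda>n. inner x (blinfun_apply (?y n) x)) \<longlonglongrightarrow> inner x (blinfun_apply Y x)"
      by (intro tendsto_intros Y(2))
    show "\<exists>N. \<forall>n\<ge>N. inner x (blinfun_apply (?y n) x) \<le> (norm x)\<^sup>2"
      using le op_le_id_iff[OF op_pos_herm[OF pos]] by blast
  qed
  then have "op_pos s"
    using Y(1) op_le_id_iff[of Y] by (simp add: s_def op_le_def)
  moreover have "s o\<^sub>L s = a"
  proof -
    have "Y + Y = b + (Y o\<^sub>L Y)"
      using arg_cong[OF YY, of "\<lambda>x. 2 *\<^sub>R x"] by (simp add: scaleR_2)
    then show ?thesis
      unfolding s_def by (simp add: blinfun_compose.diff_left blinfun_compose.diff_right b_def algebra_simps)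
  qed
  moreover have "s o\<^sub>L c = c o\<^sub>L s" if "a o\<^sub>L c = c o\<^sub>L a" for c
  proof -
    have "b o\<^sub>L c = c o\<^sub>L b"
      using that by (simp add: b_def blinfun_compose.diff_left blinfun_compose.diff_right)
    then have "Y o\<^sub>L c = c o\<^sub>L Y"
      by (intro Y(3) pcone_commute[OF sqrt_seq_pcone])
    then show ?thesis
      by (simp add: s_def blinfun_compose.diff_left blinfun_compose.diff_right)
  qed
  ultimately show ?thesis
    by blast
qed

lemma ex_sqrt:
  fixes a :: "'h::complex_hilbert \<Rightarrow>\<^sub>L 'h"
  assumes "op_pos a"
  obtains s where "op_pos s" "s o\<^sub>L s = a" "\<And>c. a o\<^sub>L c = c o\<^sub>L a \<Longrightarrow> s o\<^sub>L c = c o\<^sub>L s"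
proof -
  define K where "K = norm a + 1"
  have K: "K > 0"
    by (simp add: K_def add_nonneg_pos)
  define a' where "a' = (1/K) *\<^sub>R a"
  have a: "a = K *\<^sub>R a'"
    using K by (simp add: a'_def)
  have "op_pos a'"
    using assms K by (simp add: a'_def op_pos_scaleR)
  moreover have "a' \<le>\<^sub>o id_blinfun"
    unfolding op_le_id_iff[OF op_pos_herm[OF \<open>op_pos a'\<close>]]
  proof
    fix x
    have "inner x (blinfun_apply a x) \<le> norm a * (norm x)\<^sup>2"
      by (rule inner_op_le)
    also have "\<dots> \<le> K * (norm x)\<^sup>2"
      by (simp add: K_def mult_right_mono)
    finally show "inner x (blinfun_apply a' x) \<le> (norm x)\<^sup>2"
      using K by (simp add: a'_def blinfun.bilinear_simps field_simps)
  qed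
  ultimately obtain s where s: "op_pos s" "s o\<^sub>L s = a'" "\<And>c. a' o\<^sub>L c = c o\<^sub>L a' \<Longrightarrow> s o\<^sub>L c = c o\<^sub>L s"
    using ex_sqrt_contraction by blast
  show thesis
  proof (rule that[of "sqrt K *\<^sub>R s"])
    show "op_pos (sqrt K *\<^sub>R s)"
      using s(1) K by (simp add: op_pos_scaleR)
    show "(sqrt K *\<^sub>R s) o\<^sub>L (sqrt K *\<^sub>R s) = a"
      using K by (simp add: blinfun_compose.scaleR_left blinfun_compose.scaleR_right s(2) a)
    show "(sqrt K *\<^sub>R s) o\<^sub>L c = c o\<^sub>L (sqrt K *\<^sub>R s)" if "a o\<^sub>L c = c o\<^sub>L a" for c
      using that s(3)[of c]
      by (simp add: a'_def blinfun_compose.scaleR_left blinfun_compose.scaleR_right)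
  qed
qed

text \<open>The square root s of b commutes with a, so a b = s a s is a sandwich.\<close>

lemma op_pos_comp:
  assumes "op_pos a" "op_pos b" "a o\<^sub>L b = b o\<^sub>L a"
  shows "op_pos (a o\<^sub>L b)"
proof -
  obtain s where s: "op_pos s" "s o\<^sub>L s = b" "s o\<^sub>L a = a o\<^sub>L s"
    using ex_sqrt[OF assms(2)] assms(3) by metis
  have "a o\<^sub>L b = s o\<^sub>L a o\<^sub>L s"
    by (simp add: s(2)[symmetric] s(3) blinfun_compose_assoc)
  then show ?thesis
    using op_pos_sandwich_herm[OF assms(1) op_pos_herm[OF s(1)]] by simp
qed

section \<open>Projections, kernel projections and sign projections\<close>

definition proj :: "('h::complex_hilbert \<Rightarrow>\<^sub>L 'h) \<Rightarrow> bool" where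
  "proj p \<longleftrightarrow> herm p \<and> p o\<^sub>L p = p"

lemma proj_herm: "proj p \<Longrightarrow> herm p"
  and proj_idem: "proj p \<Longrightarrow> p o\<^sub>L p = p"
  by (auto simp: proj_def)

lemma proj_apply: "proj p \<Longrightarrow> blinfun_apply p (blinfun_apply p x) = blinfun_apply p x"
  by (metis blinfun_apply_blinfun_compose proj_idem)

lemma proj_ops: "proj p \<Longrightarrow> p \<in> complex_ops"
  by (simp add: proj_herm herm_ops)

lemma proj_inner: "proj p \<Longrightarrow> inner x (blinfun_apply p x) = (norm (blinfun_apply p x))\<^sup>2"
  by (metis herm_inner power2_norm_eq_inner proj_apply proj_herm)

lemma proj_pos: "proj p \<Longrightarrow> op_pos p"
  by (simp add: op_pos_iff proj_inner proj_herm)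

lemma proj_compl: "proj p \<Longrightarrow> proj (id_blinfun - p)"
  by (auto simp: proj_def herm_diff blinfun_compose.diff_left blinfun_compose.diff_right)

lemma proj_le_id: "proj p \<Longrightarrow> p \<le>\<^sub>o id_blinfun"
  unfolding op_le_def by (intro proj_pos proj_compl)

lemma proj_comp: "proj p \<Longrightarrow> proj q \<Longrightarrow> p o\<^sub>L q = q o\<^sub>L p \<Longrightarrow> proj (p o\<^sub>L q)"
  unfolding proj_def by (metis blinfun_compose_assoc herm_comp)

lemma proj_zero [simp]: "proj 0" and proj_id [simp]: "proj id_blinfun"
  by (auto simp: proj_def)

text \<open>For c = 1 - z^2 / K, where 0 \<le> c \<le> 1, the powers of c decrease strongly to the
  projection onto the fixed vectors of c, which form the kernel of z.\<close>

lemma ex_kernel_proj: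
  fixes z :: "'h::complex_hilbert \<Rightarrow>\<^sub>L 'h"
  assumes z: "herm z"
  obtains k where "proj k" "z o\<^sub>L k = 0" "\<And>h. blinfun_apply z h = 0 \<Longrightarrow> blinfun_apply k h = h"
    "\<And>c. z o\<^sub>L c = c o\<^sub>L z \<Longrightarrow> k o\<^sub>L c = c o\<^sub>L k"
proof -
  define K where "K = (norm z)\<^sup>2 + 1"
  have K: "K > 0"
    by (simp add: K_def add_nonneg_pos)
  define b where "b = (1/K) *\<^sub>R (z o\<^sub>L z)"
  define c where "c = id_blinfun - b"
  have zz: "inner x (blinfun_apply z (blinfun_apply z x)) = (norm (blinfun_apply z x))\<^sup>2" for x
    by (simp add: herm_inner[OF z, symmetric] power2_norm_eq_inner)
  have b: "op_pos b"
    using op_pos_adj_comp[OF herm_ops[OF z]] K z by (auto simp: b_def herm_adj intro!: op_pos_scaleR)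
  have "inner x (blinfun_apply b x) \<le> (norm x)\<^sup>2" for x
  proof -
    have "norm (blinfun_apply z x) \<le> norm z * norm x"
      by (rule norm_blinfun)
    then have "(norm (blinfun_apply z x))\<^sup>2 \<le> (norm z * norm x)\<^sup>2"
      by (rule power_mono) simp
    also have "\<dots> \<le> K * (norm x)\<^sup>2"
      by (simp add: K_def power_mult_distrib mult_right_mono)
    finally show ?thesis
      using K by (simp add: b_def blinfun.bilinear_simps zz field_simps)
  qed
  then have c: "op_pos c"
    using op_le_id_iff[OF op_pos_herm[OF b]] by (simp add: c_def op_le_def)
  have bc: "b o\<^sub>L c = c o\<^sub>L b"
    by (simp add: c_def blinfun_compose.diff_left blinfun_compose.diff_right)
  define a where "a n = ((o\<^sub>L) c ^^ n) id_blinfun" for n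
  have a0: "a 0 = id_blinfun" and aS: "a (Suc n) = c o\<^sub>L a n" for n
    by (auto simp: a_def)
  have acomm: "a n o\<^sub>L d = d o\<^sub>L a n" if "c o\<^sub>L d = d o\<^sub>L c" for n d
    by (induction n) (use that in \<open>auto simp: a0 aS blinfun_compose_assoc\<close>, metis blinfun_compose_assoc)
  have apos: "op_pos (a n)" for n
    by (induction n) (auto simp: a0 aS intro!: op_pos_comp c acomm[symmetric])
  have step: "a n - a (Suc n) = b o\<^sub>L a n" for n
    by (simp add: aS c_def blinfun_compose.diff_left)
  have ba: "a n o\<^sub>L b = b o\<^sub>L a n" for n
    by (rule acomm) (simp add: bc)
  obtain L where L: "herm L" "\<And>h. (\<lambda>n. blinfun_apply (- a n) h) \<longlonglongrightarrow> blinfun_apply L h"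
    "\<And>c. (\<And>n. (- a n) o\<^sub>L c = c o\<^sub>L (- a n)) \<Longrightarrow> L o\<^sub>L c = c o\<^sub>L L"
  \<comment> \<open>The powers decrease, so they enter the monotone limit with a minus sign.\<close>
  proof (rule increasing_limit[of "\<lambda>n. - a n" 0])
    show "herm (- a n)" for n
      using apos by (intro herm_minus op_pos_herm)
    show "- a n \<le>\<^sub>o - a (Suc n)" for n
    proof -
      have "op_pos (b o\<^sub>L a n)"
        by (intro op_pos_comp b apos ba[symmetric])
      then show ?thesis
        using step[of n] by (simp add: op_le_def)
    qed
    show "- a n \<le>\<^sub>o 0" for n
      using apos by (simp add: op_le_def)
  qed auto
  define k where "k = - L"
  have k: "herm k"
    using L(1) by (auto simp: k_def)
  have lim: "(\<lambda>n. blinfun_apply (a n) h) \<longlonglongrightarrow> blinfun_apply k h" for h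
    using tendsto_minus[OF L(2)[of h]] by (simp add: k_def blinfun.bilinear_simps)
  have ck: "blinfun_apply c (blinfun_apply k h) = blinfun_apply k h" for h
  proof -
    have "(\<lambda>n. blinfun_apply c (blinfun_apply (a n) h)) \<longlonglongrightarrow> blinfun_apply c (blinfun_apply k h)"
      by (intro tendsto_intros lim)
    moreover have "(\<lambda>n. blinfun_apply c (blinfun_apply (a n) h)) \<longlonglongrightarrow> blinfun_apply k h"
      using LIMSEQ_Suc[OF lim[of h]] by (simp add: aS)
    ultimately show ?thesis
      using LIMSEQ_unique by blast
  qed
  have fixpt: "blinfun_apply k h = h" if "blinfun_apply c h = h" for h
  proof -
    have "blinfun_apply (a n) h = h" for n
      by (induction n) (simp_all add: a0 aS that)
    then show ?thesis
      using LIMSEQ_unique[OF lim[of h], of h] by simp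
  qed
  have zk: "blinfun_apply z (blinfun_apply k h) = 0" for h
  proof -
    have "blinfun_apply b (blinfun_apply k h) = 0"
      using ck[of h] by (simp add: c_def blinfun.bilinear_simps)
    then have "inner (blinfun_apply k h) (blinfun_apply z (blinfun_apply z (blinfun_apply k h))) = 0"
      using K by (simp add: b_def blinfun.bilinear_simps)
    then show ?thesis
      by (simp add: zz)
  qed
  show thesis
  proof (rule that)
    show "proj k"
      using k fixpt[OF ck] by (auto simp: proj_def intro: blinfun_eqI)
    show "z o\<^sub>L k = 0"
      using zk by (auto intro: blinfun_eqI)
    show "blinfun_apply k h = h" if "blinfun_apply z h = 0" for h
      using that by (intro fixpt) (simp add: c_def b_def blinfun.bilinear_simps)
    show "k o\<^sub>L d = d o\<^sub>L k" if d: "z o\<^sub>L d = d o\<^sub>L z" for d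
    proof -
      have "z o\<^sub>L z o\<^sub>L d = d o\<^sub>L (z o\<^sub>L z)"
        using d by (metis blinfun_compose_assoc)
      then have "c o\<^sub>L d = d o\<^sub>L c"
        by (simp add: c_def b_def blinfun_compose.diff_left blinfun_compose.diff_right
            blinfun_compose.scaleR_left blinfun_compose.scaleR_right)
      then have "L o\<^sub>L d = d o\<^sub>L L"
        by (intro L(3)) (simp add: blinfun_compose.minus_left blinfun_compose.minus_right acomm)
      then show ?thesis
        by (simp add: k_def blinfun_compose.minus_left blinfun_compose.minus_right)
    qed
  qed
qed

text \<open>With s the absolute value of y, p is the projection onto the kernel of s - y, where y =
  s. Since (s - y)(s + y) = 0, the range of s + y lies in that kernel, so y = - s off p. Hence y p =
  s p and - y (1 - p) = s (1 - p), both positive.\<close>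

lemma ex_sign_proj:
  fixes y :: "'h::complex_hilbert \<Rightarrow>\<^sub>L 'h"
  assumes y: "herm y"
  obtains p where "proj p" "op_pos (y o\<^sub>L p)" "op_pos (- (y o\<^sub>L (id_blinfun - p)))"
    "\<And>c. y o\<^sub>L c = c o\<^sub>L y \<Longrightarrow> p o\<^sub>L c = c o\<^sub>L p"
proof -
  have "op_pos (y o\<^sub>L y)"
    using op_pos_adj_comp[OF herm_ops[OF y]] y by (simp add: herm_adj)
  then obtain s where s: "op_pos s" "s o\<^sub>L s = y o\<^sub>L y"
    "\<And>c. y o\<^sub>L y o\<^sub>L c = c o\<^sub>L (y o\<^sub>L y) \<Longrightarrow> s o\<^sub>L c = c o\<^sub>L s"
    by (rule ex_sqrt) blast
  have sy: "s o\<^sub>L y = y o\<^sub>L s"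
    by (rule s(3)) (simp add: blinfun_compose_assoc)
  have herm: "herm (s - y)"
    using op_pos_herm[OF s(1)] y by (rule herm_diff)
  obtain p where p: "proj p" "(s - y) o\<^sub>L p = 0" "\<And>h. blinfun_apply (s - y) h = 0 \<Longrightarrow> blinfun_apply p h = h"
    "\<And>c. (s - y) o\<^sub>L c = c o\<^sub>L (s - y) \<Longrightarrow> p o\<^sub>L c = c o\<^sub>L p"
    by (rule ex_kernel_proj[OF herm]) blast
  have pc: "p o\<^sub>L c = c o\<^sub>L p" if "y o\<^sub>L c = c o\<^sub>L y" for c
  proof (rule p(4))
    have "s o\<^sub>L c = c o\<^sub>L s"
      by (rule s(3)) (metis that blinfun_compose_assoc)
    then show "(s - y) o\<^sub>L c = c o\<^sub>L (s - y)"
      using that by (simp add: blinfun_compose.diff_left blinfun_compose.diff_right)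
  qed
  have ps: "p o\<^sub>L s = s o\<^sub>L p" and py: "p o\<^sub>L y = y o\<^sub>L p"
    by (auto intro: pc simp: sy)
  have yp: "y o\<^sub>L p = s o\<^sub>L p"
    using p(2) by (simp add: blinfun_compose.diff_left)
  have "(s - y) o\<^sub>L (s + y) = 0"
    by (simp add: blinfun_compose.diff_left blinfun_compose.add_right s(2) sy)
  then have "blinfun_apply (s - y) (blinfun_apply (s + y) h) = 0" for h
    by (metis blinfun_apply_blinfun_compose zero_blinfun.rep_eq)
  then have "p o\<^sub>L (s + y) = s + y"
    using p(3) by (intro blinfun_eqI) simp
  then have "(s o\<^sub>L p) + (y o\<^sub>L p) = s + y"
    by (simp add: blinfun_compose.add_right ps py)
  then have "y o\<^sub>L p = s + y - (s o\<^sub>L p)"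
    by (metis add_diff_cancel_left')
  then have "- (y o\<^sub>L (id_blinfun - p)) = s o\<^sub>L (id_blinfun - p)"
    by (simp add: blinfun_compose.diff_right)
  moreover have "op_pos (s o\<^sub>L (id_blinfun - p))"
    using p(1) ps
    by (intro op_pos_comp[OF s(1)] proj_pos proj_compl) (auto simp: blinfun_compose.diff_left blinfun_compose.diff_right)
  moreover have "op_pos (y o\<^sub>L p)"
    unfolding yp using p(1) ps by (intro op_pos_comp[OF s(1)] proj_pos) auto
  ultimately show thesis
    using that[OF p(1)] pc by simp
qed

section \<open>Von Neumann algebras\<close>

lemma scaleC_of_real: "complex_of_real r *\<^sub>C (a::'a::real_normed_vector \<Rightarrow>\<^sub>L 'b::complex_hilbert) = r *\<^sub>R a"
  by (rule blinfun_eqI) (simp add: scaleC_blinfun.rep_eq scaleR_scaleC blinfun.scaleR_left)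

lemma scaleC_op_cancel:
  assumes "c *\<^sub>C p = d *\<^sub>C (p :: 'a::real_normed_vector \<Rightarrow>\<^sub>L 'b::complex_hilbert)" "p \<noteq> 0"
  shows "c = d"
proof -
  obtain h where h: "blinfun_apply p h \<noteq> 0"
    using assms(2) by (metis blinfun_eqI zero_blinfun.rep_eq)
  have "(c - d) *\<^sub>C blinfun_apply p h = 0"
    using arg_cong[OF assms(1), of "\<lambda>f. blinfun_apply f h"] by (simp add: scaleC_blinfun.rep_eq scaleC_diff_left)
  then have "cmod (c - d) * norm (blinfun_apply p h) = 0"
    by (metis norm_scaleC norm_zero)
  then show ?thesis
    using h by simp
qed

lemma comp_scaleC_left: "(c *\<^sub>C a) o\<^sub>L b = c *\<^sub>C (a o\<^sub>L b)"
  by (rule blinfun_eqI) (simp add: scaleC_blinfun.rep_eq)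

lemma comp_scaleC_right: "a \<in> complex_ops \<Longrightarrow> a o\<^sub>L (c *\<^sub>C b) = c *\<^sub>C (a o\<^sub>L b)"
  by (rule blinfun_eqI) (simp add: scaleC_blinfun.rep_eq complex_ops_scaleC)

lemma commutantI: "b \<in> complex_ops \<Longrightarrow> (\<And>a. a \<in> S \<Longrightarrow> a o\<^sub>L b = b o\<^sub>L a) \<Longrightarrow> b \<in> commutant S"
  by (simp add: commutant_def)

lemma commutantD: "b \<in> commutant S \<Longrightarrow> a \<in> S \<Longrightarrow> a o\<^sub>L b = b o\<^sub>L a"
  by (simp add: commutant_def)

lemma commutant_ops: "commutant S \<subseteq> complex_ops"
  by (auto simp: commutant_def)

lemma bicommutant_subset: "S \<subseteq> complex_ops \<Longrightarrow> S \<subseteq> commutant (commutant S)"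
  by (auto simp: commutant_def)

lemma commutant_antimono: "S \<subseteq> T \<Longrightarrow> commutant T \<subseteq> commutant S"
  by (auto simp: commutant_def)

text \<open>Closure under adjoints passes from S to its commutant and so to the double commutant;
  the third commutant equals the first.\<close>

lemma von_neumann_algebra_bicommutant:
  assumes S: "S \<subseteq> complex_ops" "\<And>a. a \<in> S \<Longrightarrow> adj a \<in> S"
  shows "von_neumann_algebra (commutant (commutant S))"
proof -
  have adj: "adj b \<in> commutant T" if T: "T \<subseteq> complex_ops" "\<And>a. a \<in> T \<Longrightarrow> adj a \<in> T" and b: "b \<in> commutant T"
    for T :: "('a \<Rightarrow>\<^sub>L 'a) set" and b
  proof (rule commutantI)
    have bc: "b \<in> complex_ops"
      using b commutant_ops by blast
    then show "adj b \<in> complex_ops"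
      by auto
    fix a assume a: "a \<in> T"
    then have "a \<in> complex_ops"
      using T by auto
    then have "adj (adj a o\<^sub>L b) = adj b o\<^sub>L a" "adj (b o\<^sub>L adj a) = a o\<^sub>L adj b"
      using bc by (simp_all add: adj_comp adj_adj adj_complex_ops)
    then show "a o\<^sub>L adj b = adj b o\<^sub>L a"
      using commutantD[OF b T(2)[OF a]] by simp
  qed
  show ?thesis
    unfolding von_neumann_algebra_def
  proof (intro conjI ballI)
    show "adj a \<in> commutant (commutant S)" if "a \<in> commutant (commutant S)" for a
    proof (rule adj[OF commutant_ops _ that])
      show "adj b \<in> commutant S" if "b \<in> commutant S" for b
        by (rule adj[OF S that])
    qed
    show "commutant (commutant (commutant (commutant S))) = commutant (commutant S)"
      using commutant_antimono[OF bicommutant_subset[OF S(1)]] bicommutant_subset[OF commutant_ops, of S]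
      by (metis subset_antisym)
  qed (rule commutant_ops)
qed

locale vn_algebra =
  fixes A :: "('h::complex_hilbert \<Rightarrow>\<^sub>L 'h) set"
  assumes vn: "von_neumann_algebra A"
begin

lemma ops: "a \<in> A \<Longrightarrow> a \<in> complex_ops"
  using vn by (auto simp: von_neumann_algebra_def)

lemma adj_mem: "a \<in> A \<Longrightarrow> adj a \<in> A"
  using vn by (auto simp: von_neumann_algebra_def)

lemma memI: "a \<in> complex_ops \<Longrightarrow> (\<And>b. b \<in> commutant A \<Longrightarrow> b o\<^sub>L a = a o\<^sub>L b) \<Longrightarrow> a \<in> A"
  using vn unfolding von_neumann_algebra_def by (metis commutantI)

lemma commutant_comm: "a \<in> A \<Longrightarrow> b \<in> commutant A \<Longrightarrow> b o\<^sub>L a = a o\<^sub>L b"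
  by (rule commutantD[symmetric])

lemma zero_mem [simp]: "0 \<in> A"
  and id_mem [simp]: "id_blinfun \<in> A"
  and add_mem: "a \<in> A \<Longrightarrow> b \<in> A \<Longrightarrow> a + b \<in> A"
  and diff_mem: "a \<in> A \<Longrightarrow> b \<in> A \<Longrightarrow> a - b \<in> A"
  and scaleR_mem: "a \<in> A \<Longrightarrow> r *\<^sub>R a \<in> A"
  by (rule memI; use ops in \<open>auto simp: commutant_comm[of a] commutant_comm[of b]
      blinfun_compose.zero_left blinfun_compose.add_left blinfun_compose.add_right
      blinfun_compose.diff_left blinfun_compose.diff_right blinfun_compose.scaleR_left
      blinfun_compose.scaleR_right\<close>)+

lemma comp_mem:
  assumes "a \<in> A" "b \<in> A"
  shows "a o\<^sub>L b \<in> A"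
proof (rule memI)
  show "c o\<^sub>L (a o\<^sub>L b) = a o\<^sub>L b o\<^sub>L c" if "c \<in> commutant A" for c
    by (metis assms blinfun_compose_assoc commutant_comm that)
qed (use assms ops in auto)

lemma scaleC_mem:
  assumes "a \<in> A"
  shows "c *\<^sub>C a \<in> A"
proof (rule memI)
  fix b assume b: "b \<in> commutant A"
  then have "b \<in> complex_ops"
    using commutant_ops by blast
  then have "blinfun_apply (b o\<^sub>L (c *\<^sub>C a)) h = blinfun_apply ((c *\<^sub>C a) o\<^sub>L b) h" for h
    using arg_cong[OF commutant_comm[OF assms b], of "\<lambda>f. blinfun_apply f h"]
    by (simp add: scaleC_blinfun.rep_eq complex_ops_scaleC)
  then show "b o\<^sub>L (c *\<^sub>C a) = (c *\<^sub>C a) o\<^sub>L b"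
    by (rule blinfun_eqI)
qed (use assms ops in auto)

lemma sum_mem: "(\<And>i. i \<in> I \<Longrightarrow> f i \<in> A) \<Longrightarrow> sum f I \<in> A"
  by (induction I rule: infinite_finite_induct) (auto intro: add_mem)

text \<open>The commutation clauses of \<open>ex_kernel_proj\<close> and \<open>ex_sign_proj\<close>
  feed into this: b then commutes in particular with the commutant of A.\<close>

lemma mem_if_commutes:
  assumes "a \<in> A" "b \<in> complex_ops" "\<And>c. a o\<^sub>L c = c o\<^sub>L a \<Longrightarrow> b o\<^sub>L c = c o\<^sub>L b"
  shows "b \<in> A"
  using assms by (intro memI) (metis commutant_comm)+

lemma self_adjoints_iff: "a \<in> self_adjoints A \<longleftrightarrow> a \<in> A \<and> herm a"
  using ops by (auto simp: self_adjoints_def herm_iff_adj)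

text \<open>The strong limit taken among all operators commutes with the commutant of A, so it lies
  in A. Suprema in A thus agree with suprema among all operators, and the third clause allows bounds
  t outside A.\<close>

lemma directed_limit_mem:
  assumes D: "D \<subseteq> self_adjoints A" "directed D" and t: "\<And>d. d \<in> D \<Longrightarrow> d \<le>\<^sub>o t"
  obtains T where "is_supremum A D T" "\<And>h. ((\<lambda>d. blinfun_apply d h) \<longlongrightarrow> blinfun_apply T h) (tails D)"
    "\<And>t. (\<And>d. d \<in> D \<Longrightarrow> d \<le>\<^sub>o t) \<Longrightarrow> T \<le>\<^sub>o t"
    "\<And>c. (\<And>d. d \<in> D \<Longrightarrow> d o\<^sub>L c = c o\<^sub>L d) \<Longrightarrow> T o\<^sub>L c = c o\<^sub>L T"
proof -
  have h: "herm d" if "d \<in> D" for d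
    using D(1) self_adjoints_iff that by blast
  obtain T where T: "herm T" "\<And>h. ((\<lambda>d. blinfun_apply d h) \<longlongrightarrow> blinfun_apply T h) (tails D)"
    "\<And>d. d \<in> D \<Longrightarrow> d \<le>\<^sub>o T" "\<And>t. (\<And>d. d \<in> D \<Longrightarrow> d \<le>\<^sub>o t) \<Longrightarrow> T \<le>\<^sub>o t"
    "\<And>c. (\<And>d. d \<in> D \<Longrightarrow> d o\<^sub>L c = c o\<^sub>L d) \<Longrightarrow> T o\<^sub>L c = c o\<^sub>L T"
    by (rule directed_limit[OF D(2) h t]) blast+
  have "T \<in> A"
  proof (rule memI)
    show "b o\<^sub>L T = T o\<^sub>L b" if "b \<in> commutant A" for b
    proof (rule T(5)[symmetric])
      show "d o\<^sub>L b = b o\<^sub>L d" if "d \<in> D" for d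
        using D(1) that \<open>b \<in> commutant A\<close> commutant_comm self_adjoints_iff by fastforce
    qed
  qed (simp add: T herm_ops)
  then have "is_supremum A D T"
    using T by (auto simp: is_supremum_def self_adjoints_iff)
  then show thesis
    using that T by blast
qed

lemma is_supremum_unique:
  assumes "is_supremum A D s" "is_supremum A D t"
  shows "s = t"
  using assms by (intro op_le_antisym) (auto simp: is_supremum_def)

text \<open>A supremum is defined by the order of A only; by uniqueness it is the strong limit. The
  normality of the duplicator constructed at the end rests on this.\<close>

lemma is_supremum_tendsto:
  assumes "D \<subseteq> self_adjoints A" "directed D" "is_supremum A D s"
  shows "((\<lambda>d. blinfun_apply d h) \<longlongrightarrow> blinfun_apply s h) (tails D)"
proof -
  have le: "d \<le>\<^sub>o s" if "d \<in> D" for d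
    using assms(3) that by (auto simp: is_supremum_def)
  obtain T where "is_supremum A D T" "\<And>h. ((\<lambda>d. blinfun_apply d h) \<longlongrightarrow> blinfun_apply T h) (tails D)"
    by (rule directed_limit_mem[OF assms(1,2) le]) blast+
  then show ?thesis
    using is_supremum_unique[OF assms(3)] by blast
qed

lemma kernel_proj_mem:
  assumes "z \<in> A" "herm z"
  obtains k where "k \<in> A" "proj k" "z o\<^sub>L k = 0" "\<And>h. blinfun_apply z h = 0 \<Longrightarrow> blinfun_apply k h = h"
proof -
  obtain k where "proj k" "z o\<^sub>L k = 0" "\<And>h. blinfun_apply z h = 0 \<Longrightarrow> blinfun_apply k h = h"
    "\<And>c. z o\<^sub>L c = c o\<^sub>L z \<Longrightarrow> k o\<^sub>L c = c o\<^sub>L k"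
    using ex_kernel_proj[OF assms(2)] by metis
  then show thesis
    using that mem_if_commutes[OF assms(1) proj_ops] by blast
qed

lemma sign_proj_mem:
  assumes "y \<in> A" "herm y"
  obtains p where "p \<in> A" "proj p" "op_pos (y o\<^sub>L p)" "op_pos (- (y o\<^sub>L (id_blinfun - p)))" "p o\<^sub>L y = y o\<^sub>L p"
proof -
  obtain p where "proj p" "op_pos (y o\<^sub>L p)" "op_pos (- (y o\<^sub>L (id_blinfun - p)))"
    "\<And>c. y o\<^sub>L c = c o\<^sub>L y \<Longrightarrow> p o\<^sub>L c = c o\<^sub>L p"
    using ex_sign_proj[OF assms(2)] by metis
  then show thesis
    using that[of p] mem_if_commutes[OF assms(1) proj_ops] by blast
qed

text \<open>One binary digit of the spectral decomposition of x: the digit p is the spectral projection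
  for the interval above 1/2.\<close>

lemma binary_digit:
  assumes x: "x \<in> A" "op_pos x" "x \<le>\<^sub>o id_blinfun"
  obtains p x' where "p \<in> A" "proj p" "x' \<in> A" "op_pos x'" "x' \<le>\<^sub>o id_blinfun" "2 *\<^sub>R x = p + x'"
proof -
  define y where "y = 2 *\<^sub>R x - id_blinfun"
  have "herm x"
    using x by (simp add: op_pos_herm)
  then have "y \<in> A" "herm y"
    using x(1) by (auto simp: y_def intro!: diff_mem scaleR_mem herm_diff herm_scaleR)
  then obtain p where p: "p \<in> A" "proj p" "op_pos (y o\<^sub>L p)" "op_pos (- (y o\<^sub>L (id_blinfun - p)))"
    "p o\<^sub>L y = y o\<^sub>L p"
    by (rule sign_proj_mem)
  have x2: "2 *\<^sub>R x = y + id_blinfun"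
    by (simp add: y_def)
  have px: "p o\<^sub>L x = x o\<^sub>L p"
    using p(5) by (simp add: y_def blinfun_compose.diff_left blinfun_compose.diff_right
        blinfun_compose.scaleR_left blinfun_compose.scaleR_right)
  have x_pos: "op_pos (x o\<^sub>L (id_blinfun - p))" "op_pos ((id_blinfun - x) o\<^sub>L p)"
    using op_pos_comp[OF x(2) proj_pos[OF proj_compl[OF p(2)]]]
      op_pos_comp[OF x(3)[unfolded op_le_def] proj_pos[OF p(2)]] px
    by (simp_all add: blinfun_compose.diff_left blinfun_compose.diff_right)
  let ?x' = "2 *\<^sub>R x - p"
  have "(x o\<^sub>L p) + (x o\<^sub>L p) = (2 *\<^sub>R x) o\<^sub>L p"
    by (subst blinfun_compose.scaleR_left) (rule scaleR_2[symmetric])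
  also have "\<dots> = (y o\<^sub>L p) + p"
    by (simp only: x2 blinfun_compose.add_left blinfun_compose_id)
  finally have xp: "(x o\<^sub>L p) + (x o\<^sub>L p) = (y o\<^sub>L p) + p" .
  have "2 *\<^sub>R (x o\<^sub>L (id_blinfun - p)) = 2 *\<^sub>R x - ((x o\<^sub>L p) + (x o\<^sub>L p))"
    by (simp add: blinfun_compose.diff_right blinfun_compose.add_left scaleR_2)
  \<comment> \<open>On the range of p the remainder 2 x - p is y = 2 x - 1, off it the remainder is
    2 x; both parts are positive.\<close>
  then have "?x' = (y o\<^sub>L p) + 2 *\<^sub>R (x o\<^sub>L (id_blinfun - p))"
    by (simp add: xp)
  then have 1: "op_pos ?x'"
    using p x_pos by (auto intro!: op_pos_add op_pos_scaleR)
  have "2 *\<^sub>R ((id_blinfun - x) o\<^sub>L p) = p + p - ((x o\<^sub>L p) + (x o\<^sub>L p))"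
    by (simp add: blinfun_compose.diff_left scaleR_2)
  then have "id_blinfun - ?x' = - (y o\<^sub>L (id_blinfun - p)) + 2 *\<^sub>R ((id_blinfun - x) o\<^sub>L p)"
    by (simp add: xp blinfun_compose.diff_right x2)
  then have "op_pos (id_blinfun - ?x')"
    by (simp only: op_pos_add[OF p(4) op_pos_scaleR[OF x_pos(2)]] zero_le_numeral)
  then show thesis
    using that[of p ?x'] p 1 x(1) by (simp add: op_le_def diff_mem scaleR_mem)
qed

text \<open>Extracting n digits leaves 2^-n times a positive contraction. This is the norm density
  of the span of the projections in quantitative form, with the remainder again in A.\<close>

lemma binary_expansion:
  assumes x: "x \<in> A" "op_pos x" "x \<le>\<^sub>o id_blinfun"
  shows "\<exists>q\<in>span {p \<in> A. proj p}. \<exists>y\<in>A. op_pos y \<and> y \<le>\<^sub>o id_blinfun \<and> x = q + (1 / 2 ^ n) *\<^sub>R y"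
proof (induction n)
  case 0
  show ?case
    by (rule bexI[of _ 0]) (use x in \<open>auto simp: span_zero\<close>)
next
  case (Suc n)
  then obtain q y where q: "q \<in> span {p \<in> A. proj p}"
    and y: "y \<in> A" "op_pos y" "y \<le>\<^sub>o id_blinfun" "x = q + (1 / 2 ^ n) *\<^sub>R y"
    by blast
  obtain p x' where p: "p \<in> A" "proj p" "x' \<in> A" "op_pos x'" "x' \<le>\<^sub>o id_blinfun" "2 *\<^sub>R y = p + x'"
    using binary_digit[OF y(1,2,3)] by metis
  have "y = (1/2) *\<^sub>R (p + x')"
    using arg_cong[OF p(6), of "\<lambda>z. (1/2) *\<^sub>R z"] by simp
  then have "x = (q + (1 / 2 ^ Suc n) *\<^sub>R p) + (1 / 2 ^ Suc n) *\<^sub>R x'"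
    using y(4) by (simp add: scaleR_add_right mult.commute)
  moreover have "q + (1 / 2 ^ Suc n) *\<^sub>R p \<in> span {p \<in> A. proj p}"
    using q p by (intro span_add span_scale) (auto intro: span_base)
  ultimately show ?case
    using p by blast
qed

lemma herm_decomp:
  assumes a: "a \<in> A"
  obtains b c where "b \<in> A" "herm b" "c \<in> A" "herm c" "a = b + \<i> *\<^sub>C c"
proof -
  define b where "b = (1/2) *\<^sub>R (a + adj a)"
  define c where "c = (- \<i>/2) *\<^sub>C (a - adj a)"
  have ac: "a \<in> complex_ops"
    using a ops by blast
  have "herm b"
    unfolding herm_iff_adj b_def scaleR_blinfun.rep_eq
    using ac by (intro conjI adj_eqI) (auto simp: blinfun.bilinear_simps scaleR_scaleC cinner_scaleC_left
        cinner_scaleC_right cinner_add_left cinner_add_right cinner_adj_left cinner_adj_right)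
  moreover have "herm c"
    unfolding herm_iff_adj c_def
    using ac by (intro conjI adj_eqI) (auto simp: blinfun.bilinear_simps scaleC_blinfun.rep_eq cinner_scaleC_left
        cinner_scaleC_right cinner_diff_left cinner_diff_right cinner_adj_left cinner_adj_right algebra_simps)
  moreover have "a = b + \<i> *\<^sub>C c"
  proof (rule blinfun_eqI)
    fix h
    let ?u = "blinfun_apply a h" and ?v = "blinfun_apply (adj a) h"
    have "blinfun_apply (\<i> *\<^sub>C c) h = complex_of_real (1/2) *\<^sub>C (?u - ?v)"
      by (simp add: c_def scaleC_blinfun.rep_eq scaleC_scaleC blinfun.bilinear_simps)
    also have "\<dots> = (1/2) *\<^sub>R (?u - ?v)"
      by (rule scaleR_scaleC[symmetric])
    finally have "blinfun_apply (b + \<i> *\<^sub>C c) h = (1/2) *\<^sub>R ((?u + ?v) + (?u - ?v))"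
      by (simp only: b_def blinfun.bilinear_simps scaleR_add_right)
    then show "?u = blinfun_apply (b + \<i> *\<^sub>C c) h"
      by simp
  qed
  moreover have "b \<in> A" "c \<in> A"
    using a by (auto simp: b_def c_def intro!: scaleR_mem scaleC_mem add_mem diff_mem adj_mem)
  ultimately show thesis
    using that by blast
qed

text \<open>Positive contractions span A: a = b + \<i> c with b and c hermitian, and b = 2 K x - K
  with x a positive contraction. As an induction rule this reduces linear statements to elements for
  which binary expansion and order estimates are available.\<close>

lemma contraction_induct [consumes 1, case_names contraction add scale]:
  assumes a: "a \<in> A"
    and pos: "\<And>x. x \<in> A \<Longrightarrow> op_pos x \<Longrightarrow> x \<le>\<^sub>o id_blinfun \<Longrightarrow> P x"
    and add: "\<And>x y. x \<in> A \<Longrightarrow> y \<in> A \<Longrightarrow> P x \<Longrightarrow> P y \<Longrightarrow> P (x + y)"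
    and scale: "\<And>c x. x \<in> A \<Longrightarrow> P x \<Longrightarrow> P (c *\<^sub>C x)"
  shows "P a"
proof -
  have herm: "P b" if b: "b \<in> A" "herm b" for b
  proof -
    define K where "K = norm b + 1"
    have K: "K > 0"
      by (simp add: K_def add_nonneg_pos)
    \<comment> \<open>The affine map from [-K, K], which contains the form of b on unit vectors,
      onto [0, 1].\<close>
    define x where "x = (1 / (2 * K)) *\<^sub>R (b + K *\<^sub>R id_blinfun)"
    have x: "x \<in> A" "herm x"
      using b by (auto simp: x_def intro!: scaleR_mem add_mem herm_scaleR herm_add)
    have bd: "\<bar>inner h (blinfun_apply b h)\<bar> \<le> K * inner h h" for h
    proof -
      have "inner h (blinfun_apply b h) \<le> norm b * (norm h)\<^sup>2" "inner h (blinfun_apply (- b) h) \<le> norm (- b) * (norm h)\<^sup>2"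
        by (rule inner_op_le)+
      moreover have "norm b * (norm h)\<^sup>2 \<le> K * (norm h)\<^sup>2"
        by (simp add: K_def mult_right_mono)
      ultimately show ?thesis
        by (simp add: blinfun.bilinear_simps power2_norm_eq_inner abs_le_iff)
    qed
    have "op_pos x"
      unfolding op_pos_iff
    proof (intro conjI allI x)
      fix h
      show "0 \<le> inner h (blinfun_apply x h)"
        using bd[of h] K by (simp add: x_def blinfun.bilinear_simps inner_add_right)
    qed
    moreover have "x \<le>\<^sub>o id_blinfun"
      unfolding op_le_id_iff[OF x(2)]
    proof
      fix h
      show "inner h (blinfun_apply x h) \<le> (norm h)\<^sup>2"
        using bd[of h] K by (simp add: x_def blinfun.bilinear_simps inner_add_right power2_norm_eq_inner field_simps)
    qed
    ultimately have "P x"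
      using x by (intro pos)
    moreover have "P id_blinfun"
      by (intro pos) auto
    moreover have "b = complex_of_real (2 * K) *\<^sub>C x + complex_of_real (- K) *\<^sub>C id_blinfun"
      unfolding scaleC_of_real using K by (simp add: x_def)
    ultimately show "P b"
      using add scale x scaleC_mem by (metis id_mem)
  qed
  obtain b c where bc: "b \<in> A" "herm b" "c \<in> A" "herm c" "a = b + \<i> *\<^sub>C c"
    by (rule herm_decomp[OF a])
  then show ?thesis
    using add[OF bc(1) scaleC_mem[OF bc(3)] herm[OF bc(1,2)] scale[OF bc(3) herm[OF bc(3,4)]]] by simp
qed

end

section \<open>Tensor products of operators\<close>

text \<open>Agreement of f and g is a closed real-linear condition, so \<open>dense_tensor\<close>
  applies.\<close>

lemma htensor_ext:
  assumes f: "bounded_linear f" and g: "bounded_linear g"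
    and eq: "\<And>x y. f (x \<otimes>\<^sub>h y) = g (x \<otimes>\<^sub>h y)"
  shows "f z = (g z :: 'c::real_normed_vector)"
proof -
  interpret f: bounded_linear f by fact
  interpret g: bounded_linear g by fact
  have "closed {z. f z = g z}"
    by (intro closed_Collect_eq f.continuous_on g.continuous_on continuous_on_id)
  moreover have "span {x \<otimes>\<^sub>h y | x y. True} \<subseteq> {z. f z = g z}"
    by (rule span_minimal) (auto simp: eq subspace_def f.add g.add f.scaleR g.scaleR f.zero g.zero)
  ultimately have "closure (span {x \<otimes>\<^sub>h y | x y. True}) \<subseteq> {z. f z = g z}"
    by (rule closure_minimal[rotated])
  then show ?thesis
    using dense_tensor by blast
qed

lemma blinfun_htensor_eqI:
  fixes s t :: "('a::complex_hilbert, 'b::complex_hilbert) htensor \<Rightarrow>\<^sub>L 'c::real_normed_vector"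
  assumes "\<And>x y. blinfun_apply s (x \<otimes>\<^sub>h y) = blinfun_apply t (x \<otimes>\<^sub>h y)"
  shows "s = t"
  by (rule blinfun_eqI, rule htensor_ext) (auto intro: blinfun.bounded_linear_right assms)

lemma htensor_orthogonal_zero:
  assumes "\<And>x y. cinner (x \<otimes>\<^sub>h y) z = 0"
  shows "z = 0"
proof -
  have "cinner z w = 0" for w
    by (rule htensor_ext[OF bounded_linear_cinner bounded_linear_zero])
      (subst cinner_commute, simp add: assms)
  then show ?thesis
    using cinner_self_eq_0 by blast
qed

text \<open>The Gram matrix estimate behind the boundedness of a tensor product of operators. It is stated
  for an abstract map t, so as to apply to both tensor factors.\<close>

lemma norm_sum_gram_le:
  fixes t :: "'a::complex_hilbert \<Rightarrow> 'b::complex_hilbert \<Rightarrow> 'c::complex_hilbert"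
  assumes t: "\<And>x y x' y'. cinner (t x y) (t x' y') = cinner x x' * cinner y y'"
    and a: "a \<in> complex_ops"
  shows "norm (\<Sum>i\<in>I. t (blinfun_apply a (x i)) (y i)) \<le> norm a * norm (\<Sum>i\<in>I. t (x i) (y i))"
proof -
  define c where "c = (norm a)\<^sup>2 *\<^sub>R id_blinfun - (adj a o\<^sub>L a)"
  have "op_pos (adj a o\<^sub>L a)"
    by (rule op_pos_adj_comp[OF a])
  then have herm: "herm c"
    using op_pos_herm by (auto simp: c_def intro!: herm_diff herm_scaleR)
  have "inner h (blinfun_apply (adj a) (blinfun_apply a h)) \<le> (norm a)\<^sup>2 * inner h h" for h
  proof -
    have "inner h (blinfun_apply (adj a) (blinfun_apply a h)) = (norm (blinfun_apply a h))\<^sup>2"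
      by (simp add: inner_cinner cinner_adj_right[OF a] power2_norm_eq_inner)
    also have "\<dots> \<le> (norm a * norm h)\<^sup>2"
      by (intro power_mono norm_blinfun) simp
    finally show ?thesis
      by (simp add: power_mult_distrib power2_norm_eq_inner)
  qed
  then have "op_pos c"
    unfolding op_pos_iff using herm by (simp add: c_def blinfun.bilinear_simps inner_diff_right)
  \<comment> \<open>By the Gram identity, the amount by which \<open>(norm a)\<^sup>2\<close> times
    the squared norm of the original sum exceeds that of the sum with a applied is the squared norm
    of the sum with s applied, hence nonnegative.\<close>
  then obtain s where s: "op_pos s" "s o\<^sub>L s = c"
    by (rule ex_sqrt) blast
  have gram: "cinner (\<Sum>i\<in>I. t (u i) (y i)) (\<Sum>i\<in>I. t (u i) (y i)) =
      (\<Sum>i\<in>I. \<Sum>j\<in>I. cinner (u i) (u j) * cinner (y i) (y j))" for u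
    by (simp only: cinner_sum_left) (simp only: cinner_sum_right t)
  have scx: "cinner (blinfun_apply s u) (blinfun_apply s v) =
      complex_of_real ((norm a)\<^sup>2) * cinner u v - cinner (blinfun_apply a u) (blinfun_apply a v)" for u v
  proof -
    have "cinner (blinfun_apply s u) (blinfun_apply s v) = cinner u (blinfun_apply c v)"
      by (simp add: herm_cinner[OF op_pos_herm[OF s(1)]] s(2)[symmetric])
    also have "\<dots> = complex_of_real ((norm a)\<^sup>2) * cinner u v - cinner (blinfun_apply a u) (blinfun_apply a v)"
      by (simp add: c_def blinfun.bilinear_simps cinner_diff_right cinner_adj_right[OF a] scaleR_scaleC
          cinner_scaleC_right del: of_real_power)
    finally show ?thesis .
  qed
  have "complex_of_real ((norm (\<Sum>i\<in>I. t (blinfun_apply s (x i)) (y i)))\<^sup>2) =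
      complex_of_real ((norm a)\<^sup>2) * complex_of_real ((norm (\<Sum>i\<in>I. t (x i) (y i)))\<^sup>2) -
      complex_of_real ((norm (\<Sum>i\<in>I. t (blinfun_apply a (x i)) (y i)))\<^sup>2)"
    unfolding cinner_self[symmetric] gram scx
    by (simp only: left_diff_distrib sum_subtractf sum_distrib_left mult.assoc)
  then have "(norm (\<Sum>i\<in>I. t (blinfun_apply s (x i)) (y i)))\<^sup>2 =
      (norm a)\<^sup>2 * (norm (\<Sum>i\<in>I. t (x i) (y i)))\<^sup>2 - (norm (\<Sum>i\<in>I. t (blinfun_apply a (x i)) (y i)))\<^sup>2"
    by (simp only: of_real_mult[symmetric] of_real_diff[symmetric] of_real_eq_iff)
  then have "(norm (\<Sum>i\<in>I. t (blinfun_apply a (x i)) (y i)))\<^sup>2 \<le> (norm a * norm (\<Sum>i\<in>I. t (x i) (y i)))\<^sup>2"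
    using zero_le_power2[of "norm (\<Sum>i\<in>I. t (blinfun_apply s (x i)) (y i))"]
    by (simp add: power_mult_distrib del: zero_le_power2)
  then show ?thesis
    by (rule power2_le_imp_le) simp
qed

text \<open>a \<otimes> b acts as a on the first factor after b on the second; the Gram estimate
  handles each in turn, the second with the arguments of t exchanged.\<close>

lemma norm_sum_tensor_le:
  assumes "a \<in> complex_ops" "b \<in> complex_ops"
  shows "norm (\<Sum>i\<in>I. blinfun_apply a (x i) \<otimes>\<^sub>h blinfun_apply b (y i))
    \<le> norm a * norm b * norm (\<Sum>i\<in>I. x i \<otimes>\<^sub>h y i)"
proof -
  have "norm (\<Sum>i\<in>I. blinfun_apply a (x i) \<otimes>\<^sub>h blinfun_apply b (y i))
      \<le> norm a * norm (\<Sum>i\<in>I. x i \<otimes>\<^sub>h blinfun_apply b (y i))"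
    by (rule norm_sum_gram_le[of "(\<otimes>\<^sub>h)", OF cinner_tensor assms(1)])
  also have "norm (\<Sum>i\<in>I. x i \<otimes>\<^sub>h blinfun_apply b (y i)) \<le> norm b * norm (\<Sum>i\<in>I. x i \<otimes>\<^sub>h y i)"
    by (rule norm_sum_gram_le[of "\<lambda>y x. x \<otimes>\<^sub>h y", OF _ assms(2)]) (simp add: cinner_tensor)
  finally show ?thesis
    by (simp add: mult_left_mono mult.assoc)
qed

text \<open>The coefficients of the image of z must be its inner products with \<open>adj a\<close>
  \<otimes> \<open>adj b\<close> applied to the basis tensors. Square summability is shown as in
  \<open>riesz\<close>: for S a finite sum of squares, w0 the matching combination of basis tensors
  and w its image, S = <w, z> \<le> N * norm w0 * norm z, while the squared norm of w0 is S.\<close>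

lemma ex_op_tensor:
  fixes a :: "'h::complex_hilbert \<Rightarrow>\<^sub>L 'h" and b :: "'k::complex_hilbert \<Rightarrow>\<^sub>L 'k"
  assumes a: "a \<in> complex_ops" and b: "b \<in> complex_ops"
  shows "\<exists>t\<in>complex_ops. \<forall>x y. blinfun_apply t (x \<otimes>\<^sub>h y) = blinfun_apply a x \<otimes>\<^sub>h blinfun_apply b y"
proof -
  define N where "N = norm (adj a) * norm (adj b)"
  define v where "v p = blinfun_apply (adj a) (fst p) \<otimes>\<^sub>h blinfun_apply (adj b) (snd p)" for p
  define g where "g z p = (if p \<in> onb \<times> onb then cinner (v p) z else 0)" for z and p :: "'h \<times> 'k"
  have N: "N \<ge> 0"
    by (simp add: N_def)
  have bound: "(\<Sum>p\<in>G. (cmod (g z p))\<^sup>2) \<le> (N * norm z)\<^sup>2" if "finite G" for G z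
  proof -
    define F where "F = G \<inter> onb \<times> onb"
    have F: "finite F" "F \<subseteq> onb \<times> onb"
      using that by (auto simp: F_def)
    let ?S = "\<Sum>p\<in>F. (cmod (g z p))\<^sup>2"
    define k where "k p = g z p" for p
    define w where "w = (\<Sum>p\<in>F. blinfun_apply (adj a) (k p *\<^sub>C fst p) \<otimes>\<^sub>h blinfun_apply (adj b) (snd p))"
    define w0 where "w0 = (\<Sum>p\<in>F. (k p *\<^sub>C fst p) \<otimes>\<^sub>h snd p)"
    have w: "w = (\<Sum>p\<in>F. k p *\<^sub>C v p)"
      by (simp add: w_def v_def complex_ops_scaleC a adj_complex_ops htensor_bilinear)
    have "cinner w z = (\<Sum>p\<in>F. cnj (k p) * k p)"
      unfolding w cinner_sum_left cinner_scaleC_left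
      by (intro sum.cong refl) (use F in \<open>auto simp: k_def g_def\<close>)
    then have "cinner w z = complex_of_real ?S"
      by (simp add: k_def complex_norm_square mult.commute del: of_real_power)
    then have "?S \<le> norm w * norm z"
      using cinner_bound[of w z] by (simp only: norm_of_real)
    also have "norm w \<le> N * norm w0"
      unfolding w_def w0_def N_def using a b by (intro norm_sum_tensor_le) auto
    finally have 1: "?S \<le> N * norm w0 * norm z"
      by (simp add: mult_right_mono)
    have "complex_of_real ((norm w0)\<^sup>2) = (\<Sum>p\<in>F. \<Sum>q\<in>F. cnj (k p) * k q * (cinner (fst p) (fst q) * cinner (snd p) (snd q)))"
      unfolding cinner_self[symmetric] w0_def htensor_bilinear
      by (simp only: cinner_sum_left) (simp only: cinner_sum_right cinner_scaleC_left cinner_scaleC_right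
          cinner_tensor sum_distrib_left mult_ac)
    also have "\<dots> = (\<Sum>p\<in>F. \<Sum>q\<in>F. if q = p then complex_of_real ((cmod (k p))\<^sup>2) else 0)"
    proof (intro sum.cong refl)
      fix p q assume "p \<in> F" "q \<in> F"
      then have "cinner (fst p) (fst q) * cinner (snd p) (snd q) = (if q = p then 1 else 0)"
        using F(2) by (subst (1 2) cinner_onb) (auto simp: prod_eq_iff)
      then show "cnj (k p) * k q * (cinner (fst p) (fst q) * cinner (snd p) (snd q))
          = (if q = p then complex_of_real ((cmod (k p))\<^sup>2) else 0)"
        by (auto simp: complex_norm_square mult.commute simp del: of_real_power)
    qed
    also have "\<dots> = complex_of_real ?S"
      using F(1) by (simp add: k_def)
    finally have w0: "(norm w0)\<^sup>2 = ?S"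
      by (simp only: of_real_eq_iff)
    then have "norm w0 * norm w0 \<le> norm w0 * (N * norm z)"
      using 1 by (simp add: power2_eq_square mult_ac)
    then have "norm w0 \<le> N * norm z"
      using N mult_left_le_imp_le[of "norm w0" "norm w0" "N * norm z"] by (cases "norm w0 = 0") auto
    then have "?S \<le> (N * norm z)\<^sup>2"
      unfolding w0[symmetric] by (intro power_mono) auto
    moreover have "(\<Sum>p\<in>G. (cmod (g z p))\<^sup>2) = ?S"
      using that by (intro sum.mono_neutral_right) (auto simp: F_def g_def)
    ultimately show ?thesis
      by simp
  qed
  have summable: "(\<lambda>p. (cmod (g z p))\<^sup>2) summable_on UNIV" for z
    by (rule nonneg_bdd_above_summable_on) (auto intro!: bdd_aboveI2 bound)
  define t where "t z = Abs_htensor (g z)" for z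
  have t: "Rep_htensor (t z) = g z" for z
    unfolding t_def by (rule Abs_htensor_inverse) (use summable in \<open>auto simp: g_def\<close>)
  have t_add: "t (x + y) = t x + t y" for x y
    by (simp add: Rep_htensor_inject[symmetric] plus_htensor.rep_eq t) (auto simp: g_def cinner_add_right)
  have t_scaleC: "t (c *\<^sub>C x) = c *\<^sub>C t x" for c x
    by (simp add: Rep_htensor_inject[symmetric] scaleC_htensor.rep_eq t) (auto simp: g_def cinner_scaleC_right)
  have "bounded_linear t"
  proof (rule bounded_linear_intro[of _ N])
    show "t (r *\<^sub>R x) = r *\<^sub>R t x" for r x
      by (simp add: scaleR_scaleC t_scaleC)
    show "norm (t z) \<le> norm z * N" for z
    proof -
      have "(\<Sum>\<^sub>\<infinity>p. (cmod (g z p))\<^sup>2) \<le> (N * norm z)\<^sup>2"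
        by (rule infsum_le_finite_sums[OF summable bound])
      then have "norm (t z) \<le> sqrt ((N * norm z)\<^sup>2)"
        unfolding norm_htensor_def htensor_norm.rep_eq t by (rule real_sqrt_le_mono)
      then show ?thesis
        using N by (simp add: mult.commute)
    qed
  qed (rule t_add)
  then have T: "blinfun_apply (Blinfun t) = t"
    by (rule bounded_linear_Blinfun_apply)
  have "t (x \<otimes>\<^sub>h y) = blinfun_apply a x \<otimes>\<^sub>h blinfun_apply b y" for x y
    unfolding Rep_htensor_inject[symmetric] t
    by (rule ext) (auto simp: g_def v_def cinner_tensor tensor.rep_eq cinner_adj_left a b split: if_splits)
  moreover have "Blinfun t \<in> complex_ops"
    by (simp add: complex_ops_def T t_scaleC)
  ultimately show ?thesis
    using T by (intro bexI[of _ "Blinfun t"]) auto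
qed

lemma op_tensor_eqI:
  fixes a :: "'h::complex_hilbert \<Rightarrow>\<^sub>L 'h" and b :: "'k::complex_hilbert \<Rightarrow>\<^sub>L 'k"
  assumes "\<And>x y. blinfun_apply t (x \<otimes>\<^sub>h y) = blinfun_apply a x \<otimes>\<^sub>h blinfun_apply b y"
  shows "a \<otimes>\<^sub>o b = t"
  unfolding op_tensor_def
  by (rule the_equality) (auto simp: assms intro!: blinfun_htensor_eqI)

lemma
  fixes a :: "'h::complex_hilbert \<Rightarrow>\<^sub>L 'h" and b :: "'k::complex_hilbert \<Rightarrow>\<^sub>L 'k"
  assumes "a \<in> complex_ops" "b \<in> complex_ops"
  shows op_tensor_ops [simp, intro]: "a \<otimes>\<^sub>o b \<in> complex_ops"
    and op_tensor_apply: "blinfun_apply (a \<otimes>\<^sub>o b) (x \<otimes>\<^sub>h y) = blinfun_apply a x \<otimes>\<^sub>h blinfun_apply b y"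
proof -
  obtain t where t: "t \<in> complex_ops" "\<And>x y. blinfun_apply t (x \<otimes>\<^sub>h y) = blinfun_apply a x \<otimes>\<^sub>h blinfun_apply b y"
    using ex_op_tensor[OF assms] by blast
  then have "a \<otimes>\<^sub>o b = t"
    by (intro op_tensor_eqI)
  then show "a \<otimes>\<^sub>o b \<in> complex_ops" "blinfun_apply (a \<otimes>\<^sub>o b) (x \<otimes>\<^sub>h y) = blinfun_apply a x \<otimes>\<^sub>h blinfun_apply b y"
    using t by auto
qed

lemma op_tensor_comp:
  assumes "a \<in> complex_ops" "b \<in> complex_ops" "c \<in> complex_ops" "d \<in> complex_ops"
  shows "(a \<otimes>\<^sub>o b) o\<^sub>L (c \<otimes>\<^sub>o d) = (a o\<^sub>L c) \<otimes>\<^sub>o (b o\<^sub>L d)"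
  by (rule op_tensor_eqI[symmetric]) (simp add: op_tensor_apply assms)

lemma op_tensor_id: "id_blinfun \<otimes>\<^sub>o id_blinfun = id_blinfun"
  by (rule op_tensor_eqI) simp

lemma htensor_diff_left: "(x - x') \<otimes>\<^sub>h y = x \<otimes>\<^sub>h y - x' \<otimes>\<^sub>h y"
  and htensor_diff_right: "x \<otimes>\<^sub>h (y - y') = x \<otimes>\<^sub>h y - x \<otimes>\<^sub>h y'"
  by (metis add_diff_cancel_right' diff_add_cancel htensor_bilinear(1))
    (metis add_diff_cancel_right' diff_add_cancel htensor_bilinear(2))

lemma op_tensor_add_left:
  assumes "a \<in> complex_ops" "a' \<in> complex_ops" "b \<in> complex_ops"
  shows "(a + a') \<otimes>\<^sub>o b = (a \<otimes>\<^sub>o b) + (a' \<otimes>\<^sub>o b)"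
  by (rule op_tensor_eqI) (simp add: op_tensor_apply assms blinfun.bilinear_simps htensor_bilinear)

lemma op_tensor_add_right:
  assumes "a \<in> complex_ops" "b \<in> complex_ops" "b' \<in> complex_ops"
  shows "a \<otimes>\<^sub>o (b + b') = (a \<otimes>\<^sub>o b) + (a \<otimes>\<^sub>o b')"
  by (rule op_tensor_eqI) (simp add: op_tensor_apply assms blinfun.bilinear_simps htensor_bilinear)

lemma op_tensor_diff_left:
  assumes "a \<in> complex_ops" "a' \<in> complex_ops" "b \<in> complex_ops"
  shows "(a - a') \<otimes>\<^sub>o b = (a \<otimes>\<^sub>o b) - (a' \<otimes>\<^sub>o b)"
  by (rule op_tensor_eqI) (simp add: op_tensor_apply assms blinfun.bilinear_simps htensor_diff_left)

lemma op_tensor_diff_right: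
  assumes "a \<in> complex_ops" "b \<in> complex_ops" "b' \<in> complex_ops"
  shows "a \<otimes>\<^sub>o (b - b') = (a \<otimes>\<^sub>o b) - (a \<otimes>\<^sub>o b')"
  by (rule op_tensor_eqI) (simp add: op_tensor_apply assms blinfun.bilinear_simps htensor_diff_right)

lemma op_tensor_scaleC_left:
  assumes "a \<in> complex_ops" "b \<in> complex_ops"
  shows "(c *\<^sub>C a) \<otimes>\<^sub>o b = c *\<^sub>C (a \<otimes>\<^sub>o b)"
  by (rule op_tensor_eqI) (simp add: op_tensor_apply assms scaleC_blinfun.rep_eq htensor_bilinear)

lemma op_tensor_scaleC_right:
  assumes "a \<in> complex_ops" "b \<in> complex_ops"
  shows "a \<otimes>\<^sub>o (c *\<^sub>C b) = c *\<^sub>C (a \<otimes>\<^sub>o b)"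
  by (rule op_tensor_eqI) (simp add: op_tensor_apply assms scaleC_blinfun.rep_eq htensor_bilinear)

lemma adj_op_tensor:
  fixes a :: "'h::complex_hilbert \<Rightarrow>\<^sub>L 'h" and b :: "'k::complex_hilbert \<Rightarrow>\<^sub>L 'k"
  assumes "a \<in> complex_ops" "b \<in> complex_ops"
  shows "adj (a \<otimes>\<^sub>o b) = adj a \<otimes>\<^sub>o adj b"
proof (rule op_tensor_eqI[symmetric])
  fix x :: 'h and y :: 'k
  have "cinner z (blinfun_apply (adj (a \<otimes>\<^sub>o b)) (x \<otimes>\<^sub>h y)) = cinner z (blinfun_apply (adj a) x \<otimes>\<^sub>h blinfun_apply (adj b) y)"
    for z
  proof -
    have "cinner (blinfun_apply (adj (a \<otimes>\<^sub>o b)) (x \<otimes>\<^sub>h y)) z = cinner (blinfun_apply (adj a) x \<otimes>\<^sub>h blinfun_apply (adj b) y) z"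
      by (rule htensor_ext[OF bounded_linear_cinner bounded_linear_cinner])
        (simp add: cinner_adj_left assms op_tensor_apply cinner_tensor)
    then show ?thesis
      by (subst (1 2) cinner_commute) (rule arg_cong)
  qed
  then show "blinfun_apply (adj (a \<otimes>\<^sub>o b)) (x \<otimes>\<^sub>h y) = blinfun_apply (adj a) x \<otimes>\<^sub>h blinfun_apply (adj b) y"
    by (rule cinner_ext_right)
qed

lemma herm_op_tensor: "herm a \<Longrightarrow> herm b \<Longrightarrow> herm (a \<otimes>\<^sub>o b)"
  by (simp add: herm_iff_adj adj_op_tensor)

text \<open>For square roots s of a and t of b, the tensor product is \<open>adj (s
  \<otimes>\<^sub>o t) o\<^sub>L (s \<otimes>\<^sub>o t)\<close>.\<close>

lemma op_pos_op_tensor: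
  assumes "op_pos a" "op_pos b"
  shows "op_pos (a \<otimes>\<^sub>o b)"
proof -
  obtain s where s: "op_pos s" "s o\<^sub>L s = a"
    by (rule ex_sqrt[OF assms(1)]) blast
  obtain t where t: "op_pos t" "t o\<^sub>L t = b"
    by (rule ex_sqrt[OF assms(2)]) blast
  have ops: "s \<in> complex_ops" "t \<in> complex_ops"
    using s t by (auto simp: op_pos_def)
  have "adj (s \<otimes>\<^sub>o t) o\<^sub>L (s \<otimes>\<^sub>o t) = a \<otimes>\<^sub>o b"
    using s t ops by (simp add: adj_op_tensor op_tensor_comp herm_adj op_pos_herm)
  then show ?thesis
    using op_pos_adj_comp[of "s \<otimes>\<^sub>o t"] ops by simp
qed

lemma proj_op_tensor: "proj a \<Longrightarrow> proj b \<Longrightarrow> proj (a \<otimes>\<^sub>o b)"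
  unfolding proj_def by (simp add: herm_op_tensor op_tensor_comp herm_ops)

section \<open>The spatial tensor product as a von Neumann algebra\<close>

lemma spatial_tensor_generators:
  assumes A: "von_neumann_algebra A" and B: "von_neumann_algebra B"
  shows "{a \<otimes>\<^sub>o b | a b. a \<in> A \<and> b \<in> B} \<subseteq> complex_ops"
    "c \<in> {a \<otimes>\<^sub>o b | a b. a \<in> A \<and> b \<in> B} \<Longrightarrow> adj c \<in> {a \<otimes>\<^sub>o b | a b. a \<in> A \<and> b \<in> B}"
proof -
  interpret A: vn_algebra A by standard fact
  interpret B: vn_algebra B by standard fact
  show "{a \<otimes>\<^sub>o b | a b. a \<in> A \<and> b \<in> B} \<subseteq> complex_ops"
    using A.ops B.ops by auto
  assume "c \<in> {a \<otimes>\<^sub>o b | a b. a \<in> A \<and> b \<in> B}"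
  then obtain a b where ab: "c = a \<otimes>\<^sub>o b" "a \<in> A" "b \<in> B"
    by blast
  then have "adj c = adj a \<otimes>\<^sub>o adj b"
    by (simp add: adj_op_tensor A.ops B.ops)
  then show "adj c \<in> {a \<otimes>\<^sub>o b | a b. a \<in> A \<and> b \<in> B}"
    using A.adj_mem[OF ab(2)] B.adj_mem[OF ab(3)] by blast
qed

lemma von_neumann_algebra_spatial_tensor:
  assumes "von_neumann_algebra A" "von_neumann_algebra B"
  shows "von_neumann_algebra (spatial_tensor A B)"
  unfolding spatial_tensor_def
  by (rule von_neumann_algebra_bicommutant) (use spatial_tensor_generators[OF assms] in blast)+

lemma op_tensor_mem:
  assumes "von_neumann_algebra A" "von_neumann_algebra B" "a \<in> A" "b \<in> B"
  shows "a \<otimes>\<^sub>o b \<in> spatial_tensor A B"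
  using bicommutant_subset[OF spatial_tensor_generators(1)[OF assms(1,2)]] assms(3,4)
  unfolding spatial_tensor_def by blast

section \<open>Duplicators multiply\<close>

text \<open>On a vector k with p k = 0 the form of x is squeezed between 0 and the form of p, so it
  vanishes and x k = 0 by \<open>op_pos_norm_sq_le\<close>. Hence x (1 - p) = 0, and adjoints give
  the other side.\<close>

lemma op_pos_le_proj:
  assumes "op_pos x" "x \<le>\<^sub>o p" "proj p"
  shows "x o\<^sub>L p = x" "p o\<^sub>L x = x"
proof -
  have bd: "inner h (blinfun_apply x h) \<le> 1 * (norm h)\<^sup>2" for h
  proof -
    have "inner h (blinfun_apply x h) \<le> inner h (blinfun_apply p h)" "inner h (blinfun_apply p h) \<le> (norm h)\<^sup>2"
      using op_le_inner[OF assms(2)] op_le_id_iff[OF proj_herm[OF assms(3)]] proj_le_id[OF assms(3)] by auto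
    then show ?thesis
      by simp
  qed
  have "blinfun_apply x (h - blinfun_apply p h) = 0" for h
  proof -
    let ?k = "h - blinfun_apply p h"
    have "(norm (blinfun_apply x ?k))\<^sup>2 \<le> 1 * inner ?k (blinfun_apply x ?k)"
      by (rule op_pos_norm_sq_le[OF assms(1) bd])
    also have "\<dots> \<le> inner ?k (blinfun_apply p ?k)"
      using op_le_inner[OF assms(2), of ?k] by simp
    also have "blinfun_apply p ?k = 0"
      by (simp add: blinfun.bilinear_simps proj_apply[OF assms(3)])
    finally show ?thesis
      by simp
  qed
  then show 1: "x o\<^sub>L p = x"
    by (intro blinfun_eqI) (simp add: blinfun.bilinear_simps)
  have "adj (x o\<^sub>L p) = p o\<^sub>L x"
    using assms by (simp add: adj_comp herm_adj op_pos_herm proj_herm herm_ops)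
  then show "p o\<^sub>L x = x"
    using 1 assms(1) by (simp add: herm_adj op_pos_herm)
qed

lemma norm_contraction_le:
  assumes "op_pos x" "x \<le>\<^sub>o id_blinfun"
  shows "norm x \<le> 1"
  by (rule norm_blinfun_bound)
    (use assms op_le_norm_bound[of x 1] in \<open>auto simp: op_le_id_iff op_pos_herm\<close>)

text \<open>1 - x \<otimes> y = (1 - x) \<otimes> 1 + x \<otimes> (1 - y), a sum of positive
  operators.\<close>

lemma op_tensor_contraction:
  assumes "op_pos x" "x \<le>\<^sub>o id_blinfun" "op_pos y" "y \<le>\<^sub>o id_blinfun"
  shows "x \<otimes>\<^sub>o y \<le>\<^sub>o id_blinfun"
proof -
  have ops: "x \<in> complex_ops" "y \<in> complex_ops"
    using assms by (auto simp: op_pos_def)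
  have "id_blinfun - (x \<otimes>\<^sub>o y) = ((id_blinfun - x) \<otimes>\<^sub>o id_blinfun) + (x \<otimes>\<^sub>o (id_blinfun - y))"
    using ops by (simp add: op_tensor_diff_left op_tensor_diff_right op_tensor_id)
  moreover have "op_pos \<dots>"
    using assms by (auto simp: op_le_def intro!: op_pos_add op_pos_op_tensor)
  ultimately show ?thesis
    by (simp add: op_le_def)
qed

lemma op_tensor_scaleR_left:
  assumes "a \<in> complex_ops" "b \<in> complex_ops"
  shows "(r *\<^sub>R a) \<otimes>\<^sub>o b = r *\<^sub>R (a \<otimes>\<^sub>o b)"
  by (rule op_tensor_eqI) (simp add: op_tensor_apply assms blinfun.bilinear_simps scaleR_scaleC htensor_bilinear)

text \<open>The n-digit expansion of x gives F x = 2^-n F y with y a positive contraction. A uniform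
  bound on positive contractions thus takes the place of continuity; for \<delta> such a bound
  follows from the order.\<close>

lemma (in vn_algebra) vanish_if_vanish_on_projs:
  fixes F :: "('h \<Rightarrow>\<^sub>L 'h) \<Rightarrow> 'c::real_normed_vector"
  assumes add: "\<And>a b. a \<in> A \<Longrightarrow> b \<in> A \<Longrightarrow> F (a + b) = F a + F b"
    and scale: "\<And>r a. a \<in> A \<Longrightarrow> F (r *\<^sub>R a) = r *\<^sub>R F a"
    and projs: "\<And>p. p \<in> A \<Longrightarrow> proj p \<Longrightarrow> F p = 0"
    and bound: "\<And>y. y \<in> A \<Longrightarrow> op_pos y \<Longrightarrow> y \<le>\<^sub>o id_blinfun \<Longrightarrow> norm (F y) \<le> C"
    and x: "x \<in> A" "op_pos x" "x \<le>\<^sub>o id_blinfun"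
  shows "F x = 0"
proof -
  have "F 0 = 0"
    using scale[of 0 0] by simp
  then have "span {p \<in> A. proj p} \<subseteq> {q \<in> A. F q = 0}"
    by (intro span_minimal) (auto simp: subspace_def add scale add_mem scaleR_mem projs)
  then have span: "q \<in> A" "F q = 0" if "q \<in> span {p \<in> A. proj p}" for q
    using that by auto
  have le: "norm (F x) \<le> C * (1/2) ^ n" for n
  proof -
    obtain q y where q: "q \<in> span {p \<in> A. proj p}"
      and y: "y \<in> A" "op_pos y" "y \<le>\<^sub>o id_blinfun" "x = q + (1 / 2 ^ n) *\<^sub>R y"
      using binary_expansion[OF x] by blast
    have "F x = (1 / 2 ^ n) *\<^sub>R F y"
      using span[OF q] y(1) by (simp add: y(4) add scale scaleR_mem)
    then show ?thesis
      using bound[OF y(1,2,3)] by (simp add: power_one_over divide_right_mono)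
  qed
  have "(\<lambda>n. C * (1/2) ^ n) \<longlonglongrightarrow> C * 0"
    by (intro tendsto_mult_left LIMSEQ_power_zero) simp
  then have "norm (F x) \<le> C * 0"
    by (rule LIMSEQ_le_const) (use le in blast)
  then show ?thesis
    by simp
qed

locale duplicator_on = vn_algebra A for A :: "('h::complex_hilbert \<Rightarrow>\<^sub>L 'h) set" +
  fixes \<delta> and u
  assumes dup: "duplicator A \<delta> u"
begin

sublocale AA: vn_algebra "spatial_tensor A A"
  by standard (intro von_neumann_algebra_spatial_tensor vn)

lemma tensor_mem: "a \<in> A \<Longrightarrow> b \<in> A \<Longrightarrow> a \<otimes>\<^sub>o b \<in> spatial_tensor A A"
  by (rule op_tensor_mem[OF vn vn])

lemma delta_mem: "T \<in> spatial_tensor A A \<Longrightarrow> \<delta> T \<in> A"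
  and delta_add: "S \<in> spatial_tensor A A \<Longrightarrow> T \<in> spatial_tensor A A \<Longrightarrow> \<delta> (S + T) = \<delta> S + \<delta> T"
  and delta_scaleC: "T \<in> spatial_tensor A A \<Longrightarrow> \<delta> (c *\<^sub>C T) = c *\<^sub>C \<delta> T"
  and delta_pos: "T \<in> spatial_tensor A A \<Longrightarrow> op_pos T \<Longrightarrow> op_pos (\<delta> T)"
  using dup by (auto simp: duplicator_def linear_map_def positive_map_def)

lemma delta_scaleR: "T \<in> spatial_tensor A A \<Longrightarrow> \<delta> (r *\<^sub>R T) = r *\<^sub>R \<delta> T"
  by (simp add: delta_scaleC flip: scaleC_of_real)

lemma delta_diff:
  assumes "S \<in> spatial_tensor A A" "T \<in> spatial_tensor A A"
  shows "\<delta> (S - T) = \<delta> S - \<delta> T"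
  using delta_add[OF AA.diff_mem[OF assms] assms(2)] by simp

lemma delta_zero: "\<delta> 0 = 0"
  using delta_diff[of 0 0] by simp

lemma delta_mono:
  "S \<in> spatial_tensor A A \<Longrightarrow> T \<in> spatial_tensor A A \<Longrightarrow> S \<le>\<^sub>o T \<Longrightarrow> \<delta> S \<le>\<^sub>o \<delta> T"
  unfolding op_le_def by (simp add: delta_diff[symmetric] delta_pos AA.diff_mem)

text \<open>The order of the two conclusions matters: positivity of \<delta>(1 \<otimes> (1 - u)) =
  \<delta>(1) - 1 reverses subunitality, and only with \<delta>(1) = 1 does \<delta>((1 - u)
  \<otimes> (1 - u)) evaluate to u - 1.\<close>

lemma delta_unit: "\<delta> id_blinfun = id_blinfun" and unit_eq_id: "u = id_blinfun"
proof -
  have u: "u \<in> A" "op_pos u" "u \<le>\<^sub>o id_blinfun" and le: "\<delta> id_blinfun \<le>\<^sub>o id_blinfun"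
    and l: "\<And>a. a \<in> A \<Longrightarrow> \<delta> (a \<otimes>\<^sub>o u) = a" and r: "\<And>a. a \<in> A \<Longrightarrow> \<delta> (u \<otimes>\<^sub>o a) = a"
    using dup by (auto simp: duplicator_def op_le_zero_iff)
  let ?v = "id_blinfun - u"
  have v: "?v \<in> A" "op_pos ?v"
    using u by (auto simp: diff_mem op_le_def)
  note mem = tensor_mem[OF u(1) u(1)] tensor_mem[OF id_mem u(1)] tensor_mem[OF u(1) id_mem]
    tensor_mem[OF v(1) v(1)] tensor_mem[OF id_mem v(1)]
  have "op_pos (\<delta> (id_blinfun \<otimes>\<^sub>o ?v))"
    using v mem by (intro delta_pos op_pos_op_tensor) auto
  moreover have "(id_blinfun :: 'h \<Rightarrow>\<^sub>L 'h) \<otimes>\<^sub>o ?v = id_blinfun - (id_blinfun \<otimes>\<^sub>o u)"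
    using ops[OF u(1)] by (simp add: op_tensor_diff_right op_tensor_id)
  ultimately have "id_blinfun \<le>\<^sub>o \<delta> id_blinfun"
    using mem by (simp add: delta_diff l op_le_def)
  then show 1: "\<delta> id_blinfun = id_blinfun"
    using le by (rule op_le_antisym[rotated])
  have "op_pos (\<delta> (?v \<otimes>\<^sub>o ?v))"
    using v mem by (intro delta_pos op_pos_op_tensor) auto
  moreover have "?v \<otimes>\<^sub>o ?v = (id_blinfun - (u \<otimes>\<^sub>o id_blinfun)) - ((id_blinfun \<otimes>\<^sub>o u) - (u \<otimes>\<^sub>o u))"
    using ops[OF u(1)] by (simp add: op_tensor_diff_right op_tensor_diff_left op_tensor_id)
  ultimately have "id_blinfun \<le>\<^sub>o u"
    using mem u by (simp add: delta_diff AA.diff_mem l r 1 op_le_def)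
  then show "u = id_blinfun"
    using u(3) by (rule op_le_antisym[rotated])
qed

lemma delta_left: "a \<in> A \<Longrightarrow> \<delta> (a \<otimes>\<^sub>o id_blinfun) = a"
  and delta_right: "a \<in> A \<Longrightarrow> \<delta> (id_blinfun \<otimes>\<^sub>o a) = a"
  using dup unit_eq_id by (auto simp: duplicator_def)

lemma delta_proj_tensor:
  assumes p: "p \<in> A" "proj p" and b: "b \<in> A" "op_pos b" "b \<le>\<^sub>o id_blinfun"
  shows "\<delta> (p \<otimes>\<^sub>o b) = p o\<^sub>L b" "p o\<^sub>L b = b o\<^sub>L p"
proof -
  have bound: "op_pos (\<delta> (q \<otimes>\<^sub>o b))" "\<delta> (q \<otimes>\<^sub>o b) \<le>\<^sub>o q" if q: "q \<in> A" "proj q" for q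
  proof -
    show "op_pos (\<delta> (q \<otimes>\<^sub>o b))"
      using q b by (intro delta_pos op_pos_op_tensor tensor_mem proj_pos[OF q(2)])
    have "op_pos (q \<otimes>\<^sub>o (id_blinfun - b))"
      using b by (intro op_pos_op_tensor proj_pos[OF q(2)]) (auto simp: op_le_def)
    then have "q \<otimes>\<^sub>o b \<le>\<^sub>o q \<otimes>\<^sub>o id_blinfun"
      using q b by (simp add: op_le_def op_tensor_diff_right ops)
    then show "\<delta> (q \<otimes>\<^sub>o b) \<le>\<^sub>o q"
      using delta_mono[OF tensor_mem tensor_mem, of q b q id_blinfun] q b by (simp add: delta_left)
  qed
  let ?q = "id_blinfun - p"
  have q: "?q \<in> A" "proj ?q"
    using p by (auto simp: diff_mem proj_compl)
  let ?x = "\<delta> (p \<otimes>\<^sub>o b)" and ?y = "\<delta> (?q \<otimes>\<^sub>o b)"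
  have x: "?x o\<^sub>L p = ?x" "p o\<^sub>L ?x = ?x"
    using op_pos_le_proj[OF bound[OF p] p(2)] .
  have y: "?y o\<^sub>L p = 0" "p o\<^sub>L ?y = 0"
    using op_pos_le_proj[OF bound[OF q] q(2)]
    by (simp_all add: blinfun_compose.diff_left blinfun_compose.diff_right)
  have "?x + ?y = \<delta> (id_blinfun \<otimes>\<^sub>o b)"
    using p q b by (simp add: delta_add[symmetric] tensor_mem op_tensor_add_left[symmetric] ops)
  then have "?x + ?y = b"
    using b by (simp add: delta_right)
  then have "p o\<^sub>L b = p o\<^sub>L (?x + ?y)" "b o\<^sub>L p = (?x + ?y) o\<^sub>L p"
    by simp_all
  then have "p o\<^sub>L b = ?x" "b o\<^sub>L p = ?x"
    by (simp_all add: blinfun_compose.add_left blinfun_compose.add_right x y)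
  then show "\<delta> (p \<otimes>\<^sub>o b) = p o\<^sub>L b" "p o\<^sub>L b = b o\<^sub>L p"
    by simp_all
qed

lemma norm_comp_contraction_le:
  assumes "op_pos x" "x \<le>\<^sub>o id_blinfun" "op_pos y" "y \<le>\<^sub>o id_blinfun"
  shows "norm (x o\<^sub>L y) \<le> 1"
proof -
  have "norm (x o\<^sub>L y) \<le> norm x * norm y"
    by (rule norm_blinfun_compose)
  also have "\<dots> \<le> 1 * 1"
    using assms by (intro mult_mono norm_contraction_le) auto
  finally show ?thesis
    by simp
qed

text \<open>\<open>delta_proj_tensor\<close> covers a projection against a positive contraction. The
  commutator is linear and bounded by 2 on contractions, so \<open>vanish_if_vanish_on_projs\<close>
  replaces the projection by a positive contraction, and \<open>contraction_induct\<close> extends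
  both entries.\<close>

lemma comm:
  assumes "a \<in> A" "b \<in> A"
  shows "a o\<^sub>L b = b o\<^sub>L a"
  using assms(1)
proof (induction rule: contraction_induct)
  case (contraction x)
  show ?case
    using assms(2)
  proof (induction rule: contraction_induct)
    case (contraction y)
    have "(x o\<^sub>L y) - (y o\<^sub>L x) = 0"
    proof (rule vanish_if_vanish_on_projs[of "\<lambda>x. (x o\<^sub>L y) - (y o\<^sub>L x)" 2])
      show "norm ((z o\<^sub>L y) - (y o\<^sub>L z)) \<le> 2" if "z \<in> A" "op_pos z" "z \<le>\<^sub>o id_blinfun" for z
        using norm_triangle_ineq4[of "z o\<^sub>L y" "y o\<^sub>L z"] norm_comp_contraction_le[of z y]
          norm_comp_contraction_le[of y z] that contraction by simp
    qed (use contraction \<open>x \<in> A\<close> \<open>op_pos x\<close> \<open>x \<le>\<^sub>o id_blinfun\<close> delta_proj_tensor(2)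
        in \<open>auto simp: blinfun_compose.add_left blinfun_compose.add_right blinfun_compose.scaleR_left
          blinfun_compose.scaleR_right scaleR_diff_right\<close>)
    then show ?case
      by simp
  next
    case (scale c y)
    then have "blinfun_apply x (c *\<^sub>C blinfun_apply y h) = c *\<^sub>C blinfun_apply y (blinfun_apply x h)" for h
      using \<open>x \<in> A\<close> by (metis blinfun_apply_blinfun_compose complex_ops_scaleC ops)
    then show ?case
      by (intro blinfun_eqI) (simp add: scaleC_blinfun.rep_eq)
  qed (simp add: blinfun_compose.add_left blinfun_compose.add_right)
next
  case (scale c x)
  then have "blinfun_apply b (c *\<^sub>C blinfun_apply x h) = c *\<^sub>C blinfun_apply x (blinfun_apply b h)" for h
    using assms(2) by (metis blinfun_apply_blinfun_compose complex_ops_scaleC ops)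
  then show ?case
    by (intro blinfun_eqI) (simp add: scaleC_blinfun.rep_eq)
qed (simp add: blinfun_compose.add_left blinfun_compose.add_right)

text \<open>The extension is the one used for commutativity, applied to the difference of both
  sides. Its bound 2 comes from 0 \<le> \<delta>(z \<otimes> y) \<le> \<delta>(1) = 1 and from the
  norm of a product of contractions.\<close>

lemma delta_tensor:
  assumes "a \<in> A" "b \<in> A"
  shows "\<delta> (a \<otimes>\<^sub>o b) = a o\<^sub>L b"
  using assms(1)
proof (induction rule: contraction_induct)
  case (contraction x)
  show ?case
    using assms(2)
  proof (induction rule: contraction_induct)
    case (contraction y)
    have "\<delta> (x \<otimes>\<^sub>o y) - (x o\<^sub>L y) = 0"
    proof (rule vanish_if_vanish_on_projs[of "\<lambda>x. \<delta> (x \<otimes>\<^sub>o y) - (x o\<^sub>L y)" 2])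
      show "norm (\<delta> (z \<otimes>\<^sub>o y) - (z o\<^sub>L y)) \<le> 2" if z: "z \<in> A" "op_pos z" "z \<le>\<^sub>o id_blinfun" for z
      proof -
        have "\<delta> (z \<otimes>\<^sub>o y) \<le>\<^sub>o id_blinfun"
          using delta_mono[OF tensor_mem AA.id_mem op_tensor_contraction, of z y] z contraction by (simp add: delta_unit)
        then have "norm (\<delta> (z \<otimes>\<^sub>o y)) \<le> 1"
          using z contraction by (intro norm_contraction_le delta_pos tensor_mem op_pos_op_tensor)
        then show ?thesis
          using norm_triangle_ineq4[of "\<delta> (z \<otimes>\<^sub>o y)" "z o\<^sub>L y"] norm_comp_contraction_le[of z y] z contraction by simp
      qed
      show "\<delta> ((r *\<^sub>R a) \<otimes>\<^sub>o y) - ((r *\<^sub>R a) o\<^sub>L y) = r *\<^sub>R (\<delta> (a \<otimes>\<^sub>o y) - (a o\<^sub>L y))" if "a \<in> A" for r a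
        using that contraction
        by (simp add: op_tensor_scaleR_left ops delta_scaleR tensor_mem blinfun_compose.scaleR_left scaleR_diff_right)
    qed (use contraction \<open>x \<in> A\<close> \<open>op_pos x\<close> \<open>x \<le>\<^sub>o id_blinfun\<close> delta_proj_tensor(1)
        in \<open>auto simp: blinfun_compose.add_left op_tensor_add_left ops delta_add tensor_mem\<close>)
    then show ?case
      by simp
  qed (use \<open>x \<in> A\<close> in \<open>auto simp: blinfun_compose.add_right op_tensor_add_right ops delta_add tensor_mem
      op_tensor_scaleC_right delta_scaleC comp_scaleC_right\<close>)
qed (use assms(2) in \<open>auto simp: blinfun_compose.add_left op_tensor_add_left ops delta_add tensor_mem
      op_tensor_scaleC_left delta_scaleC comp_scaleC_left\<close>)

end

section \<open>Existence of atoms\<close>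

text \<open>For projections, \<open>q o\<^sub>L p = q\<close> is the order q \<le> p in
  multiplicative form, which suits the commutation arguments.\<close>

definition atoms :: "('h::complex_hilbert \<Rightarrow>\<^sub>L 'h) set \<Rightarrow> ('h \<Rightarrow>\<^sub>L 'h) set" where
  "atoms A = {p \<in> A. proj p \<and> p \<noteq> 0 \<and> (\<forall>q\<in>A. proj q \<and> q o\<^sub>L p = q \<longrightarrow> q = 0 \<or> q = p)}"

lemma atomsD:
  assumes "p \<in> atoms A"
  shows "p \<in> A" "proj p" "p \<noteq> 0"
  using assms by (auto simp: atoms_def)

lemma atoms_minimal: "p \<in> atoms A \<Longrightarrow> q \<in> A \<Longrightarrow> proj q \<Longrightarrow> q o\<^sub>L p = q \<Longrightarrow> q = 0 \<or> q = p"
  by (auto simp: atoms_def)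

text \<open>Dual to \<open>op_pos_le_proj\<close>, which is applied to 1 - x \<le> 1 - p.\<close>

lemma proj_mult_le:
  assumes "proj p" "op_pos x" "p \<le>\<^sub>o x" "x \<le>\<^sub>o id_blinfun"
  shows "p o\<^sub>L x = p"
proof -
  have "op_pos (id_blinfun - x)" "id_blinfun - x \<le>\<^sub>o id_blinfun - p"
    using assms by (auto simp: op_le_def)
  from op_pos_le_proj(2)[OF this proj_compl[OF assms(1)]] show ?thesis
    by (simp add: blinfun_compose.diff_left blinfun_compose.diff_right)
qed

lemma eventually_tails_mem:
  assumes "directed D" "\<And>d. d \<in> D \<Longrightarrow> P d"
  shows "eventually P (tails D)"
  using assms unfolding eventually_tails[OF assms(1)] by (auto simp: directed_def)

text \<open>Each d satisfies d T = d by \<open>proj_mult_le\<close>; letting d tend to T gives T T =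
  T.\<close>

lemma proj_directed_limit:
  assumes D: "directed D" "\<And>d. d \<in> D \<Longrightarrow> proj d" and T: "herm T" "\<And>d. d \<in> D \<Longrightarrow> d \<le>\<^sub>o T" "T \<le>\<^sub>o id_blinfun"
    and lim: "\<And>h. ((\<lambda>d. blinfun_apply d h) \<longlongrightarrow> blinfun_apply T h) (tails D)"
  shows "proj T"
proof -
  obtain d0 where d0: "d0 \<in> D"
    using D(1) by (auto simp: directed_def)
  have "op_pos T"
    using op_le_trans[of 0 d0 T] proj_pos[OF D(2)[OF d0]] T(2)[OF d0] by (simp add: op_le_zero_iff)
  then have dT: "blinfun_apply d (blinfun_apply T h) = blinfun_apply d h" if "d \<in> D" for d h
    using arg_cong[OF proj_mult_le[OF D(2)[OF that] _ T(2)[OF that] T(3)], of "\<lambda>f. blinfun_apply f h"] by simp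
  have "blinfun_apply T (blinfun_apply T h) = blinfun_apply T h" for h
  proof (rule tendsto_unique[OF tails_not_bot[OF D(1)] lim])
    show "((\<lambda>d. blinfun_apply d (blinfun_apply T h)) \<longlongrightarrow> blinfun_apply T h) (tails D)"
    proof (rule Lim_transform_eventually[OF lim])
      show "\<forall>\<^sub>F d in tails D. blinfun_apply d h = blinfun_apply d (blinfun_apply T h)"
        using d0 dT by (auto simp: eventually_tails[OF D(1)])
    qed
  qed
  then show ?thesis
    using T(1) by (auto simp: proj_def intro: blinfun_eqI)
qed

lemma norm_tensor: "norm (x \<otimes>\<^sub>h y) = norm x * norm y"
proof -
  have "complex_of_real ((norm (x \<otimes>\<^sub>h y))\<^sup>2) = complex_of_real ((norm x)\<^sup>2) * complex_of_real ((norm y)\<^sup>2)"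
    unfolding cinner_self[symmetric] by (rule cinner_tensor)
  then have "(norm (x \<otimes>\<^sub>h y))\<^sup>2 = (norm x * norm y)\<^sup>2"
    by (simp only: of_real_mult[symmetric] of_real_eq_iff power_mult_distrib)
  then show ?thesis
    by (simp add: power2_eq_iff_nonneg)
qed

lemma bounded_linear_tensor_left: "bounded_linear (\<lambda>x. x \<otimes>\<^sub>h y)"
  by (rule bounded_linear_intro[of _ "norm y"]) (auto simp: htensor_bilinear scaleR_scaleC norm_tensor)

text \<open>Finite products of the projections \<open>1 - p \<otimes> p\<^sup>\<bottom>\<close>: these form a downward directed family, whose
  infimum is the part of the tensor square living on the diagonal.\<close>

inductive_set diagonal_projs :: "('h::complex_hilbert \<Rightarrow>\<^sub>L 'h) set \<Rightarrow> (('h, 'h) htensor \<Rightarrow>\<^sub>L ('h, 'h) htensor) set"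
  for A where
  id: "id_blinfun \<in> diagonal_projs A"
| step: "G \<in> diagonal_projs A \<Longrightarrow> p \<in> A \<Longrightarrow> proj p \<Longrightarrow>
    G o\<^sub>L (id_blinfun - (p \<otimes>\<^sub>o (id_blinfun - p))) \<in> diagonal_projs A"

lemma diagonal_projs_comp:
  "G' \<in> diagonal_projs A \<Longrightarrow> G \<in> diagonal_projs A \<Longrightarrow> G o\<^sub>L G' \<in> diagonal_projs A"
  by (induction rule: diagonal_projs.induct)
    (auto simp: blinfun_compose_assoc[symmetric] intro: diagonal_projs.step)

section \<open>Diagonal vectors and the construction of atoms\<close>

context duplicator_on
begin

lemma tensor_commute:
  "a \<in> A \<Longrightarrow> b \<in> A \<Longrightarrow> c \<in> A \<Longrightarrow> d \<in> A \<Longrightarrow> (a \<otimes>\<^sub>o b) o\<^sub>L (c \<otimes>\<^sub>o d) = (c \<otimes>\<^sub>o d) o\<^sub>L (a \<otimes>\<^sub>o b)"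
  by (simp add: op_tensor_comp ops comm)

lemma diagonal_projs_commute:
  assumes "G \<in> diagonal_projs A" "a \<in> A" "b \<in> A"
  shows "G o\<^sub>L (a \<otimes>\<^sub>o b) = (a \<otimes>\<^sub>o b) o\<^sub>L G"
  using assms(1)
proof (induction rule: diagonal_projs.induct)
  case (step G p)
  let ?e = "p \<otimes>\<^sub>o (id_blinfun - p)" and ?c = "a \<otimes>\<^sub>o b"
  have "?e o\<^sub>L ?c = ?c o\<^sub>L ?e"
    using step assms by (intro tensor_commute) (auto simp: diff_mem)
  then have "(id_blinfun - ?e) o\<^sub>L ?c = ?c o\<^sub>L (id_blinfun - ?e)"
    by (simp add: blinfun_compose.diff_left blinfun_compose.diff_right)
  then show ?case
    using step.IH by (metis blinfun_compose_assoc)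
qed simp

text \<open>Multiplying G by 1 - e, where e = p \<otimes> (1 - p), removes at most e: 1 - G (1 - e)
  \<le> (1 - G) + e. Both summands have image 0 under \<delta>, the second because p (1 - p) = 0, so
  monotonicity carries the vanishing along.\<close>

lemma diagonal_projs_props:
  assumes "G \<in> diagonal_projs A"
  shows "G \<in> spatial_tensor A A \<and> proj G \<and> \<delta> (id_blinfun - G) = 0"
  using assms
proof (induction rule: diagonal_projs.induct)
  case id
  then show ?case
    by (simp add: delta_zero)
next
  case (step G p)
  let ?e = "p \<otimes>\<^sub>o (id_blinfun - p)"
  have e: "?e \<in> spatial_tensor A A" "proj ?e"
    using step by (auto intro!: tensor_mem diff_mem proj_op_tensor proj_compl)
  have Ge: "G o\<^sub>L ?e = ?e o\<^sub>L G"
    using step by (intro diagonal_projs_commute) (auto simp: diff_mem)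
  have G: "G \<in> spatial_tensor A A" "proj G" "\<delta> (id_blinfun - G) = 0"
    using step by auto
  let ?H = "G o\<^sub>L (id_blinfun - ?e)"
  have mem: "?H \<in> spatial_tensor A A"
    using G e by (intro AA.comp_mem AA.diff_mem) auto
  have proj: "proj ?H"
    using G e Ge by (intro proj_comp proj_compl) (auto simp: blinfun_compose.diff_left blinfun_compose.diff_right)
  have \<delta>e: "\<delta> ?e = 0"
    using step by (simp add: delta_tensor diff_mem blinfun_compose.diff_right proj_idem)
  have "op_pos ((id_blinfun - G) o\<^sub>L ?e)"
    using G e Ge by (intro op_pos_comp proj_pos proj_compl)
      (auto simp: blinfun_compose.diff_left blinfun_compose.diff_right)
  moreover have "(id_blinfun - G + ?e) - (id_blinfun - ?H) = (id_blinfun - G) o\<^sub>L ?e"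
    by (simp add: blinfun_compose.diff_left blinfun_compose.diff_right)
  ultimately have "id_blinfun - ?H \<le>\<^sub>o id_blinfun - G + ?e"
    by (simp add: op_le_def)
  then have "\<delta> (id_blinfun - ?H) \<le>\<^sub>o \<delta> (id_blinfun - G + ?e)"
    using G e mem by (intro delta_mono AA.add_mem AA.diff_mem) auto
  also have "\<delta> (id_blinfun - G + ?e) = 0"
    using G e \<delta>e by (simp add: delta_add AA.diff_mem)
  finally have "\<delta> (id_blinfun - ?H) \<le>\<^sub>o 0" .
  moreover have "0 \<le>\<^sub>o \<delta> (id_blinfun - ?H)"
    using mem proj by (simp add: op_le_zero_iff delta_pos AA.diff_mem proj_pos proj_compl)
  ultimately show ?case
    using mem proj op_le_antisym by blast
qed

lemma diagonal_projs_commutes: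
  assumes "G \<in> diagonal_projs A" "G' \<in> diagonal_projs A"
  shows "G o\<^sub>L G' = G' o\<^sub>L G"
  using assms(2)
proof (induction rule: diagonal_projs.induct)
  case (step G' p)
  let ?e = "p \<otimes>\<^sub>o (id_blinfun - p)"
  have "G o\<^sub>L ?e = ?e o\<^sub>L G"
    using step assms by (intro diagonal_projs_commute) (auto simp: diff_mem)
  then have "G o\<^sub>L (id_blinfun - ?e) = (id_blinfun - ?e) o\<^sub>L G"
    by (simp add: blinfun_compose.diff_left blinfun_compose.diff_right)
  then show ?case
    using step.IH by (metis blinfun_compose_assoc)
qed simp

text \<open>Normality forces the diagonal part of \<open>e0 \<otimes> 1\<close> to be nonzero, as \<open>\<delta>\<close> vanishes off the diagonal.\<close>

lemma ex_diagonal_vector: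
  assumes e0: "e0 \<in> A" "proj e0" "e0 \<noteq> 0"
  obtains \<xi> where "\<xi> \<noteq> 0" "blinfun_apply (e0 \<otimes>\<^sub>o id_blinfun) \<xi> = \<xi>"
    "\<And>p. p \<in> A \<Longrightarrow> proj p \<Longrightarrow> blinfun_apply (p \<otimes>\<^sub>o id_blinfun) \<xi> = blinfun_apply (p \<otimes>\<^sub>o p) \<xi>"
proof -
  define D where "D = {id_blinfun - G | G. G \<in> diagonal_projs A}"
  have D: "d \<in> spatial_tensor A A" "proj d" "\<delta> d = 0" if "d \<in> D" for d
    using that diagonal_projs_props by (auto simp: D_def intro: AA.diff_mem proj_compl)
  have sub: "D \<subseteq> self_adjoints (spatial_tensor A A)"
    using D(1) proj_herm[OF D(2)] by (auto simp: AA.self_adjoints_iff)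
  have dir: "directed D"
    unfolding directed_def
  proof (intro conjI ballI)
    show "D \<noteq> {}"
      using diagonal_projs.id by (auto simp: D_def)
    fix x y assume "x \<in> D" "y \<in> D"
    then obtain G G' where G: "G \<in> diagonal_projs A" "x = id_blinfun - G" "G' \<in> diagonal_projs A" "y = id_blinfun - G'"
      by (auto simp: D_def)
    have "x \<le>\<^sub>o id_blinfun - (G o\<^sub>L G')"
    proof -
      have "op_pos (G o\<^sub>L (id_blinfun - G'))"
        using G diagonal_projs_props diagonal_projs_commutes[OF G(1,3)] by (intro op_pos_comp proj_pos proj_compl)
          (auto simp: blinfun_compose.diff_left blinfun_compose.diff_right)
      then show ?thesis
        by (simp add: op_le_def G blinfun_compose.diff_right)
    qed
    moreover have "y \<le>\<^sub>o id_blinfun - (G o\<^sub>L G')"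
    proof -
      have "op_pos ((id_blinfun - G) o\<^sub>L G')"
        using G diagonal_projs_props diagonal_projs_commutes[OF G(1,3)] by (intro op_pos_comp proj_pos proj_compl)
          (auto simp: blinfun_compose.diff_left blinfun_compose.diff_right)
      then show ?thesis
        by (simp add: op_le_def G blinfun_compose.diff_left)
    qed
    moreover have "id_blinfun - (G o\<^sub>L G') \<in> D"
      using diagonal_projs_comp[OF G(3,1)] by (auto simp: D_def)
    ultimately show "\<exists>c\<in>D. x \<le>\<^sub>o c \<and> y \<le>\<^sub>o c"
      by blast
  qed
  have le_id: "d \<le>\<^sub>o id_blinfun" if "d \<in> D" for d
    using D[OF that] by (intro proj_le_id)
  obtain s where s: "is_supremum (spatial_tensor A A) D s"
    "\<And>t. (\<And>d. d \<in> D \<Longrightarrow> d \<le>\<^sub>o t) \<Longrightarrow> s \<le>\<^sub>o t"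
    "\<And>c. (\<And>d. d \<in> D \<Longrightarrow> d o\<^sub>L c = c o\<^sub>L d) \<Longrightarrow> s o\<^sub>L c = c o\<^sub>L s"
    by (rule AA.directed_limit_mem[OF sub dir le_id]) blast+
  have s_mem: "s \<in> spatial_tensor A A" "herm s" and s_upper: "d \<le>\<^sub>o s" if "d \<in> D" for d
    using s(1) that by (auto simp: is_supremum_def AA.self_adjoints_iff)
  have zero: "0 \<in> D"
    using diagonal_projs.id by (force simp: D_def)
  have s_pos: "op_pos s"
    using s_upper[OF zero] by (simp add: op_le_zero_iff)
  have s_le: "s \<le>\<^sub>o id_blinfun"
    by (rule s(2)) (rule le_id)
  have s_comm: "s o\<^sub>L (a \<otimes>\<^sub>o b) = (a \<otimes>\<^sub>o b) o\<^sub>L s" if "a \<in> A" "b \<in> A" for a b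
    by (rule s(3)) (use that diagonal_projs_commute in
      \<open>auto simp: D_def blinfun_compose.diff_left blinfun_compose.diff_right\<close>)
  \<comment> \<open>Normality: every d in D is mapped to 0, so s is mapped to the supremum of
    {0}.\<close>
  have "is_supremum A (\<delta> ` D) (\<delta> s)"
    using dup sub dir s(1) by (auto simp: duplicator_def normal_map_def)
  moreover have "\<delta> ` D = {0}"
    using D zero by force
  ultimately have "is_supremum A {0} (\<delta> s)"
    by simp
  then have \<delta>s: "\<delta> s = 0"
    by (intro op_le_antisym) (auto simp: is_supremum_def self_adjoints_iff)
  let ?E = "e0 \<otimes>\<^sub>o (id_blinfun :: 'h \<Rightarrow>\<^sub>L 'h)"
  have E: "?E \<in> spatial_tensor A A" "proj ?E"
    using e0 by (auto intro: tensor_mem proj_op_tensor)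
  have sE: "s o\<^sub>L ?E = ?E o\<^sub>L s"
    using e0 by (intro s_comm) auto
  \<comment> \<open>Otherwise e0 \<otimes> 1 \<le> s, and applying \<delta> gives e0 \<le>
    0.\<close>
  have "?E o\<^sub>L (id_blinfun - s) \<noteq> 0"
  proof
    assume "?E o\<^sub>L (id_blinfun - s) = 0"
    then have "s - ?E = s o\<^sub>L (id_blinfun - ?E)"
      by (simp add: blinfun_compose.diff_right sE)
    moreover have "op_pos (s o\<^sub>L (id_blinfun - ?E))"
      using E sE by (intro op_pos_comp[OF s_pos] proj_pos proj_compl)
        (auto simp: blinfun_compose.diff_left blinfun_compose.diff_right)
    ultimately have "\<delta> ?E \<le>\<^sub>o \<delta> s"
      using E s_mem[OF zero] by (intro delta_mono) (auto simp: op_le_def)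
    then have "e0 \<le>\<^sub>o 0"
      using e0 by (simp add: delta_left \<delta>s)
    moreover have "0 \<le>\<^sub>o e0"
      using e0 by (simp add: op_le_zero_iff proj_pos)
    ultimately show False
      using e0(3) op_le_antisym by blast
  qed
  then obtain \<eta> where \<eta>: "blinfun_apply (?E o\<^sub>L (id_blinfun - s)) \<eta> \<noteq> 0"
    by (metis blinfun_eqI zero_blinfun.rep_eq)
  define \<xi> where "\<xi> = blinfun_apply (?E o\<^sub>L (id_blinfun - s)) \<eta>"
  show thesis
  proof (rule that)
    show "\<xi> \<noteq> 0"
      using \<eta> by (simp add: \<xi>_def)
    show "blinfun_apply ?E \<xi> = \<xi>"
      by (simp add: \<xi>_def proj_apply[OF E(2)])
    show "blinfun_apply (p \<otimes>\<^sub>o id_blinfun) \<xi> = blinfun_apply (p \<otimes>\<^sub>o p) \<xi>" if p: "p \<in> A" "proj p" for p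
    proof -
      let ?e = "p \<otimes>\<^sub>o (id_blinfun - p)"
      have "id_blinfun - (id_blinfun o\<^sub>L (id_blinfun - ?e)) \<in> D"
        using diagonal_projs.step[OF diagonal_projs.id p] unfolding D_def by blast
      then have e: "?e \<in> D"
        by simp
      \<comment> \<open>As a projection below s, p \<otimes> (1 - p) annihilates 1 - s, and \<xi> is
        built from the range of 1 - s.\<close>
      have "?e o\<^sub>L s = ?e"
        by (rule proj_mult_le[OF D(2)[OF e] s_pos s_upper[OF e] s_le])
      moreover have "?e o\<^sub>L ?E = ?E o\<^sub>L ?e"
        using p e0 by (intro tensor_commute) (auto simp: diff_mem)
      ultimately have "?e o\<^sub>L (?E o\<^sub>L (id_blinfun - s)) = 0"
        by (metis (no_types) blinfun_compose.diff_right blinfun_compose.zero_right blinfun_compose_assoc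
            blinfun_compose_id(2) diff_self)
      then have "blinfun_apply ?e \<xi> = 0"
        by (metis \<xi>_def blinfun_apply_blinfun_compose zero_blinfun.rep_eq)
      then show ?thesis
        using p by (simp add: op_tensor_diff_right ops blinfun.bilinear_simps)
    qed
  qed
qed

text \<open>With \<open>\<xi>\<close> a diagonal vector, the complex measure \<open>\<nu>\<close> and the positive measure \<open>\<mu>\<close> below satisfy
  \<open>\<bar>\<nu>\<bar>\<^sup>2 \<le> \<mu>\<^sup>3\<close>. Hence \<open>\<mu>\<close> is bounded below on the projections with \<open>\<bar>\<nu>\<bar> \<ge> r \<mu>\<close>, so Zorn's lemma
  applies to them; a minimal one cannot be split, since the inequality passes to one of the parts.\<close>

lemma ex_atom:
  assumes e0: "e0 \<in> A" "proj e0" "e0 \<noteq> 0"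
  obtains m where "m \<in> atoms A" "e0 o\<^sub>L m = m"
proof -
  obtain \<xi> where \<xi>: "\<xi> \<noteq> 0" "blinfun_apply (e0 \<otimes>\<^sub>o id_blinfun) \<xi> = \<xi>"
    "\<And>p. p \<in> A \<Longrightarrow> proj p \<Longrightarrow> blinfun_apply (p \<otimes>\<^sub>o id_blinfun) \<xi> = blinfun_apply (p \<otimes>\<^sub>o p) \<xi>"
    by (rule ex_diagonal_vector[OF e0]) blast
  obtain x y where xy: "cinner (x \<otimes>\<^sub>h y) \<xi> \<noteq> 0"
    using htensor_orthogonal_zero \<xi>(1) by blast
  let ?L = "\<lambda>p. p \<otimes>\<^sub>o (id_blinfun :: 'h \<Rightarrow>\<^sub>L 'h)"
  define \<nu> where "\<nu> p = cinner (x \<otimes>\<^sub>h y) (blinfun_apply (?L p) \<xi>)" for p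
  define \<mu> where "\<mu> p = (norm (blinfun_apply p x))\<^sup>2 + (norm (blinfun_apply p y))\<^sup>2 +
    (norm (blinfun_apply (?L p) \<xi>))\<^sup>2" for p
  have \<mu>_nonneg: "\<mu> p \<ge> 0" for p
    by (simp add: \<mu>_def)
  have projL: "proj (?L p)" if "proj p" for p
    using that by (intro proj_op_tensor) auto
  have \<mu>_inner: "\<mu> p = inner x (blinfun_apply p x) + inner y (blinfun_apply p y) + inner \<xi> (blinfun_apply (?L p) \<xi>)"
    if "proj p" for p
    using that projL[OF that] by (simp add: \<mu>_def proj_inner)
  have bound: "(cmod (\<nu> p))\<^sup>2 \<le> \<mu> p ^ 3" if p: "p \<in> A" "proj p" for p
  proof -
    have pc: "p \<in> complex_ops"
      by (rule proj_ops[OF p(2)])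
    \<comment> \<open>Diagonality inserts p \<otimes> p in front of (p \<otimes> 1) \<xi>. Moved to
      the other side of the inner product it puts one p on x and one on y, while p still acts on
      \<xi>; each of the three squared norms is at most \<mu> p.\<close>
    have "blinfun_apply (?L p) \<xi> = blinfun_apply (p \<otimes>\<^sub>o p) (blinfun_apply (?L p) \<xi>)"
      using \<xi>(3)[OF p] proj_apply[OF proj_op_tensor[OF p(2) p(2)]] by simp
    then have "\<nu> p = cinner (blinfun_apply p x \<otimes>\<^sub>h blinfun_apply p y) (blinfun_apply (?L p) \<xi>)"
      unfolding \<nu>_def using herm_cinner[OF proj_herm[OF proj_op_tensor[OF p(2) p(2)]], of "x \<otimes>\<^sub>h y"]
      by (simp add: op_tensor_apply pc)
    then have "cmod (\<nu> p) \<le> norm (blinfun_apply p x) * norm (blinfun_apply p y) * norm (blinfun_apply (?L p) \<xi>)"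
      using cinner_bound by (metis norm_tensor)
    then have "(cmod (\<nu> p))\<^sup>2 \<le> (norm (blinfun_apply p x) * norm (blinfun_apply p y) * norm (blinfun_apply (?L p) \<xi>))\<^sup>2"
      by (rule power_mono) simp
    also have "\<dots> = (norm (blinfun_apply p x))\<^sup>2 * (norm (blinfun_apply p y))\<^sup>2 * (norm (blinfun_apply (?L p) \<xi>))\<^sup>2"
      by (simp add: power_mult_distrib)
    also have "\<dots> \<le> \<mu> p * \<mu> p * \<mu> p"
      by (intro mult_mono) (auto simp: \<mu>_def)
    finally show ?thesis
      by (simp add: power3_eq_cube)
  qed
  \<comment> \<open>The largest ratio for which e0 itself satisfies r * \<mu> e0 \<le> cmod (\<nu>
    e0).\<close>
  define r where "r = cmod (\<nu> e0) / \<mu> e0"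
  have \<nu>0: "\<nu> e0 \<noteq> 0"
    using xy \<xi>(2) by (simp add: \<nu>_def)
  then have "\<mu> e0 \<noteq> 0"
    using bound[OF e0(1,2)] by auto
  then have \<mu>0: "\<mu> e0 > 0"
    using \<mu>_nonneg[of e0] by simp
  then have r: "r > 0"
    using \<nu>0 by (simp add: r_def)
  define S where "S = {p \<in> A. proj p \<and> e0 o\<^sub>L p = p \<and> \<nu> p \<noteq> 0 \<and> r * \<mu> p \<le> cmod (\<nu> p)}"
  have S: "p \<in> A" "proj p" "e0 o\<^sub>L p = p" "\<nu> p \<noteq> 0" "r * \<mu> p \<le> cmod (\<nu> p)" if "p \<in> S" for p
    using that by (auto simp: S_def)
  have e0S: "e0 \<in> S"
    using e0 \<nu>0 \<mu>0 by (simp add: S_def r_def proj_idem)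
  \<comment> \<open>From r * \<mu> p \<le> cmod (\<nu> p) and the cubic bound follows r^2 \<le>
    \<mu> p, hence r^3 \<le> cmod (\<nu> p). This keeps \<nu> away from 0 in limits along
    chains.\<close>
  have lower: "r ^ 3 \<le> cmod (\<nu> p)" if p: "p \<in> S" for p
  proof -
    have "\<mu> p > 0"
      using bound[OF S(1,2)[OF p]] S(4)[OF p] \<mu>_nonneg[of p] by (cases "\<mu> p = 0") auto
    have "(r * \<mu> p)\<^sup>2 \<le> (cmod (\<nu> p))\<^sup>2"
      using S(5)[OF p] r \<mu>_nonneg[of p] by (intro power_mono) auto
    also have "\<dots> \<le> \<mu> p ^ 3"
      by (rule bound[OF S(1,2)[OF p]])
    finally have "r\<^sup>2 * (\<mu> p)\<^sup>2 \<le> \<mu> p * (\<mu> p)\<^sup>2"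
      by (simp add: power3_eq_cube power2_eq_square mult_ac)
    then have "r\<^sup>2 \<le> \<mu> p"
      using \<open>\<mu> p > 0\<close> by (simp add: mult_le_cancel_right)
    then have "r * r\<^sup>2 \<le> r * \<mu> p"
      using r by (simp add: mult_left_mono)
    then show ?thesis
      using S(5)[OF p] by (simp add: power3_eq_cube power2_eq_square)
  qed
  have \<mu>_mono: "\<mu> p \<le> \<mu> q" if "proj p" "proj q" "p \<le>\<^sub>o q" for p q
  proof -
    have "op_pos ((q - p) \<otimes>\<^sub>o (id_blinfun :: 'h \<Rightarrow>\<^sub>L 'h))"
      using that by (intro op_pos_op_tensor) (auto simp: op_le_def)
    then have "?L p \<le>\<^sub>o ?L q"
      using that by (simp add: op_le_def op_tensor_diff_left proj_ops)
    then show ?thesis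
      unfolding \<mu>_inner[OF that(1)] \<mu>_inner[OF that(2)] using that(3) by (intro add_mono op_le_inner)
  qed
  \<comment> \<open>Moves p onto the vector x, so that strong convergence in A suffices for limits
    of \<nu>.\<close>
  have \<nu>_alt: "\<nu> p = cinner (blinfun_apply p x \<otimes>\<^sub>h y) \<xi>" if "proj p" for p
    unfolding \<nu>_def using herm_cinner[OF proj_herm[OF projL[OF that]], of "x \<otimes>\<^sub>h y" \<xi>] that
    by (simp add: op_tensor_apply proj_ops)
  have le_iff: "p \<le>\<^sub>o q \<longleftrightarrow> q o\<^sub>L p = p" if "p \<in> A" "proj p" "q \<in> A" "proj q" for p q
  proof
    assume "p \<le>\<^sub>o q"
    then show "q o\<^sub>L p = p"
      using op_pos_le_proj(2) that proj_pos by blast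
  next
    assume "q o\<^sub>L p = p"
    moreover have "op_pos (q o\<^sub>L (id_blinfun - p))"
      using that comm[OF that(1,3)] by (intro op_pos_comp proj_pos proj_compl)
        (auto simp: blinfun_compose.diff_left blinfun_compose.diff_right)
    ultimately show "p \<le>\<^sub>o q"
      by (simp add: op_le_def blinfun_compose.diff_right)
  qed
  \<comment> \<open>The order is reversed, so a maximal element for P is a minimal member of
    S.\<close>
  define P :: "('h \<Rightarrow>\<^sub>L 'h) \<Rightarrow> ('h \<Rightarrow>\<^sub>L 'h) \<Rightarrow> bool" where "P a b \<longleftrightarrow> b \<le>\<^sub>o a" for a b
  have "\<exists>m\<in>S. \<forall>a\<in>S. P m a \<longrightarrow> a = m"
  proof (rule predicate_Zorn)
    show "partial_order_on S (relation_of P S)"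
      by (rule partial_order_on_relation_ofI) (auto simp: P_def intro: op_le_trans op_le_antisym)
    fix C assume "C \<in> Chains (relation_of P S)"
    then have C: "C \<subseteq> S" "\<And>a b. a \<in> C \<Longrightarrow> b \<in> C \<Longrightarrow> a \<le>\<^sub>o b \<or> b \<le>\<^sub>o a"
      by (auto simp: Chains_def relation_of_def P_def)
    show "\<exists>u\<in>S. \<forall>a\<in>C. P a u"
    proof (cases "C = {}")
      case True
      then show ?thesis
        using e0S by auto
    next
      case False
      \<comment> \<open>Complements turn the chain into an upward directed set, whose supremum t
        gives the lower bound 1 - t of C.\<close>
      define D where "D = (\<lambda>p. id_blinfun - p) ` C"
      have Dproj: "proj d" "d \<in> A" if "d \<in> D" for d
        using that C(1) S by (auto simp: D_def proj_compl diff_mem subset_iff)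
      have sub: "D \<subseteq> self_adjoints A"
        using Dproj(2) proj_herm[OF Dproj(1)] by (auto simp: self_adjoints_iff)
      have dir: "directed D"
        unfolding directed_def
      proof (intro conjI ballI)
        fix a b assume "a \<in> D" "b \<in> D"
        then obtain p q where pq: "p \<in> C" "q \<in> C" "a = id_blinfun - p" "b = id_blinfun - q"
          by (auto simp: D_def)
        then have "a \<le>\<^sub>o b \<or> b \<le>\<^sub>o a"
          using C(2)[of p q] by (auto simp: op_le_def)
        then show "\<exists>c\<in>D. a \<le>\<^sub>o c \<and> b \<le>\<^sub>o c"
          using \<open>a \<in> D\<close> \<open>b \<in> D\<close> op_le_refl by blast
      qed (use False in \<open>auto simp: D_def\<close>)
      obtain t where t: "is_supremum A D t" "\<And>h. ((\<lambda>d. blinfun_apply d h) \<longlongrightarrow> blinfun_apply t h) (tails D)"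
        "\<And>t'. (\<And>d. d \<in> D \<Longrightarrow> d \<le>\<^sub>o t') \<Longrightarrow> t \<le>\<^sub>o t'"
        by (rule directed_limit_mem[OF sub dir proj_le_id[OF Dproj(1)]]) blast+
      have t_mem: "t \<in> A" "herm t" and t_upper: "\<And>d. d \<in> D \<Longrightarrow> d \<le>\<^sub>o t"
        using t(1) by (auto simp: is_supremum_def self_adjoints_iff)
      have t_le: "t \<le>\<^sub>o id_blinfun"
        by (rule t(3)) (rule proj_le_id[OF Dproj(1)])
      have t_proj: "proj t"
        by (rule proj_directed_limit[OF dir Dproj(1) t_mem(2) t_upper t_le t(2)])
      let ?u = "id_blinfun - t"
      have u: "?u \<in> A" "proj ?u"
        using t_mem t_proj by (auto simp: diff_mem proj_compl)
      have u_le: "?u \<le>\<^sub>o p" if "p \<in> C" for p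
        using t_upper[of "id_blinfun - p"] that by (auto simp: D_def op_le_def algebra_simps)
      obtain p0 where p0: "p0 \<in> C"
        using False by blast
      have "e0 o\<^sub>L ?u = ?u"
      proof -
        have p0S: "p0 \<in> S"
          using p0 C(1) by blast
        have "p0 o\<^sub>L ?u = ?u"
          using le_iff[OF u S(1,2)[OF p0S]] u_le[OF p0] by blast
        then show ?thesis
          by (metis S(3)[OF p0S] blinfun_compose_assoc)
      qed
      moreover have lim: "((\<lambda>d. cmod (\<nu> (id_blinfun - d))) \<longlongrightarrow> cmod (\<nu> ?u)) (tails D)"
      proof -
        have 1: "bounded_linear (\<lambda>h. cinner \<xi> (h \<otimes>\<^sub>h y))"
          by (rule bounded_linear_compose[OF bounded_linear_cinner bounded_linear_tensor_left])
        have "((\<lambda>d. blinfun_apply (id_blinfun - d) x) \<longlongrightarrow> blinfun_apply ?u x) (tails D)"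
          by (simp add: blinfun.bilinear_simps) (intro tendsto_intros t(2))
        from tendsto_norm[OF bounded_linear.tendsto[OF 1 this]]
        have "((\<lambda>d. cmod (cinner \<xi> (blinfun_apply (id_blinfun - d) x \<otimes>\<^sub>h y))) \<longlongrightarrow> cmod (\<nu> ?u)) (tails D)"
          unfolding \<nu>_alt[OF u(2)] by (subst (asm) (2) cinner_commute) simp
        then show ?thesis
        proof (rule Lim_transform_eventually)
          have "cmod (cinner \<xi> (blinfun_apply (id_blinfun - d) x \<otimes>\<^sub>h y)) = cmod (\<nu> (id_blinfun - d))" if "d \<in> D" for d
            unfolding \<nu>_alt[OF proj_compl[OF Dproj(1)[OF that]]] by (subst cinner_commute) simp
          then show "\<forall>\<^sub>F d in tails D. cmod (cinner \<xi> (blinfun_apply (id_blinfun - d) x \<otimes>\<^sub>h y)) = cmod (\<nu> (id_blinfun - d))"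
            by (rule eventually_tails_mem[OF dir])
        qed
      qed
      have ev: "eventually (\<lambda>d. Q (id_blinfun - d)) (tails D)" if "\<And>p. p \<in> C \<Longrightarrow> Q p" for Q
        by (rule eventually_tails_mem[OF dir]) (use that in \<open>auto simp: D_def\<close>)
      have "r ^ 3 \<le> cmod (\<nu> ?u)"
        by (rule tendsto_lowerbound[OF lim ev tails_not_bot[OF dir]]) (use lower C(1) in blast)
      then have "\<nu> ?u \<noteq> 0"
        using r by (auto simp: not_le)
      moreover have "r * \<mu> ?u \<le> cmod (\<nu> ?u)"
      proof (rule tendsto_lowerbound[OF lim ev tails_not_bot[OF dir]])
        fix p assume p: "p \<in> C"
        then have pS: "p \<in> S"
          using C(1) by blast
        have "r * \<mu> ?u \<le> r * \<mu> p"
          using r by (intro mult_left_mono \<mu>_mono u S(2)[OF pS] u_le[OF p]) auto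
        then show "r * \<mu> ?u \<le> cmod (\<nu> p)"
          using S(5)[OF pS] by simp
      qed
      ultimately have "?u \<in> S"
        using u by (simp add: S_def)
      then show ?thesis
        using u_le by (auto simp: P_def)
    qed
  qed
  then obtain m where m: "m \<in> S" and min: "\<And>a. a \<in> S \<Longrightarrow> a \<le>\<^sub>o m \<Longrightarrow> a = m"
    by (auto simp: P_def)
  have sub: "q \<notin> S" if q: "q \<in> A" "proj q" "q o\<^sub>L m = q" "q \<noteq> m" for q
    using min[of q] le_iff[OF q(1,2) S(1,2)[OF m]] q comm[OF q(1) S(1)[OF m]] by auto
  have e0q: "e0 o\<^sub>L q = q" if "q \<in> A" "q o\<^sub>L m = q" for q
    using S(3)[OF m] comm[OF that(1) S(1)[OF m]] that(2) by (metis blinfun_compose_assoc)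
  have "q = 0 \<or> q = m" if q: "q \<in> A" "proj q" "q o\<^sub>L m = q" for q
  proof (rule ccontr)
    assume "\<not> (q = 0 \<or> q = m)"
    then have neq: "q \<noteq> 0" "q \<noteq> m"
      by auto
    let ?q = "m - q"
    have mA: "m \<in> A" "proj m"
      using S m by auto
    have mq: "m o\<^sub>L q = q"
      using q comm[OF q(1) mA(1)] by simp
    have q': "?q \<in> A" "proj ?q" "?q o\<^sub>L m = ?q" "?q \<noteq> m"
      using q mA mq neq
      by (auto simp: proj_def diff_mem herm_diff blinfun_compose.diff_left blinfun_compose.diff_right)
    have \<nu>m: "\<nu> m = \<nu> q + \<nu> ?q"
      using q mA by (simp add: \<nu>_def op_tensor_diff_left ops blinfun.bilinear_simps cinner_diff_right)
    have \<mu>m: "\<mu> m = \<mu> q + \<mu> ?q"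
      using q mA q' by (simp add: \<mu>_inner op_tensor_diff_left ops blinfun.bilinear_simps inner_diff_right)
    have r\<mu>: "0 \<le> r * \<mu> q" "0 \<le> r * \<mu> ?q"
      using r \<mu>_nonneg by (simp_all add: less_imp_le)
    have main: "r * \<mu> q + r * \<mu> ?q \<le> cmod (\<nu> q + \<nu> ?q)"
      using S(5)[OF m] by (simp add: \<nu>m \<mu>m distrib_left)
    \<comment> \<open>Minimality of m keeps both parts out of S, and only the conditions on \<nu>
      can fail. So cmod \<nu> \<le> r * \<mu> on each part, strictly on a part where \<nu> is
      nonzero; such a part exists, contradicting \<open>main\<close>.\<close>
    have q1: "\<nu> q = 0 \<or> cmod (\<nu> q) < r * \<mu> q"
      using sub[OF q neq(2)] q e0q[OF q(1,3)] by (auto simp: S_def)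
    have q2: "\<nu> ?q = 0 \<or> cmod (\<nu> ?q) < r * \<mu> ?q"
      using sub[OF q'] q' e0q[OF q'(1,3)] by (auto simp: S_def)
    have "\<nu> q + \<nu> ?q \<noteq> 0"
      using S(4)[OF m] by (simp add: \<nu>m)
    then show False
      using q1 q2 main r\<mu> norm_triangle_ineq[of "\<nu> q" "\<nu> ?q"] by auto
  qed
  moreover have "m \<noteq> 0"
    using S(4)[OF m] htensor_diff_left[of "0::'h" 0 y] by (auto simp: \<nu>_alt)
  ultimately have "m \<in> atoms A"
    using S[OF m] by (auto simp: atoms_def)
  then show thesis
    using that S(3)[OF m] by blast
qed

end

section \<open>Commutative algebras with enough atoms\<close>

lemma op_pos_null:
  assumes "op_pos b" "inner v (blinfun_apply b v) = 0"
  shows "blinfun_apply b v = 0"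
  using op_pos_norm_sq_le[OF assms(1) inner_op_le, of v] assms(2) by simp

text \<open>The representation as bounded functions rests on these two properties, so it is
  developed apart from duplicators and attached to them by a sublocale.\<close>

locale atomic_algebra = vn_algebra A for A :: "('h::complex_hilbert \<Rightarrow>\<^sub>L 'h) set" +
  assumes commute: "a \<in> A \<Longrightarrow> b \<in> A \<Longrightarrow> a o\<^sub>L b = b o\<^sub>L a"
    and atom_below: "e \<in> A \<Longrightarrow> proj e \<Longrightarrow> e \<noteq> 0 \<Longrightarrow> \<exists>p\<in>atoms A. e o\<^sub>L p = p"
begin

lemma atom_cases:
  assumes "p \<in> atoms A" "q \<in> A" "proj q"
  shows "q o\<^sub>L p = 0 \<or> q o\<^sub>L p = p"
proof (rule atoms_minimal[OF assms(1)])
  show "q o\<^sub>L p \<in> A" "proj (q o\<^sub>L p)"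
    using assms atomsD commute by (auto intro!: comp_mem proj_comp)
  show "q o\<^sub>L p o\<^sub>L p = q o\<^sub>L p"
    using proj_idem[OF atomsD(2)[OF assms(1)]] by (simp add: blinfun_compose_assoc)
qed

lemma atoms_orthogonal:
  assumes "p \<in> atoms A" "q \<in> atoms A" "p \<noteq> q"
  shows "p o\<^sub>L q = 0"
  using atom_cases[OF assms(1) atomsD(1,2)[OF assms(2)]] atom_cases[OF assms(2) atomsD(1,2)[OF assms(1)]]
    commute[OF atomsD(1)[OF assms(1)] atomsD(1)[OF assms(2)]] assms(3) by auto

text \<open>Subtracting the mean value t of a at a vector v in the range of p leaves y with <v, y v>
  = 0. The sign projection of y contains or annihilates p, so y has one sign there and y v = 0; then
  the kernel projection of y does not annihilate p, hence contains it.\<close>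

lemma atom_scalar_herm:
  assumes p: "p \<in> atoms A" and a: "a \<in> A" "herm a"
  shows "\<exists>t. a o\<^sub>L p = t *\<^sub>R p"
proof -
  obtain h where h: "blinfun_apply p h \<noteq> 0"
    using atomsD(3)[OF p] by (metis blinfun_eqI zero_blinfun.rep_eq)
  define v where "v = blinfun_apply p h"
  have v: "v \<noteq> 0" "blinfun_apply p v = v"
    using h proj_apply[OF atomsD(2)[OF p]] by (auto simp: v_def)
  define t where "t = inner v (blinfun_apply a v) / inner v v"
  define y where "y = a - t *\<^sub>R id_blinfun"
  have y: "y \<in> A" "herm y"
    using a by (auto simp: y_def intro!: diff_mem scaleR_mem herm_diff herm_scaleR)
  have vy: "inner v (blinfun_apply y v) = 0"
    using v(1) by (simp add: y_def t_def blinfun.bilinear_simps inner_diff_right)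
  obtain q where q: "q \<in> A" "proj q" "op_pos (y o\<^sub>L q)" "op_pos (- (y o\<^sub>L (id_blinfun - q)))" "q o\<^sub>L y = y o\<^sub>L q"
    by (rule sign_proj_mem[OF y])
  have "blinfun_apply y v = 0"
    using atom_cases[OF p q(1,2)]
  proof
    assume "q o\<^sub>L p = p"
    then have "blinfun_apply q v = v"
      by (metis v(2) blinfun_apply_blinfun_compose)
    then show ?thesis
      using op_pos_null[OF q(3), of v] vy by simp
  next
    assume "q o\<^sub>L p = 0"
    then have "blinfun_apply q v = 0"
      by (metis v(2) blinfun_apply_blinfun_compose zero_blinfun.rep_eq)
    then show ?thesis
      using op_pos_null[OF q(4), of v] vy by (simp add: blinfun.bilinear_simps)
  qed
  moreover obtain k where k: "k \<in> A" "proj k" "y o\<^sub>L k = 0" "\<And>h. blinfun_apply y h = 0 \<Longrightarrow> blinfun_apply k h = h"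
    by (rule kernel_proj_mem[OF y]) blast
  ultimately have "blinfun_apply k v = v"
    by blast
  then have "blinfun_apply (k o\<^sub>L p) v \<noteq> 0"
    using v by simp
  then have "k o\<^sub>L p = p"
    using atom_cases[OF p k(1,2)] by (metis zero_blinfun.rep_eq)
  then have "y o\<^sub>L p = 0"
    using k(3) by (metis blinfun_compose.zero_left blinfun_compose_assoc)
  then have "a o\<^sub>L p = t *\<^sub>R p"
    by (simp add: y_def blinfun_compose.diff_left blinfun_compose.scaleR_left)
  then show ?thesis ..
qed

lemma atom_scalar:
  assumes p: "p \<in> atoms A" and a: "a \<in> A"
  shows "\<exists>c. a o\<^sub>L p = c *\<^sub>C p"
proof -
  obtain b c where bc: "b \<in> A" "herm b" "c \<in> A" "herm c" "a = b + \<i> *\<^sub>C c"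
    by (rule herm_decomp[OF a])
  obtain s t where "b o\<^sub>L p = s *\<^sub>R p" "c o\<^sub>L p = t *\<^sub>R p"
    using atom_scalar_herm[OF p] bc by metis
  then have "blinfun_apply (b o\<^sub>L p) h = complex_of_real s *\<^sub>C blinfun_apply p h"
    "blinfun_apply (c o\<^sub>L p) h = complex_of_real t *\<^sub>C blinfun_apply p h" for h
    by (simp_all add: blinfun.bilinear_simps scaleR_scaleC)
  then have "a o\<^sub>L p = (complex_of_real s + \<i> * complex_of_real t) *\<^sub>C p"
    by (intro blinfun_eqI) (simp add: bc(5) blinfun.bilinear_simps scaleC_blinfun.rep_eq scaleC_add_left scaleC_scaleC)
  then show ?thesis ..
qed

text \<open>Let k be the kernel projection of \<open>adj a o\<^sub>L a\<close>. Were 1 - k nonzero,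
  an atom p would lie below it, but a p = 0 places p below k as well.\<close>

lemma eq_zero_if_atoms:
  assumes a: "a \<in> A" and z: "\<And>p. p \<in> atoms A \<Longrightarrow> a o\<^sub>L p = 0"
  shows "a = 0"
proof -
  let ?z = "adj a o\<^sub>L a"
  have "?z \<in> A" "herm ?z"
    using a op_pos_herm[OF op_pos_adj_comp] ops by (auto intro!: comp_mem adj_mem)
  then obtain k where k: "k \<in> A" "proj k" "?z o\<^sub>L k = 0" "\<And>h. blinfun_apply ?z h = 0 \<Longrightarrow> blinfun_apply k h = h"
    by (rule kernel_proj_mem) blast
  have "id_blinfun - k = 0"
  proof (rule ccontr)
    assume "id_blinfun - k \<noteq> 0"
    then obtain p where p: "p \<in> atoms A" "(id_blinfun - k) o\<^sub>L p = p"
      using atom_below[of "id_blinfun - k"] k by (auto simp: diff_mem proj_compl)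
    have "blinfun_apply k (blinfun_apply p h) = blinfun_apply p h" for h
      using arg_cong[OF z[OF p(1)], of "\<lambda>f. blinfun_apply f h"]
      by (intro k(4)) (simp add: blinfun.bilinear_simps)
    then have "k o\<^sub>L p = p"
      by (intro blinfun_eqI) simp
    then show False
      using p atomsD(3)[OF p(1)] by (simp add: blinfun_compose.diff_left)
  qed
  then have "?z = 0"
    using k(3) by simp
  then have "inner h (blinfun_apply ?z h) = 0" for h
    by simp
  then have "(norm (blinfun_apply a h))\<^sup>2 = 0" for h
    by (simp add: inner_cinner cinner_adj_right ops[OF a] cinner_self)
  then show ?thesis
    by (intro blinfun_eqI) simp
qed

section \<open>The Gelfand transform evaluated at atoms\<close>

definition atom_value :: "('h \<Rightarrow>\<^sub>L 'h) \<Rightarrow> ('h \<Rightarrow>\<^sub>L 'h) \<Rightarrow> complex" where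
  "atom_value a p = (THE c. a o\<^sub>L p = c *\<^sub>C p)"

lemma atom_value_eqI: "p \<in> atoms A \<Longrightarrow> a o\<^sub>L p = c *\<^sub>C p \<Longrightarrow> atom_value a p = c"
  unfolding atom_value_def by (rule the_equality) (use scaleC_op_cancel atomsD(3) in metis)+

lemma atom_value: "p \<in> atoms A \<Longrightarrow> a \<in> A \<Longrightarrow> a o\<^sub>L p = atom_value a p *\<^sub>C p"
  using atom_scalar atom_value_eqI by metis

lemma atom_value_add: "p \<in> atoms A \<Longrightarrow> a \<in> A \<Longrightarrow> b \<in> A \<Longrightarrow> atom_value (a + b) p = atom_value a p + atom_value b p"
  by (rule atom_value_eqI)
    (auto simp: blinfun_compose.add_left atom_value scaleC_blinfun.rep_eq blinfun.bilinear_simps scaleC_add_left intro!: blinfun_eqI)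

lemma atom_value_scaleC: "p \<in> atoms A \<Longrightarrow> a \<in> A \<Longrightarrow> atom_value (c *\<^sub>C a) p = c * atom_value a p"
  by (rule atom_value_eqI)
    (auto simp: comp_scaleC_left atom_value scaleC_blinfun.rep_eq scaleC_scaleC intro!: blinfun_eqI)

lemma atom_value_comp:
  assumes "p \<in> atoms A" "a \<in> A" "b \<in> A"
  shows "atom_value (a o\<^sub>L b) p = atom_value a p * atom_value b p"
proof (rule atom_value_eqI[OF assms(1)])
  have "a o\<^sub>L b o\<^sub>L p = atom_value b p *\<^sub>C (a o\<^sub>L p)"
    using assms by (simp add: blinfun_compose_assoc atom_value comp_scaleC_right ops)
  then show "a o\<^sub>L b o\<^sub>L p = (atom_value a p * atom_value b p) *\<^sub>C p"
    using assms by (auto simp: atom_value scaleC_blinfun.rep_eq scaleC_scaleC mult.commute intro!: blinfun_eqI)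
qed

lemma atom_value_adj:
  assumes "p \<in> atoms A" "a \<in> A"
  shows "atom_value (adj a) p = cnj (atom_value a p)"
proof (rule atom_value_eqI[OF assms(1)])
  note p = atomsD[OF assms(1)]
  have "adj a o\<^sub>L p = p o\<^sub>L adj a"
    using assms p by (intro commute adj_mem)
  also have "\<dots> = adj (a o\<^sub>L p)"
    using assms p by (simp add: adj_comp ops herm_adj proj_herm)
  also have "\<dots> = cnj (atom_value a p) *\<^sub>C p"
    using assms p by (simp add: atom_value adj_scaleC ops herm_adj proj_herm)
  finally show "adj a o\<^sub>L p = cnj (atom_value a p) *\<^sub>C p" .
qed

lemma atom_value_id: "p \<in> atoms A \<Longrightarrow> atom_value id_blinfun p = 1"
  by (rule atom_value_eqI) (auto simp: scaleC_blinfun.rep_eq intro!: blinfun_eqI)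

lemma atom_value_bound:
  assumes "p \<in> atoms A" "a \<in> A"
  shows "cmod (atom_value a p) \<le> norm a"
proof -
  obtain h where h: "blinfun_apply p h \<noteq> 0"
    using atomsD(3)[OF assms(1)] by (metis blinfun_eqI zero_blinfun.rep_eq)
  have "atom_value a p *\<^sub>C blinfun_apply p h = blinfun_apply a (blinfun_apply p h)"
    using arg_cong[OF atom_value[OF assms], of "\<lambda>f. blinfun_apply f h"] by (simp add: scaleC_blinfun.rep_eq)
  then have "cmod (atom_value a p) * norm (blinfun_apply p h) \<le> norm a * norm (blinfun_apply p h)"
    by (metis norm_blinfun norm_scaleC)
  then show ?thesis
    using h by (simp add: mult_le_cancel_right)
qed

lemma sum_atoms_proj:
  assumes "finite F" "F \<subseteq> atoms A"
  shows "proj (\<Sum>F)"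
proof -
  have "(\<Sum>F) o\<^sub>L (\<Sum>F) = (\<Sum>p\<in>F. \<Sum>q\<in>F. p o\<^sub>L q)"
    by (simp add: blinfun_compose.sum_left blinfun_compose.sum_right) (rule sum.swap)
  also have "\<dots> = (\<Sum>p\<in>F. \<Sum>q\<in>F. if q = p then p else 0)"
    using assms(2) by (intro sum.cong refl) (auto simp: subset_iff atoms_orthogonal proj_idem[OF atomsD(2), of _ A])
  also have "\<dots> = \<Sum>F"
    using assms(1) by simp
  finally have "(\<Sum>F) o\<^sub>L (\<Sum>F) = \<Sum>F" .
  moreover have "herm (\<Sum>F)"
    using assms by (induction F rule: finite_induct) (auto intro!: herm_add intro: proj_herm[OF atomsD(2)])
  ultimately show ?thesis
    by (simp add: proj_def)
qed

text \<open>The element is the supremum of the finite sums of f p times p. Nonnegativity of f makes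
  this net increasing, and orthogonality of the atoms bounds it by 1; signs and complex values are
  restored afterwards by affine combinations.\<close>

lemma ex_atom_value_unit_interval:
  fixes f :: "('h \<Rightarrow>\<^sub>L 'h) \<Rightarrow> real"
  assumes f: "\<And>p. p \<in> atoms A \<Longrightarrow> 0 \<le> f p \<and> f p \<le> 1"
  shows "\<exists>a\<in>A. \<forall>p\<in>atoms A. a o\<^sub>L p = f p *\<^sub>R p"
proof -
  define s where "s F = (\<Sum>p\<in>F. f p *\<^sub>R p)" for F
  define D where "D = s ` {F. finite F \<and> F \<subseteq> atoms A}"
  have inner_s: "inner h (blinfun_apply (s F) h) = (\<Sum>p\<in>F. f p * (norm (blinfun_apply p h))\<^sup>2)"
    if "F \<subseteq> atoms A" for F h
    unfolding s_def blinfun.sum_left inner_sum_right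
    using that by (intro sum.cong refl) (auto simp: blinfun.bilinear_simps proj_inner atomsD(2) subset_iff)
  have s_mem: "s F \<in> A" "herm (s F)" if "finite F" "F \<subseteq> atoms A" for F
  proof -
    show "s F \<in> A"
      unfolding s_def using that by (intro sum_mem scaleR_mem) (auto intro: atomsD(1))
    show "herm (s F)"
      unfolding s_def using that
      by (induction F rule: finite_induct) (auto intro!: herm_add herm_scaleR intro: proj_herm[OF atomsD(2)])
  qed
  have s_mono: "s F \<le>\<^sub>o s G" if "finite G" "F \<subseteq> G" "G \<subseteq> atoms A" for F G
  proof -
    have F: "finite F" "F \<subseteq> atoms A"
      using that by (auto intro: finite_subset)
    show ?thesis
      unfolding op_le_iff[OF s_mem(2)[OF F] s_mem(2)[OF that(1,3)]] inner_s[OF F(2)] inner_s[OF that(3)]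
      using that f by (auto intro!: sum_mono2 mult_nonneg_nonneg)
  qed
  have s_le: "s F \<le>\<^sub>o id_blinfun" if F: "finite F" "F \<subseteq> atoms A" for F
    unfolding op_le_id_iff[OF s_mem(2)[OF F]]
  proof
    fix h
    have "inner h (blinfun_apply (s F) h) \<le> (\<Sum>p\<in>F. (norm (blinfun_apply p h))\<^sup>2)"
      unfolding inner_s[OF F(2)] using f F by (intro sum_mono mult_left_le_one_le) auto
    also have "\<dots> = inner h (blinfun_apply (\<Sum>F) h)"
      unfolding blinfun.sum_left inner_sum_right
      using F by (intro sum.cong refl) (auto simp: proj_inner atomsD(2) subset_iff)
    also have "\<dots> \<le> (norm h)\<^sup>2"
      using proj_le_id[OF sum_atoms_proj[OF F]] op_le_id_iff[OF proj_herm[OF sum_atoms_proj[OF F]]] by blast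
    finally show "inner h (blinfun_apply (s F) h) \<le> (norm h)\<^sup>2" .
  qed
  have sub: "D \<subseteq> self_adjoints A"
    using s_mem by (auto simp: D_def self_adjoints_iff)
  have dir: "directed D"
    unfolding directed_def
  proof (intro conjI ballI)
    fix a b assume "a \<in> D" "b \<in> D"
    then obtain F G where FG: "finite F" "F \<subseteq> atoms A" "a = s F" "finite G" "G \<subseteq> atoms A" "b = s G"
      by (auto simp: D_def)
    then have "a \<le>\<^sub>o s (F \<union> G)" "b \<le>\<^sub>o s (F \<union> G)" "s (F \<union> G) \<in> D"
      by (auto simp: D_def intro!: s_mono)
    then show "\<exists>c\<in>D. a \<le>\<^sub>o c \<and> b \<le>\<^sub>o c"
      by blast
  qed (auto simp: D_def)
  have D_le: "d \<le>\<^sub>o id_blinfun" if "d \<in> D" for d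
    using that s_le by (auto simp: D_def)
  obtain T where T: "is_supremum A D T" "\<And>h. ((\<lambda>d. blinfun_apply d h) \<longlongrightarrow> blinfun_apply T h) (tails D)"
    by (rule directed_limit_mem[OF sub dir D_le]) blast+
  have "T o\<^sub>L p = f p *\<^sub>R p" if p: "p \<in> atoms A" for p
  proof (rule blinfun_eqI)
    fix h
    let ?v = "blinfun_apply p h"
    have pv: "blinfun_apply p ?v = ?v"
      by (rule proj_apply[OF atomsD(2)[OF p]])
    have s_app: "blinfun_apply (s F) ?v = (if p \<in> F then f p *\<^sub>R ?v else 0)" if F: "finite F" "F \<subseteq> atoms A" for F
    proof -
      have "blinfun_apply q ?v = (if q = p then ?v else 0)" if "q \<in> F" for q
        using pv arg_cong[OF atoms_orthogonal[of q p], of "\<lambda>g. blinfun_apply g h"] that F p by auto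
      then have "blinfun_apply (s F) ?v = (\<Sum>q\<in>F. if q = p then f p *\<^sub>R ?v else 0)"
        unfolding s_def blinfun.sum_left by (intro sum.cong refl) (auto simp: blinfun.bilinear_simps)
      then show ?thesis
        using F by simp
    qed
    have sp: "s {p} \<in> D"
      using p by (auto simp: D_def)
    have "blinfun_apply e ?v = f p *\<^sub>R ?v" if e: "e \<in> D" "s {p} \<le>\<^sub>o e" for e
    proof -
      obtain F where F: "finite F" "F \<subseteq> atoms A" "e = s F"
        using e by (auto simp: D_def)
      show ?thesis
      \<comment> \<open>The tail condition compares operators, not index sets: an e above s {p} may
        come from an F without p, but then f p = 0 or the vector vanishes.\<close>
      proof (cases "p \<in> F")
        case False
        then have 0: "blinfun_apply e ?v = 0"
          using s_app F by simp
        have "f p * (norm ?v)\<^sup>2 \<le> 0"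
          using op_le_inner[OF e(2), of ?v] 0 inner_s[of "{p}" ?v] p by (simp add: pv)
        then have "f p = 0 \<or> ?v = 0"
          using f[OF p] by (metis mult_le_0_iff norm_eq_zero order_antisym power2_less_eq_zero_iff zero_le_power2)
        then show ?thesis
          using 0 by auto
      qed (use s_app F in simp)
    qed
    then have "((\<lambda>d. blinfun_apply d ?v) \<longlongrightarrow> f p *\<^sub>R ?v) (tails D)"
      using sp by (intro tendsto_eventually) (auto simp: eventually_tails[OF dir])
    then have "blinfun_apply T ?v = f p *\<^sub>R ?v"
      using tendsto_unique[OF tails_not_bot[OF dir] T(2)] by blast
    then show "blinfun_apply (T o\<^sub>L p) h = blinfun_apply (f p *\<^sub>R p) h"
      by (simp add: blinfun.bilinear_simps)
  qed
  moreover have "T \<in> A"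
    using T(1) by (simp add: is_supremum_def self_adjoints_iff)
  ultimately show ?thesis
    by blast
qed

lemma ex_atom_value_real:
  fixes f :: "('h \<Rightarrow>\<^sub>L 'h) \<Rightarrow> real"
  assumes M: "M > 0" "\<And>p. p \<in> atoms A \<Longrightarrow> \<bar>f p\<bar> \<le> M"
  shows "\<exists>a\<in>A. \<forall>p\<in>atoms A. atom_value a p = complex_of_real (f p)"
proof -
  obtain a where a: "a \<in> A" "\<And>p. p \<in> atoms A \<Longrightarrow> a o\<^sub>L p = ((f p / M + 1) / 2) *\<^sub>R p"
    using ex_atom_value_unit_interval[of "\<lambda>p. (f p / M + 1) / 2"] M by (force simp: abs_le_iff field_simps)
  have "atom_value a p = complex_of_real ((f p / M + 1) / 2)" if "p \<in> atoms A" for p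
    using that by (intro atom_value_eqI) (simp_all add: a(2) scaleC_of_real del: of_real_divide of_real_add)
  then have "atom_value (complex_of_real (2 * M) *\<^sub>C a + complex_of_real (- M) *\<^sub>C id_blinfun) p = complex_of_real (f p)"
    if "p \<in> atoms A" for p
    using that a(1) M(1) by (simp add: atom_value_add atom_value_scaleC atom_value_id scaleC_mem field_simps)
  then show ?thesis
    using a(1) by (intro bexI[of _ "complex_of_real (2 * M) *\<^sub>C a + complex_of_real (- M) *\<^sub>C id_blinfun"])
      (auto intro!: add_mem scaleC_mem)
qed

lemma ex_atom_value:
  assumes "bounded (f ` atoms A)"
  shows "\<exists>a\<in>A. \<forall>p\<in>atoms A. atom_value a p = f p"
proof -
  obtain M where M: "M > 0" "\<And>p. p \<in> atoms A \<Longrightarrow> cmod (f p) \<le> M"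
    using assms by (auto simp: bounded_pos)
  have "\<bar>Re (f p)\<bar> \<le> M" "\<bar>Im (f p)\<bar> \<le> M" if "p \<in> atoms A" for p
    using M(2)[OF that] abs_Re_le_cmod[of "f p"] abs_Im_le_cmod[of "f p"] by linarith+
  then obtain a b where a: "a \<in> A" "\<And>p. p \<in> atoms A \<Longrightarrow> atom_value a p = complex_of_real (Re (f p))"
    and b: "b \<in> A" "\<And>p. p \<in> atoms A \<Longrightarrow> atom_value b p = complex_of_real (Im (f p))"
    using ex_atom_value_real[OF M(1), of "\<lambda>p. Re (f p)"] ex_atom_value_real[OF M(1), of "\<lambda>p. Im (f p)"] by metis
  then show ?thesis
    by (intro bexI[of _ "a + \<i> *\<^sub>C b"])
      (auto simp: atom_value_add atom_value_scaleC scaleC_mem complex_eq[symmetric] intro!: add_mem scaleC_mem)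
qed

lemma miu_isomorphism_atoms:
  "miu_isomorphism A (atoms A) (\<lambda>a. restrict (atom_value a) (atoms A))"
proof -
  have "bij_betw (\<lambda>a. restrict (atom_value a) (atoms A)) A (linfty (atoms A))"
  proof (rule bij_betw_imageI)
    show "inj_on (\<lambda>a. restrict (atom_value a) (atoms A)) A"
    proof (rule inj_onI)
      fix a b assume ab: "a \<in> A" "b \<in> A" "restrict (atom_value a) (atoms A) = restrict (atom_value b) (atoms A)"
      have "(a - b) o\<^sub>L p = 0" if "p \<in> atoms A" for p
      proof -
        have "atom_value a p = atom_value b p"
          using fun_cong[OF ab(3), of p] that by simp
        then show ?thesis
          using that ab by (simp add: blinfun_compose.diff_left atom_value)
      qed
      then have "a - b = 0"
        by (rule eq_zero_if_atoms[OF diff_mem[OF ab(1,2)]])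
      then show "a = b"
        by simp
    qed
    show "(\<lambda>a. restrict (atom_value a) (atoms A)) ` A = linfty (atoms A)"
    proof
      show "(\<lambda>a. restrict (atom_value a) (atoms A)) ` A \<subseteq> linfty (atoms A)"
        using atom_value_bound by (auto simp: linfty_def intro!: boundedI)
      show "linfty (atoms A) \<subseteq> (\<lambda>a. restrict (atom_value a) (atoms A)) ` A"
      proof
        fix f assume f: "f \<in> linfty (atoms A)"
        then obtain a where "a \<in> A" "\<forall>p\<in>atoms A. atom_value a p = f p"
          using ex_atom_value by (auto simp: linfty_def)
        moreover from this have "f = restrict (atom_value a) (atoms A)"
          using f by (intro extensionalityI[of _ "atoms A"]) (auto simp: linfty_def)
        ultimately show "f \<in> (\<lambda>a. restrict (atom_value a) (atoms A)) ` A"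
          by blast
      qed
    qed
  qed
  then show ?thesis
    unfolding miu_isomorphism_def
    by (simp add: atom_value_add atom_value_scaleC atom_value_comp atom_value_adj atom_value_id)
qed

end

sublocale duplicator_on \<subseteq> atomic_algebra A
  by standard (use comm ex_atom in blast)+

section \<open>Uniqueness of the duplicator\<close>

text \<open>The rank one operators on the range of e commute with S, hence T commutes with all of them.\<close>

lemma bicommutant_scalar:
  fixes e :: "'h::complex_hilbert \<Rightarrow>\<^sub>L 'h"
  assumes e: "proj e" and S: "S \<subseteq> complex_ops"
    and sc: "\<And>s. s \<in> S \<Longrightarrow> \<exists>c. s o\<^sub>L e = c *\<^sub>C e \<and> e o\<^sub>L s = c *\<^sub>C e"
    and T: "T \<in> commutant (commutant S)"
  shows "\<exists>\<tau>. T o\<^sub>L e = \<tau> *\<^sub>C e"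
proof (cases "e = 0")
  case True
  then show ?thesis
    by (auto intro!: exI[of _ 0] blinfun_eqI simp: scaleC_blinfun.rep_eq blinfun_compose.zero_right)
next
  case False
  then obtain h0 where h0: "blinfun_apply e h0 \<noteq> 0"
    by (metis blinfun_eqI zero_blinfun.rep_eq)
  define \<eta> where "\<eta> = blinfun_apply e h0"
  have \<eta>: "\<eta> \<noteq> 0" "blinfun_apply e \<eta> = \<eta>"
    using h0 proj_apply[OF e] by (auto simp: \<eta>_def)
  have "blinfun_apply T \<xi> = (cinner \<eta> (blinfun_apply T \<eta>) / cinner \<eta> \<eta>) *\<^sub>C \<xi>" if \<xi>: "blinfun_apply e \<xi> = \<xi>" for \<xi>
  proof -
    \<comment> \<open>The rank one operator from \<eta> to \<xi>. Evaluating R T = T R at \<eta>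
      expresses T \<xi> as a multiple of \<xi>, with a factor independent of \<xi>.\<close>
    define R where "R = Blinfun (\<lambda>h. cinner \<eta> h *\<^sub>C \<xi>)"
    have "bounded_linear (\<lambda>h. cinner \<eta> h *\<^sub>C \<xi>)"
    proof (rule bounded_linear_intro[of _ "norm \<eta> * norm \<xi>"])
      show "norm (cinner \<eta> x *\<^sub>C \<xi>) \<le> norm x * (norm \<eta> * norm \<xi>)" for x
        using mult_right_mono[OF cinner_bound[of \<eta> x], of "norm \<xi>"] by (simp add: mult_ac)
    qed (simp_all add: cinner_add_right scaleC_add_left scaleR_scaleC cinner_scaleC_right scaleC_scaleC)
    then have R: "blinfun_apply R h = cinner \<eta> h *\<^sub>C \<xi>" for h
      by (simp add: R_def bounded_linear_Blinfun_apply)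
    have "R \<in> commutant S"
    proof (rule commutantI)
      show "R \<in> complex_ops"
        by (simp add: complex_ops_def R cinner_scaleC_right scaleC_scaleC)
      fix s assume s: "s \<in> S"
      then have sc': "s \<in> complex_ops"
        using S by blast
      obtain c where c: "s o\<^sub>L e = c *\<^sub>C e" "e o\<^sub>L s = c *\<^sub>C e"
        using sc[OF s] by blast
      have "blinfun_apply s \<xi> = c *\<^sub>C \<xi>"
        using arg_cong[OF c(1), of "\<lambda>f. blinfun_apply f \<xi>"] \<xi> by (simp add: scaleC_blinfun.rep_eq)
      moreover have "cinner \<eta> (blinfun_apply s h) = c * cinner \<eta> h" for h
      proof -
        have "cinner \<eta> (blinfun_apply s h) = cinner \<eta> (blinfun_apply (e o\<^sub>L s) h)"
          using herm_cinner[OF proj_herm[OF e], of \<eta> "blinfun_apply s h"] \<eta> by simp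
        also have "\<dots> = c * cinner \<eta> h"
          using herm_cinner[OF proj_herm[OF e], of \<eta> h] \<eta> by (simp add: c(2) scaleC_blinfun.rep_eq cinner_scaleC_right)
        finally show ?thesis .
      qed
      ultimately show "s o\<^sub>L R = R o\<^sub>L s"
        by (intro blinfun_eqI) (simp add: R complex_ops_scaleC sc' scaleC_scaleC mult.commute)
    qed
    then have "blinfun_apply (R o\<^sub>L T) \<eta> = blinfun_apply (T o\<^sub>L R) \<eta>"
      using commutantD[OF T] by simp
    then have "cinner \<eta> (blinfun_apply T \<eta>) *\<^sub>C \<xi> = cinner \<eta> \<eta> *\<^sub>C blinfun_apply T \<xi>"
      using T commutant_ops[of "commutant S"] by (auto simp: R complex_ops_scaleC subset_iff)
    then have "(1 / cinner \<eta> \<eta>) *\<^sub>C cinner \<eta> (blinfun_apply T \<eta>) *\<^sub>C \<xi> = (1 / cinner \<eta> \<eta>) *\<^sub>C cinner \<eta> \<eta> *\<^sub>C blinfun_apply T \<xi>"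
      by simp
    then show ?thesis
      using \<eta>(1) by (simp add: scaleC_scaleC)
  qed
  then have "T o\<^sub>L e = (cinner \<eta> (blinfun_apply T \<eta>) / cinner \<eta> \<eta>) *\<^sub>C e"
    using proj_apply[OF e] by (intro blinfun_eqI) (simp add: scaleC_blinfun.rep_eq)
  then show ?thesis ..
qed

context duplicator_on
begin

text \<open>On p \<otimes> p a generator a \<otimes> b acts as the product of the two atom values;
  \<open>bicommutant_scalar\<close> passes this on to the double commutant.\<close>

lemma tensor_square_scalar:
  assumes p: "p \<in> atoms A" and T: "T \<in> spatial_tensor A A"
  shows "\<exists>\<tau>. T o\<^sub>L (p \<otimes>\<^sub>o p) = \<tau> *\<^sub>C (p \<otimes>\<^sub>o p)"
proof (rule bicommutant_scalar[OF _ spatial_tensor_generators(1)[OF vn vn] _ T[unfolded spatial_tensor_def]])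
  note p' = atomsD[OF p]
  show "proj (p \<otimes>\<^sub>o p)"
    using p' by (intro proj_op_tensor)
  fix s assume "s \<in> {a \<otimes>\<^sub>o b | a b. a \<in> A \<and> b \<in> A}"
  then obtain a b where ab: "a \<in> A" "b \<in> A" "s = a \<otimes>\<^sub>o b"
    by blast
  have "s o\<^sub>L (p \<otimes>\<^sub>o p) = (atom_value a p *\<^sub>C p) \<otimes>\<^sub>o (atom_value b p *\<^sub>C p)"
    using ab p' p by (simp add: op_tensor_comp ops atom_value)
  also have "\<dots> = (atom_value a p * atom_value b p) *\<^sub>C (p \<otimes>\<^sub>o p)"
    using p' by (auto simp: op_tensor_scaleC_left op_tensor_scaleC_right ops scaleC_blinfun.rep_eq scaleC_scaleC
        mult.commute intro!: blinfun_eqI)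
  finally have "s o\<^sub>L (p \<otimes>\<^sub>o p) = (atom_value a p * atom_value b p) *\<^sub>C (p \<otimes>\<^sub>o p)" .
  moreover have "(p \<otimes>\<^sub>o p) o\<^sub>L s = s o\<^sub>L (p \<otimes>\<^sub>o p)"
    unfolding ab(3) using ab p' by (intro tensor_commute)
  ultimately show "\<exists>c. s o\<^sub>L (p \<otimes>\<^sub>o p) = c *\<^sub>C (p \<otimes>\<^sub>o p) \<and> (p \<otimes>\<^sub>o p) o\<^sub>L s = c *\<^sub>C (p \<otimes>\<^sub>o p)"
    by metis
qed

text \<open>For a positive contraction T the remainder T - \<sigma> (p \<otimes> p) lies between 0
  and 1 - p \<otimes> p, so its image lies between 0 and 1 - p and is annihilated by p. The scalar
  is existentially quantified in the induction because summands bring their own; it equals \<tau>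
  since p \<otimes> p is nonzero.\<close>

lemma delta_atom:
  assumes p: "p \<in> atoms A" and T: "T \<in> spatial_tensor A A" "T o\<^sub>L (p \<otimes>\<^sub>o p) = \<tau> *\<^sub>C (p \<otimes>\<^sub>o p)"
  shows "\<delta> T o\<^sub>L p = \<tau> *\<^sub>C p"
proof -
  let ?e = "p \<otimes>\<^sub>o p"
  note p' = atomsD[OF p]
  have e: "?e \<in> spatial_tensor A A" "proj ?e" "\<delta> ?e = p"
    using p' by (auto simp: delta_tensor proj_idem intro!: tensor_mem proj_op_tensor)
  have e_nz: "?e \<noteq> 0"
    using e(3) delta_zero p'(3) by auto
  have "\<exists>\<sigma>. T o\<^sub>L ?e = \<sigma> *\<^sub>C ?e \<and> \<delta> T o\<^sub>L p = \<sigma> *\<^sub>C p"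
    using T(1)
  proof (induction rule: AA.contraction_induct)
    case (contraction T)
    obtain \<sigma> where \<sigma>: "T o\<^sub>L ?e = \<sigma> *\<^sub>C ?e"
      using tensor_square_scalar[OF p contraction(1)] by blast
    have Te: "adj (T o\<^sub>L ?e) = ?e o\<^sub>L T"
      using contraction e by (simp add: adj_comp AA.ops herm_adj op_pos_herm proj_herm)
    have "?e o\<^sub>L T = ?e o\<^sub>L (T o\<^sub>L ?e)"
    proof -
      have "?e o\<^sub>L T = cnj \<sigma> *\<^sub>C ?e"
        using Te e by (simp add: \<sigma> adj_scaleC AA.ops herm_adj proj_herm)
      then have "?e o\<^sub>L T = (?e o\<^sub>L T) o\<^sub>L ?e"
        by (simp add: comp_scaleC_left proj_idem e)
      then show ?thesis
        by (simp add: blinfun_compose_assoc)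
    qed
    also have "\<dots> = T o\<^sub>L ?e"
      unfolding \<sigma> using e by (simp add: comp_scaleC_right AA.ops proj_idem)
    finally have comm: "?e o\<^sub>L T = T o\<^sub>L ?e" .
    have pos: "op_pos (T o\<^sub>L (id_blinfun - ?e))" "op_pos ((id_blinfun - T) o\<^sub>L (id_blinfun - ?e))"
      using op_pos_comp[OF contraction(2) proj_pos[OF proj_compl[OF e(2)]]]
        op_pos_comp[OF contraction(3)[unfolded op_le_def] proj_pos[OF proj_compl[OF e(2)]]]
      by (simp_all add: blinfun_compose.diff_left blinfun_compose.diff_right comm)
    have eq: "T o\<^sub>L (id_blinfun - ?e) = T - \<sigma> *\<^sub>C ?e"
      by (simp add: blinfun_compose.diff_right \<sigma>)
    have "T - \<sigma> *\<^sub>C ?e \<le>\<^sub>o id_blinfun - ?e"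
      using pos(2) by (simp add: op_le_def blinfun_compose.diff_left flip: eq)
    then have "\<delta> (T - \<sigma> *\<^sub>C ?e) \<le>\<^sub>o id_blinfun - p"
      using delta_mono[of "T - \<sigma> *\<^sub>C ?e" "id_blinfun - ?e"] contraction e
      by (simp add: AA.diff_mem AA.scaleC_mem delta_diff delta_unit)
    moreover have "op_pos (\<delta> (T - \<sigma> *\<^sub>C ?e))"
      using pos(1) contraction e unfolding eq by (intro delta_pos AA.diff_mem AA.scaleC_mem)
    ultimately have "\<delta> (T - \<sigma> *\<^sub>C ?e) o\<^sub>L (id_blinfun - p) = \<delta> (T - \<sigma> *\<^sub>C ?e)"
      using op_pos_le_proj(1) proj_compl[OF p'(2)] by blast
    then have "(\<delta> T - \<sigma> *\<^sub>C p) o\<^sub>L p = 0"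
      using contraction e by (simp add: blinfun_compose.diff_right delta_diff delta_scaleC AA.scaleC_mem)
    then have "\<delta> T o\<^sub>L p = \<sigma> *\<^sub>C p"
      by (simp add: blinfun_compose.diff_left comp_scaleC_left proj_idem p')
    then show ?case
      using \<sigma> by blast
  next
    case (add S T)
    then obtain \<sigma> \<rho> where "S o\<^sub>L ?e = \<sigma> *\<^sub>C ?e" "\<delta> S o\<^sub>L p = \<sigma> *\<^sub>C p" "T o\<^sub>L ?e = \<rho> *\<^sub>C ?e" "\<delta> T o\<^sub>L p = \<rho> *\<^sub>C p"
      by blast
    then show ?case
      using add(1,2) by (intro exI[of _ "\<sigma> + \<rho>"])
        (auto simp: blinfun_compose.add_left delta_add scaleC_blinfun.rep_eq blinfun.bilinear_simps scaleC_add_left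
          intro!: blinfun_eqI)
  next
    case (scale c T)
    then obtain \<sigma> where "T o\<^sub>L ?e = \<sigma> *\<^sub>C ?e" "\<delta> T o\<^sub>L p = \<sigma> *\<^sub>C p"
      by blast
    then show ?case
      using scale(1) by (intro exI[of _ "c * \<sigma>"])
        (auto simp: comp_scaleC_left delta_scaleC scaleC_blinfun.rep_eq scaleC_scaleC intro!: blinfun_eqI)
  qed
  then obtain \<sigma> where \<sigma>: "T o\<^sub>L ?e = \<sigma> *\<^sub>C ?e" "\<delta> T o\<^sub>L p = \<sigma> *\<^sub>C p"
    by blast
  have "\<sigma> = \<tau>"
    using \<sigma>(1)[unfolded T(2)] scaleC_op_cancel e_nz by metis
  then show ?thesis
    using \<sigma>(2) by simp
qed

end

text \<open>Both maps yield the same scalar at each atom, and atoms separate the elements of A; off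
  the spatial tensor product extensionality fixes both.\<close>

lemma duplicator_unique:
  assumes vn: "von_neumann_algebra A" and dup: "duplicator A \<delta> u" "duplicator A \<delta>' u'"
  shows "\<delta> = \<delta>'" "u = u'"
proof -
  interpret D: duplicator_on A \<delta> u
    by standard (fact vn dup)+
  interpret D': duplicator_on A \<delta>' u'
    by standard (fact vn dup)+
  show "u = u'"
    using D.unit_eq_id D'.unit_eq_id by simp
  have "\<delta> T = \<delta>' T" if T: "T \<in> spatial_tensor A A" for T
  proof -
    have "(\<delta> T - \<delta>' T) o\<^sub>L p = 0" if p: "p \<in> atoms A" for p
    proof -
      obtain \<tau> where \<tau>: "T o\<^sub>L (p \<otimes>\<^sub>o p) = \<tau> *\<^sub>C (p \<otimes>\<^sub>o p)"
        using D.tensor_square_scalar[OF p T] by blast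
      then show ?thesis
        using D.delta_atom[OF p T \<tau>] D'.delta_atom[OF p T \<tau>] by (simp add: blinfun_compose.diff_left)
    qed
    then have "\<delta> T - \<delta>' T = 0"
      by (rule D.eq_zero_if_atoms[OF D.diff_mem[OF D.delta_mem[OF T] D'.delta_mem[OF T]]])
    then show ?thesis
      by simp
  qed
  moreover have "\<delta> \<in> spatial_tensor A A \<rightarrow>\<^sub>E A" "\<delta>' \<in> spatial_tensor A A \<rightarrow>\<^sub>E A"
    using dup by (auto simp: duplicator_def)
  ultimately show "\<delta> = \<delta>'"
    by (intro PiE_ext)
qed

section \<open>The duplicator on bounded functions\<close>

locale linfty_algebra = vn_algebra A for A :: "('h::complex_hilbert \<Rightarrow>\<^sub>L 'h) set" +
  fixes X :: "'x set" and \<phi>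
  assumes iso: "miu_isomorphism A X \<phi>"
begin

lemma phi_add: "x \<in> X \<Longrightarrow> a \<in> A \<Longrightarrow> b \<in> A \<Longrightarrow> \<phi> (a + b) x = \<phi> a x + \<phi> b x"
  and phi_scaleC: "x \<in> X \<Longrightarrow> a \<in> A \<Longrightarrow> \<phi> (c *\<^sub>C a) x = c * \<phi> a x"
  and phi_comp: "x \<in> X \<Longrightarrow> a \<in> A \<Longrightarrow> b \<in> A \<Longrightarrow> \<phi> (a o\<^sub>L b) x = \<phi> a x * \<phi> b x"
  and phi_adj: "x \<in> X \<Longrightarrow> a \<in> A \<Longrightarrow> \<phi> (adj a) x = cnj (\<phi> a x)"
  using iso by (auto simp: miu_isomorphism_def)

lemma phi_zero: "x \<in> X \<Longrightarrow> \<phi> 0 x = 0"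
  using phi_add[of x 0 0] by simp

lemma phi_eqI:
  assumes "a \<in> A" "b \<in> A" "\<And>x. x \<in> X \<Longrightarrow> \<phi> a x = \<phi> b x"
  shows "a = b"
proof -
  have bij: "bij_betw \<phi> A (linfty X)"
    using iso by (simp add: miu_isomorphism_def)
  then have "\<phi> a \<in> extensional X" "\<phi> b \<in> extensional X"
    using assms bij_betwE by (fastforce simp: linfty_def)+
  then have "\<phi> a = \<phi> b"
    using assms(3) by (rule extensionalityI)
  then show ?thesis
    using bij assms by (auto simp: bij_betw_def inj_on_def)
qed

lemma phi_surj:
  assumes "bounded (f ` X)"
  shows "\<exists>a\<in>A. \<forall>x\<in>X. \<phi> a x = f x"
proof -
  have "restrict f X \<in> linfty X"
    using assms by (simp add: linfty_def)
  moreover have "\<phi> ` A = linfty X"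
    using iso by (simp add: miu_isomorphism_def bij_betw_def)
  ultimately obtain a where "a \<in> A" "\<phi> a = restrict f X"
    by (metis imageE)
  then show ?thesis
    by (intro bexI[of _ a]) auto
qed

lemma phi_diff: "x \<in> X \<Longrightarrow> a \<in> A \<Longrightarrow> b \<in> A \<Longrightarrow> \<phi> (a - b) x = \<phi> a x - \<phi> b x"
  using phi_add[of x "a - b" b] by (simp add: diff_mem)

text \<open>The point evaluations are vector states, at unit vectors in the range of the preimages of the
  indicator functions of points.\<close>

lemma ex_eigenvector:
  assumes x: "x \<in> X"
  shows "\<exists>v. norm v = 1 \<and> (\<forall>a\<in>A. blinfun_apply a v = \<phi> a x *\<^sub>C v)"
proof -
  have "bounded ((\<lambda>y. if x = y then 1 else 0 :: complex) ` X)"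
    by (rule boundedI[of _ 1]) auto
  then obtain e where e: "e \<in> A" "\<And>y. y \<in> X \<Longrightarrow> \<phi> e y = (if x = y then 1 else 0)"
    using phi_surj by blast
  have "e \<noteq> 0"
    using e(2)[OF x] phi_zero[OF x] by auto
  then obtain h where h: "blinfun_apply e h \<noteq> 0"
    by (metis blinfun_eqI zero_blinfun.rep_eq)
  define v where "v = inverse (norm (blinfun_apply e h)) *\<^sub>R blinfun_apply e h"
  have "norm v = 1"
    using h by (simp add: v_def)
  moreover have "blinfun_apply a v = \<phi> a x *\<^sub>C v" if a: "a \<in> A" for a
  proof -
    have "a o\<^sub>L e = \<phi> a x *\<^sub>C e"
      using a e by (intro phi_eqI comp_mem scaleC_mem) (auto simp: phi_comp phi_scaleC)
    from arg_cong[OF this, of "\<lambda>f. blinfun_apply f h"] show ?thesis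
      by (simp add: v_def blinfun.bilinear_simps scaleC_blinfun.rep_eq scaleR_scaleC scaleC_scaleC mult.commute
          complex_ops_scaleC[OF ops[OF a]])
  qed
  ultimately show ?thesis
    by blast
qed

definition eigenvector :: "'x \<Rightarrow> 'h" where
  "eigenvector x = (SOME v. norm v = 1 \<and> (\<forall>a\<in>A. blinfun_apply a v = \<phi> a x *\<^sub>C v))"

lemma norm_eigenvector: "x \<in> X \<Longrightarrow> norm (eigenvector x) = 1"
  and apply_eigenvector: "x \<in> X \<Longrightarrow> a \<in> A \<Longrightarrow> blinfun_apply a (eigenvector x) = \<phi> a x *\<^sub>C eigenvector x"
  using someI_ex[OF ex_eigenvector] unfolding eigenvector_def by blast+

lemma cinner_eigenvector: "x \<in> X \<Longrightarrow> a \<in> A \<Longrightarrow> cinner (eigenvector x) (blinfun_apply a (eigenvector x)) = \<phi> a x"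
  by (simp add: apply_eigenvector cinner_scaleC_right cinner_self norm_eigenvector)

text \<open>Point evaluations are vector states, which gives nonnegative values. Conversely the
  square roots of the values form a bounded function; its preimage b satisfies a =
  \<open>adj b o\<^sub>L b\<close>.\<close>

lemma op_pos_iff_phi:
  assumes a: "a \<in> A"
  shows "op_pos a \<longleftrightarrow> (\<forall>x\<in>X. \<phi> a x \<in> \<real>\<^sub>\<ge>\<^sub>0)"
proof
  assume "op_pos a"
  then show "\<forall>x\<in>X. \<phi> a x \<in> \<real>\<^sub>\<ge>\<^sub>0"
    using a by (auto simp: op_pos_def simp flip: cinner_eigenvector)
next
  assume pos: "\<forall>x\<in>X. \<phi> a x \<in> \<real>\<^sub>\<ge>\<^sub>0"
  have "Re (\<phi> a x) \<le> norm a" if "x \<in> X" for x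
    using norm_blinfun[of a "eigenvector x"] complex_Re_le_cmod[of "\<phi> a x"] that a
    by (simp add: apply_eigenvector norm_eigenvector)
  then have "bounded ((\<lambda>x. complex_of_real (sqrt (Re (\<phi> a x)))) ` X)"
    by (intro boundedI[of _ "sqrt (norm a)"])
      (use pos in \<open>auto simp: complex_nonneg_Reals_iff\<close>)
  then obtain b where b: "b \<in> A" "\<And>x. x \<in> X \<Longrightarrow> \<phi> b x = complex_of_real (sqrt (Re (\<phi> a x)))"
    using phi_surj by blast
  have "adj b o\<^sub>L b = a"
  proof (rule phi_eqI)
    fix x assume x: "x \<in> X"
    have "complex_of_real (sqrt (Re (\<phi> a x))) * complex_of_real (sqrt (Re (\<phi> a x))) = \<phi> a x"
      using pos x by (auto simp: complex_nonneg_Reals_iff complex_eq_iff)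
    then show "\<phi> (adj b o\<^sub>L b) x = \<phi> a x"
      using b x by (simp add: phi_comp phi_adj adj_mem)
  qed (use a b in \<open>auto intro: comp_mem adj_mem\<close>)
  then show "op_pos a"
    using op_pos_adj_comp[OF ops[OF b(1)]] by simp
qed

section \<open>Diagonal states and the duplicator they define\<close>

definition state :: "'x \<Rightarrow> ('h, 'h) htensor" where
  "state x = eigenvector x \<otimes>\<^sub>h eigenvector x"

lemma norm_state: "x \<in> X \<Longrightarrow> norm (state x) = 1"
  by (simp add: state_def norm_tensor norm_eigenvector)

text \<open>Pairing T with the diagonal states restricts it to the diagonal. The values are bounded
  by the norm of T, so a preimage under \<phi> exists, and \<open>phi_eqI\<close> makes the choice
  unambiguous.\<close>

definition dupl :: "(('h, 'h) htensor \<Rightarrow>\<^sub>L ('h, 'h) htensor) \<Rightarrow> 'h \<Rightarrow>\<^sub>L 'h" where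
  "dupl = (\<lambda>T\<in>spatial_tensor A A.
     SOME a. a \<in> A \<and> (\<forall>x\<in>X. \<phi> a x = cinner (state x) (blinfun_apply T (state x))))"

lemma
  assumes "T \<in> spatial_tensor A A"
  shows dupl_mem: "dupl T \<in> A"
    and phi_dupl: "x \<in> X \<Longrightarrow> \<phi> (dupl T) x = cinner (state x) (blinfun_apply T (state x))"
proof -
  have "cmod (cinner (state x) (blinfun_apply T (state x))) \<le> norm T" if "x \<in> X" for x
    using cinner_bound[of "state x" "blinfun_apply T (state x)"] norm_blinfun[of T "state x"] norm_state[OF that]
    by simp
  then have "bounded ((\<lambda>x. cinner (state x) (blinfun_apply T (state x))) ` X)"
    by (intro boundedI[of _ "norm T"]) auto
  then have "\<exists>a. a \<in> A \<and> (\<forall>x\<in>X. \<phi> a x = cinner (state x) (blinfun_apply T (state x)))"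
    using phi_surj by blast
  from someI_ex[OF this] assms show "dupl T \<in> A"
    "x \<in> X \<Longrightarrow> \<phi> (dupl T) x = cinner (state x) (blinfun_apply T (state x))"
    by (auto simp: dupl_def)
qed

lemma dupl_tensor:
  assumes "a \<in> A" "b \<in> A"
  shows "dupl (a \<otimes>\<^sub>o b) = a o\<^sub>L b"
proof (rule phi_eqI)
  have mem: "a \<otimes>\<^sub>o b \<in> spatial_tensor A A"
    using assms by (intro op_tensor_mem vn)
  show "dupl (a \<otimes>\<^sub>o b) \<in> A"
    by (rule dupl_mem[OF mem])
  fix x assume x: "x \<in> X"
  show "\<phi> (dupl (a \<otimes>\<^sub>o b)) x = \<phi> (a o\<^sub>L b) x"
    using assms x by (simp add: phi_dupl[OF mem x] state_def op_tensor_apply ops cinner_tensor cinner_eigenvector phi_comp)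
qed (use assms comp_mem in blast)

lemma duplicator_dupl: "duplicator A dupl id_blinfun"
proof -
  interpret AA: vn_algebra "spatial_tensor A A"
    by standard (intro von_neumann_algebra_spatial_tensor vn)
  have add: "dupl (S + T) = dupl S + dupl T" if "S \<in> spatial_tensor A A" "T \<in> spatial_tensor A A" for S T
    by (rule phi_eqI)
      (use that in \<open>auto simp: phi_add phi_dupl dupl_mem AA.add_mem add_mem blinfun.bilinear_simps cinner_add_right\<close>)
  have scale: "dupl (c *\<^sub>C T) = c *\<^sub>C dupl T" if "T \<in> spatial_tensor A A" for c T
    by (rule phi_eqI)
      (use that in \<open>auto simp: phi_scaleC phi_dupl dupl_mem AA.scaleC_mem scaleC_mem scaleC_blinfun.rep_eq cinner_scaleC_right\<close>)
  have pos: "op_pos (dupl T)" if "T \<in> spatial_tensor A A" "op_pos T" for T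
    unfolding op_pos_iff_phi[OF dupl_mem[OF that(1)]] using that by (auto simp: phi_dupl op_pos_def)
  have diff: "dupl (S - T) = dupl S - dupl T" if "S \<in> spatial_tensor A A" "T \<in> spatial_tensor A A" for S T
    using add[OF AA.diff_mem[OF that] that(2)] by simp
  have mono: "dupl S \<le>\<^sub>o dupl T" if "S \<in> spatial_tensor A A" "T \<in> spatial_tensor A A" "S \<le>\<^sub>o T" for S T
    using that unfolding op_le_def by (simp add: diff[symmetric] pos AA.diff_mem)
  have herm: "herm (dupl T)" if "T \<in> spatial_tensor A A" "herm T" for T
  proof -
    have "adj (dupl T) = dupl T"
    proof (rule phi_eqI)
      fix x assume x: "x \<in> X"
      have "cnj (cinner (state x) (blinfun_apply T (state x))) = cinner (state x) (blinfun_apply T (state x))"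
        using Im_herm[OF that(2), of "state x"] by (simp add: complex_eq_iff)
      then show "\<phi> (adj (dupl T)) x = \<phi> (dupl T) x"
        using that x by (simp add: phi_adj phi_dupl dupl_mem)
    qed (use that dupl_mem adj_mem in auto)
    then show ?thesis
      using dupl_mem[OF that(1)] ops by (simp add: herm_iff_adj)
  qed
  have normal: "is_supremum A (dupl ` D) (dupl s)"
    if D: "D \<subseteq> self_adjoints (spatial_tensor A A)" "directed D" and s: "is_supremum (spatial_tensor A A) D s" for D s
  proof -
    have s': "s \<in> spatial_tensor A A" "herm s" "\<And>d. d \<in> D \<Longrightarrow> d \<le>\<^sub>o s"
      using s by (auto simp: is_supremum_def AA.self_adjoints_iff)
    have D': "d \<in> spatial_tensor A A" "herm d" if "d \<in> D" for d
      using D(1) that by (auto simp: AA.self_adjoints_iff)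
    have "dupl s \<le>\<^sub>o t" if t: "t \<in> A" "herm t" "\<And>d. d \<in> D \<Longrightarrow> dupl d \<le>\<^sub>o t" for t
    proof -
      have "\<phi> (t - dupl s) x \<in> \<real>\<^sub>\<ge>\<^sub>0" if x: "x \<in> X" for x
      proof -
        \<comment> \<open>The supremum s is the strong limit of D, so its value in each diagonal
          state is the limit of the values of the d, and the bound by t passes to s point by
          point.\<close>
        have lim: "((\<lambda>d. inner (state x) (blinfun_apply d (state x))) \<longlongrightarrow> inner (state x) (blinfun_apply s (state x))) (tails D)"
          by (intro tendsto_intros AA.is_supremum_tendsto[OF D s])
        have "inner (state x) (blinfun_apply s (state x)) \<le> Re (\<phi> t x)"
        proof (rule tendsto_upperbound[OF lim eventually_tails_mem[OF D(2)] tails_not_bot[OF D(2)]])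
          fix d assume d: "d \<in> D"
          have "t - dupl d \<in> A"
            using t D'[OF d] by (intro diff_mem dupl_mem)
          then have "\<phi> (t - dupl d) x \<in> \<real>\<^sub>\<ge>\<^sub>0"
            using t(3)[OF d] x by (simp add: op_le_def op_pos_iff_phi)
          then show "inner (state x) (blinfun_apply d (state x)) \<le> Re (\<phi> t x)"
            using t D'[OF d] x by (simp add: phi_diff dupl_mem phi_dupl complex_nonneg_Reals_iff inner_cinner)
        qed
        moreover have "herm (t - dupl s)" "t - dupl s \<in> A"
          using t s' by (auto intro: herm_diff herm diff_mem dupl_mem)
        then have "Im (\<phi> (t - dupl s) x) = 0"
          using Im_herm x by (metis cinner_eigenvector)
        ultimately show ?thesis
          using t s' x by (simp add: complex_nonneg_Reals_iff phi_diff dupl_mem phi_dupl inner_cinner)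
      qed
      then show ?thesis
        using t s' op_pos_iff_phi[of "t - dupl s"] by (simp add: op_le_def diff_mem dupl_mem)
    qed
    then show ?thesis
      using s' D' herm dupl_mem mono by (auto simp: is_supremum_def self_adjoints_iff)
  qed
  have "dupl \<in> spatial_tensor A A \<rightarrow>\<^sub>E A"
    using dupl_mem by (auto simp: dupl_def)
  moreover have "dupl id_blinfun = id_blinfun"
    using dupl_tensor[of id_blinfun id_blinfun] by (simp add: op_tensor_id)
  moreover have "normal_map (spatial_tensor A A) A dupl"
    using normal by (auto simp: normal_map_def)
  ultimately show ?thesis
    using add scale pos by (simp add: duplicator_def linear_map_def positive_map_def op_le_zero_iff dupl_tensor)
qed

end

lemma duplicable_if_miu_isomorphic_linfty:
  assumes "von_neumann_algebra A" "miu_isomorphic_linfty A X"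
  shows "duplicable A"
proof -
  obtain \<phi> where "miu_isomorphism A X \<phi>"
    using assms(2) by (auto simp: miu_isomorphic_linfty_def)
  then interpret linfty_algebra A X \<phi>
    by unfold_locales (use assms(1) in auto)
  show ?thesis
    using duplicator_dupl unfolding duplicable_def by blast
qed

text \<open>The equivalence fixes the type of X to that of operators, since the set of atoms of A
  serves as X; the second conjunct covers X of an arbitrary type, so the converse loses no
  generality.\<close>

theorem theorem2:
  fixes A :: "('h::complex_hilbert \<Rightarrow>\<^sub>L 'h) set"
  assumes "von_neumann_algebra A"
  shows "(duplicable A \<longleftrightarrow> (\<exists>X :: ('h \<Rightarrow>\<^sub>L 'h) set. miu_isomorphic_linfty A X)) \<and>
    ((\<exists>X :: 'x set. miu_isomorphic_linfty A X) \<longrightarrow> duplicable A) \<and>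
    (duplicable A \<longrightarrow>
      (\<exists>!p. duplicator A (fst p) (snd p)) \<and>
      (\<forall>\<delta> u. duplicator A \<delta> u \<longrightarrow>
        (\<forall>a\<in>A. \<forall>b\<in>A. \<delta> (a \<otimes>\<^sub>o b) = a o\<^sub>L b) \<and> u = id_blinfun))"
proof (intro conjI iffI impI allI ballI)
  show "duplicable A" if "\<exists>X :: ('h \<Rightarrow>\<^sub>L 'h) set. miu_isomorphic_linfty A X"
    using that duplicable_if_miu_isomorphic_linfty[OF assms] by blast
  show "duplicable A" if "\<exists>X :: 'x set. miu_isomorphic_linfty A X"
    using that duplicable_if_miu_isomorphic_linfty[OF assms] by blast
next
  assume "duplicable A"
  then obtain \<delta> u where dup: "duplicator A \<delta> u"
    by (auto simp: duplicable_def)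
  then interpret duplicator_on A \<delta> u
    by unfold_locales (use assms in auto)
  show "\<exists>X :: ('h \<Rightarrow>\<^sub>L 'h) set. miu_isomorphic_linfty A X"
    using miu_isomorphism_atoms unfolding miu_isomorphic_linfty_def by blast
  show "\<exists>!p. duplicator A (fst p) (snd p)"
  proof (rule ex1I[of _ "(\<delta>, u)"])
    show "p = (\<delta>, u)" if "duplicator A (fst p) (snd p)" for p
      using duplicator_unique[OF assms that dup] by (simp add: prod_eq_iff)
  qed (simp add: dup)
next
  fix \<delta> u
  assume "duplicator A \<delta> u"
  then interpret duplicator_on A \<delta> u
    by unfold_locales (use assms in auto)
  show "\<delta> (a \<otimes>\<^sub>o b) = a o\<^sub>L b" if "a \<in> A" "b \<in> A" for a b
    using that by (rule delta_tensor)
  show "u = id_blinfun"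
    by (rule unit_eq_id)
qed

end
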